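(* Let $A_1,A_2$ be compact metric spaces and $b_i,\ell_i:A_i\to\mathbb R$ ($i=1,2$) be continuous and bounded, such that $\{(b_i(\alpha_i),\ell_i(\alpha_i)):\alpha_i\in A_i\}$ is closed and convex and $B_i=\{-b_i(\alpha_i):\alpha_i\in A_i\}$ contains $[-\delta,\delta]$ for some $\delta>0$. Let $g:\mathbb R\to\mathbb R$ be globally Lipschitz continuous, and let $U^-,U^+,H_T,H_T^{\mathrm{reg}}$ be defined as in the context. Then $U^-$ is the unique $\check F_A$-solution with initial datum $g$ for $A=H_T$, and $U^+$ is the unique $\check F_A$-solution with initial datum $g$ for $A=H_T^{\mathrm{reg}}$.
   Context: Hamiltonians: $H_i(p)=\sup_{\alpha_i\in A_i}(-b_i(\alpha_i)p-\ell_i(\alpha_i))$, $i=1,2$; they are convex and coercive. $p_i^0$ is a minimum point of $H_i$; $H_1^+(q)=H_1(p_1^0)$ if $q\le p_1^0$, $H_1^+(q)=H_1(q)$ if $q>p_1^0$; $H_2^-(q)=H_2(q)$ if $q\le p_2^0$, $H_2^-(q)=H_2(p_2^0)$ if $q>p_2^0$. $\check F_A(q_1,q_2)=\max(A,H_1^+(q_1),H_2^-(q_2))$. Tangential quantities: $\hat A=A_1\times A_2\times[0,1]$; for $a=(\alpha_1,\alpha_2,\mu)\in\hat A$, $b_{\mathcal H}(a)=\mu b_1(\alpha_1)+(1-\mu)b_2(\alpha_2)$, $\ell_{\mathcal H}(a)=\mu\ell_1(\alpha_1)+(1-\mu)\ell_2(\alpha_2)$. $\hat A_0=\{a\in\hat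 A: b_{\mathcal H}(a)=0\}$, $\hat A_0^{\mathrm{reg}}=\{a\in\hat A: b_1(\alpha_1)\le0,\ b_2(\alpha_2)\ge0,\ b_{\mathcal H}(a)=0\}$. $H_T=\sup_{a\in\hat A_0}(-\ell_{\mathcal H}(a))$, $H_T^{\mathrm{reg}}=\sup_{a\in\hat A_0^{\mathrm{reg}}}(-\ell_{\mathcal H}(a))$. Value functions: for $a=(\alpha_1,\alpha_2,\mu)$, $b(x,a)=b_1(\alpha_1)$ if $x<0$, $b_2(\alpha_2)$ if $x>0$, $b_{\mathcal H}(a)$ if $x=0$; $\ell(x,a)=\ell_1(\alpha_1)$ if $x<0$, $\ell_2(\alpha_2)$ if $x>0$, $\ell_{\mathcal H}(a)$ if $x=0$. $\mathcal T_{t,x}$ is the set of $(X,a)\in\mathrm{Lip}(0,t;\mathbb R)\times L^\infty(0,t;\hat A)$ with $X(0)=x$ and $\dot X(s)=b(X(s),a(s))$ for a.e. $s\in(0,t)$; $\mathcal T_{t,x}^{reg}$ is the set of $(X,a)\in\mathcal T_{t,x}$ with $a(s)\in\hat A_0^{\mathrm{reg}}$ for a.e. $s\in(0,t)$ such that $X(s)=0$. Then $$U^-(x,t)=\inf_{(X,a)\in\mathcal T_{t,x}}\Big\{g(X(t))+\int_0^t\ell(X(s),a(s))ds\Big\},\quad U^+(x,t)=\inf_{(X,a)\in\mathcal T^{reg}_{t,x}}\Big\{g(X(t))+\int_0^t\ell(X(s),a(s))ds\Big\}.$$ $\check F_A$-solution with initial datum $g$: a function $u(t,x)$ (here $u(t,x)=U^\pm(x,t)$)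 that is a viscosity solution of $u_t+H_1(u_x)=0$ for $t>0,x<0$; $u_t+H_2(u_x)=0$ for $t>0,x>0$; $u_t+\check F_A(u_x(t,0^-),u_x(t,0^+))=0$ for $t>0,x=0$; with $u(0,\cdot)=g$. Precisely, test functions are continuous on $(0,+\infty)\times\mathbb R$ and $C^1$ on $(0,+\infty)\times(-\infty,0]$ and on $(0,+\infty)\times[0,+\infty)$; the inequality $\le0$ is required when a test function touches the upper semi-continuous envelope $u^*$ from above, and $\ge0$ when it touches the lower semi-continuous envelope $u_*$ from below; and $u^*(0,\cdot)\le g\le u_*(0,\cdot)$. *)

theory Defs
  imports "HOL-Analysis.Analysis"
begin

section \<open>Hamiltonians and flux function\<close>

definition hamiltonian :: "'a set \<Rightarrow> ('a \<Rightarrow> real) \<Rightarrow> ('a \<Rightarrow> real) \<Rightarrow> real \<Rightarrow> real" where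
  "hamiltonian A b l p = (SUP \<alpha>\<in>A. - b \<alpha> * p - l \<alpha>)"

definition incr_part :: "(real \<Rightarrow> real) \<Rightarrow> real \<Rightarrow> real \<Rightarrow> real" where
  "incr_part H p0 q = (if q \<le> p0 then H p0 else H q)"

definition decr_part :: "(real \<Rightarrow> real) \<Rightarrow> real \<Rightarrow> real \<Rightarrow> real" where
  "decr_part H p0 q = (if q \<le> p0 then H q else H p0)"

definition flux_limited ::
  "(real \<Rightarrow> real) \<Rightarrow> real \<Rightarrow> (real \<Rightarrow> real) \<Rightarrow> real \<Rightarrow> real \<Rightarrow> real \<Rightarrow> real \<Rightarrow> real" where
  "flux_limited H1 p1 H2 p2 A q1 q2 = max A (max (incr_part H1 p1 q1) (decr_part H2 p2 q2))"

section \<open>Controlled dynamics and value functions\<close>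

definition controls :: "'a set \<Rightarrow> 'b set \<Rightarrow> ('a \<times> 'b \<times> real) set" where
  "controls A1 A2 = A1 \<times> A2 \<times> {0..1}"

text \<open>The same interpolation and the same piecewise formula serve both for the dynamics
  (with \<open>f1 = b1\<close>, \<open>f2 = b2\<close>) and for the running cost (with \<open>f1 = l1\<close>, \<open>f2 = l2\<close>).\<close>

definition mix :: "('a \<Rightarrow> real) \<Rightarrow> ('b \<Rightarrow> real) \<Rightarrow> 'a \<times> 'b \<times> real \<Rightarrow> real" where
  "mix f1 f2 = (\<lambda>(\<alpha>1, \<alpha>2, \<mu>). \<mu> * f1 \<alpha>1 + (1 - \<mu>) * f2 \<alpha>2)"

definition piecewise ::
  "('a \<Rightarrow> real) \<Rightarrow> ('b \<Rightarrow> real) \<Rightarrow> real \<Rightarrow> 'a \<times> 'b \<times> real \<Rightarrow> real" where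
  "piecewise f1 f2 x = (\<lambda>(\<alpha>1, \<alpha>2, \<mu>).
     if x < 0 then f1 \<alpha>1 else if x > 0 then f2 \<alpha>2 else mix f1 f2 (\<alpha>1, \<alpha>2, \<mu>))"

definition controls0 ::
  "'a set \<Rightarrow> 'b set \<Rightarrow> ('a \<Rightarrow> real) \<Rightarrow> ('b \<Rightarrow> real) \<Rightarrow> ('a \<times> 'b \<times> real) set" where
  "controls0 A1 A2 b1 b2 = {a \<in> controls A1 A2. mix b1 b2 a = 0}"

definition controls0_reg ::
  "'a set \<Rightarrow> 'b set \<Rightarrow> ('a \<Rightarrow> real) \<Rightarrow> ('b \<Rightarrow> real) \<Rightarrow> ('a \<times> 'b \<times> real) set" where
  "controls0_reg A1 A2 b1 b2 =
     {(\<alpha>1, \<alpha>2, \<mu>) \<in> controls A1 A2. b1 \<alpha>1 \<le> 0 \<and> b2 \<alpha>2 \<ge> 0 \<and> mix b1 b2 (\<alpha>1, \<alpha>2, \<mu>) = 0}"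

definition H_T :: "'a set \<Rightarrow> 'b set \<Rightarrow> ('a \<Rightarrow> real) \<Rightarrow> ('a \<Rightarrow> real)
    \<Rightarrow> ('b \<Rightarrow> real) \<Rightarrow> ('b \<Rightarrow> real) \<Rightarrow> real" where
  "H_T A1 A2 b1 l1 b2 l2 = (SUP a\<in>controls0 A1 A2 b1 b2. - mix l1 l2 a)"

definition H_T_reg :: "'a set \<Rightarrow> 'b set \<Rightarrow> ('a \<Rightarrow> real) \<Rightarrow> ('a \<Rightarrow> real)
    \<Rightarrow> ('b \<Rightarrow> real) \<Rightarrow> ('b \<Rightarrow> real) \<Rightarrow> real" where
  "H_T_reg A1 A2 b1 l1 b2 l2 = (SUP a\<in>controls0_reg A1 A2 b1 b2. - mix l1 l2 a)"

text \<open>A class in \<open>L\<^sup>\<infinity>(0,t)\<close> with values in the compact set \<open>controls A1 A2\<close> is given by a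
  Lebesgue measurable representative with values in that set.\<close>

definition trajectories ::
  "'a::metric_space set \<Rightarrow> 'b::metric_space set \<Rightarrow> ('a \<Rightarrow> real) \<Rightarrow> ('b \<Rightarrow> real) \<Rightarrow> real \<Rightarrow> real
    \<Rightarrow> ((real \<Rightarrow> real) \<times> (real \<Rightarrow> 'a \<times> 'b \<times> real)) set" where
  "trajectories A1 A2 b1 b2 t x = {(X, a).
     (\<exists>L. L-lipschitz_on {0..t} X) \<and>
     a \<in> lebesgue_on {0<..<t} \<rightarrow>\<^sub>M restrict_space borel (controls A1 A2) \<and>
     X 0 = x \<and>
     (AE s in lebesgue_on {0<..<t}.
        (X has_real_derivative piecewise b1 b2 (X s) (a s)) (at s))}"

definition trajectories_reg ::
  "'a::metric_space set \<Rightarrow> 'b::metric_space set \<Rightarrow> ('a \<Rightarrow> real) \<Rightarrow> ('b \<Rightarrow> real) \<Rightarrow> real \<Rightarrow> real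
    \<Rightarrow> ((real \<Rightarrow> real) \<times> (real \<Rightarrow> 'a \<times> 'b \<times> real)) set" where
  "trajectories_reg A1 A2 b1 b2 t x = {(X, a) \<in> trajectories A1 A2 b1 b2 t x.
     AE s in lebesgue_on {0<..<t}. X s = 0 \<longrightarrow> a s \<in> controls0_reg A1 A2 b1 b2}"

definition total_cost :: "('a \<Rightarrow> real) \<Rightarrow> ('b \<Rightarrow> real) \<Rightarrow> (real \<Rightarrow> real) \<Rightarrow> real
    \<Rightarrow> (real \<Rightarrow> real) \<times> (real \<Rightarrow> 'a \<times> 'b \<times> real) \<Rightarrow> real" where
  "total_cost l1 l2 g t = (\<lambda>(X, a).
     g (X t) + (LINT s|lebesgue_on {0<..<t}. piecewise l1 l2 (X s) (a s)))"

definition U_minus :: "'a::metric_space set \<Rightarrow> 'b::metric_space set \<Rightarrow> ('a \<Rightarrow> real) \<Rightarrow> ('a \<Rightarrow> real)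
    \<Rightarrow> ('b \<Rightarrow> real) \<Rightarrow> ('b \<Rightarrow> real) \<Rightarrow> (real \<Rightarrow> real) \<Rightarrow> real \<Rightarrow> real \<Rightarrow> real" where
  "U_minus A1 A2 b1 l1 b2 l2 g x t =
     (INF Xa\<in>trajectories A1 A2 b1 b2 t x. total_cost l1 l2 g t Xa)"

definition U_plus :: "'a::metric_space set \<Rightarrow> 'b::metric_space set \<Rightarrow> ('a \<Rightarrow> real) \<Rightarrow> ('a \<Rightarrow> real)
    \<Rightarrow> ('b \<Rightarrow> real) \<Rightarrow> ('b \<Rightarrow> real) \<Rightarrow> (real \<Rightarrow> real) \<Rightarrow> real \<Rightarrow> real \<Rightarrow> real" where
  "U_plus A1 A2 b1 l1 b2 l2 g x t =
     (INF Xa\<in>trajectories_reg A1 A2 b1 b2 t x. total_cost l1 l2 g t Xa)"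

section \<open>Viscosity solutions with a flux condition at the origin\<close>

text \<open>Points are pairs \<open>(t, x)\<close>. Functions are total on \<open>real \<times> real\<close>, but only their values on
  \<open>time_space\<close> matter; in particular the envelopes see nothing of \<open>t < 0\<close>.\<close>

definition time_space :: "(real \<times> real) set" where
  "time_space = {0..} \<times> UNIV"

text \<open>The filter does not exclude \<open>z\<close> itself, so these are the upper and lower semicontinuous
  envelopes. They take values in \<open>ereal\<close> but are finite for locally bounded functions.\<close>

definition usc_env :: "(real \<times> real \<Rightarrow> real) \<Rightarrow> real \<times> real \<Rightarrow> ereal" where
  "usc_env u z = Limsup (inf (nhds z) (principal time_space)) (\<lambda>w. ereal (u w))"

definition lsc_env :: "(real \<times> real \<Rightarrow> real) \<Rightarrow> real \<times> real \<Rightarrow> ereal" where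
  "lsc_env u z = Liminf (inf (nhds z) (principal time_space)) (\<lambda>w. ereal (u w))"

definition locally_bounded :: "(real \<times> real \<Rightarrow> real) \<Rightarrow> bool" where
  "locally_bounded u \<longleftrightarrow> (\<forall>K. compact K \<and> K \<subseteq> time_space \<longrightarrow> bounded (u ` K))"

text \<open>Up to the boundary: derivatives are taken within \<open>S\<close>, with continuous partial
  derivatives \<open>p\<close> (in time) and \<open>q\<close> (in space).\<close>

definition C1_on :: "(real \<times> real) set \<Rightarrow> (real \<times> real \<Rightarrow> real) \<Rightarrow> bool" where
  "C1_on S \<phi> \<longleftrightarrow> (\<exists>p q. continuous_on S p \<and> continuous_on S q \<and>
     (\<forall>z\<in>S. (\<phi> has_derivative (\<lambda>h. p z * fst h + q z * snd h)) (at z within S)))"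

definition test_function :: "(real \<times> real \<Rightarrow> real) \<Rightarrow> bool" where
  "test_function \<phi> \<longleftrightarrow> continuous_on ({0<..} \<times> UNIV) \<phi> \<and>
     C1_on ({0<..} \<times> {..0}) \<phi> \<and> C1_on ({0<..} \<times> {0..}) \<phi>"

definition time_deriv :: "(real \<times> real \<Rightarrow> real) \<Rightarrow> real \<Rightarrow> real \<Rightarrow> real" where
  "time_deriv \<phi> t x = deriv (\<lambda>s. \<phi> (s, x)) t"

definition space_deriv :: "(real \<times> real \<Rightarrow> real) \<Rightarrow> real \<Rightarrow> real \<Rightarrow> real" where
  "space_deriv \<phi> t x = deriv (\<lambda>y. \<phi> (t, y)) x"

definition left_slope :: "(real \<times> real \<Rightarrow> real) \<Rightarrow> real \<Rightarrow> real" where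
  "left_slope \<phi> t = vector_derivative (\<lambda>y. \<phi> (t, y)) (at_left 0)"

definition right_slope :: "(real \<times> real \<Rightarrow> real) \<Rightarrow> real \<Rightarrow> real" where
  "right_slope \<phi> t = vector_derivative (\<lambda>y. \<phi> (t, y)) (at_right 0)"

text \<open>Left-hand side of the equation, evaluated on a test function.\<close>

definition junction_lhs :: "(real \<Rightarrow> real) \<Rightarrow> (real \<Rightarrow> real) \<Rightarrow> (real \<Rightarrow> real \<Rightarrow> real)
    \<Rightarrow> (real \<times> real \<Rightarrow> real) \<Rightarrow> real \<Rightarrow> real \<Rightarrow> real" where
  "junction_lhs H1 H2 F \<phi> t x = time_deriv \<phi> t x +
     (if x < 0 then H1 (space_deriv \<phi> t x)
      else if x > 0 then H2 (space_deriv \<phi> t x)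
      else F (left_slope \<phi> t) (right_slope \<phi> t))"

definition touches_from_above ::
  "(real \<times> real \<Rightarrow> real) \<Rightarrow> (real \<times> real \<Rightarrow> ereal) \<Rightarrow> real \<times> real \<Rightarrow> bool" where
  "touches_from_above \<phi> w z \<longleftrightarrow>
     ereal (\<phi> z) = w z \<and> (\<forall>\<^sub>F y in nhds z. w y \<le> ereal (\<phi> y))"

definition touches_from_below ::
  "(real \<times> real \<Rightarrow> real) \<Rightarrow> (real \<times> real \<Rightarrow> ereal) \<Rightarrow> real \<times> real \<Rightarrow> bool" where
  "touches_from_below \<phi> w z \<longleftrightarrow>
     ereal (\<phi> z) = w z \<and> (\<forall>\<^sub>F y in nhds z. ereal (\<phi> y) \<le> w y)"

text \<open>Local boundedness is the usual standing convention for discontinuous viscosity solutions.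
  It keeps the envelopes finite; where they are infinite no test function can touch, so that
  without it uniqueness would fail trivially.\<close>

definition junction_solution :: "(real \<Rightarrow> real) \<Rightarrow> (real \<Rightarrow> real) \<Rightarrow> (real \<Rightarrow> real \<Rightarrow> real)
    \<Rightarrow> (real \<Rightarrow> real) \<Rightarrow> (real \<times> real \<Rightarrow> real) \<Rightarrow> bool" where
  "junction_solution H1 H2 F g u \<longleftrightarrow>
     locally_bounded u \<and>
     (\<forall>\<phi> t x. test_function \<phi> \<and> t > 0 \<and> touches_from_above \<phi> (usc_env u) (t, x)
        \<longrightarrow> junction_lhs H1 H2 F \<phi> t x \<le> 0) \<and>
     (\<forall>\<phi> t x. test_function \<phi> \<and> t > 0 \<and> touches_from_below \<phi> (lsc_env u) (t, x)
        \<longrightarrow> junction_lhs H1 H2 F \<phi> t x \<ge> 0) \<and>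
     (\<forall>x. usc_env u (0, x) \<le> ereal (g x) \<and> ereal (g x) \<le> lsc_env u (0, x))"

definition unique_junction_solution :: "(real \<Rightarrow> real) \<Rightarrow> (real \<Rightarrow> real)
    \<Rightarrow> (real \<Rightarrow> real \<Rightarrow> real) \<Rightarrow> (real \<Rightarrow> real) \<Rightarrow> (real \<times> real \<Rightarrow> real) \<Rightarrow> bool" where
  "unique_junction_solution H1 H2 F g u \<longleftrightarrow>
     junction_solution H1 H2 F g u \<and>
     (\<forall>v. junction_solution H1 H2 F g v \<longrightarrow> (\<forall>z\<in>time_space. v z = u z))"

end

theory Submission
  imports Defs
begin

text \<open>The proof rests on a description of subsolutions without derivatives, in which \<open>t\<close> is the time
  that remains. A function \<open>w\<close> of \<open>(t, x)\<close> satisfies the elementary moves if its value is at most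
  the running cost of a move plus the value of \<open>w\<close> where the move ends. A move is a straight motion
  with constant control inside one closed half-line, or a rest at the junction at the
  price \<open>- A\<close> per unit of time.

  For a subsolution \<open>v\<close>, the upper envelope of \<open>v\<close> satisfies the moves (\<open>subsolution_moves\<close>): each
  of them is a linear transport inequality implied by the equation, and coercivity allows a
  test function to forbid the half-lines that the motion does not use.

  Any trajectory costs at least as much as three moves. Before its first and after its last visit to
  the junction it stays in one half-line, where convexity of the set of pairs (velocity, cost)
  allows to replace it by a straight motion. Between these visits the Fenchel inequality, with the
  minimum points of the Hamiltonians as slopes, bounds the cost from below by \<open>- A\<close> per unit of
  time. Hence a function that satisfies the moves and starts below \<open>g\<close> lies below the value function
  (\<open>moves_le_V\<close>), and so does every subsolution.

  Conversely the value function \<open>V\<close> satisfies the moves, by dynamic programming, and it is Lipschitz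
  continuous because every point can be reached with a positive speed. The moves are affine
  inequalities, so they survive averaging. Averages of \<open>V\<close> taken over windows inside one half-line
  are smooth up to the junction, and with a time window much longer than the spatial one the
  two halves can be glued to an approximate classical subsolution. It serves directly as a
  test function for a supersolution, which must therefore lie above \<open>V\<close> (\<open>comparison\<close>). Finite
  speed of propagation localizes this argument to a cone, so that no growth condition enters. Together
  the two bounds give uniqueness.

  That \<open>V\<close> itself is a solution follows from dynamic programming: the moves give the subsolution
  property, and the lower bound for the cost of nearly optimal trajectories gives the supersolution
  property (\<open>V_junction_solution\<close>).

  Both value functions are treated at once. The controls admitted at the junction form a set \<open>Z\<close>
  between the regular ones and all tangential ones, and \<open>A\<close> is the supremum of minus the mixed cost over
  \<open>Z\<close>.\<close>

section \<open>Hamiltonians of a control problem on a half-line\<close>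

locale half_line_control =
  fixes A :: "'a set" and b l :: "'a \<Rightarrow> real" and \<delta> :: real
  assumes bounded_b: "bounded (b ` A)" and bounded_l: "bounded (l ` A)"
    and closed_graph: "closed ((\<lambda>\<alpha>. (b \<alpha>, l \<alpha>)) ` A)"
    and convex_graph: "convex ((\<lambda>\<alpha>. (b \<alpha>, l \<alpha>)) ` A)"
    and delta_pos: "\<delta> > 0" and controllable: "{-\<delta>..\<delta>} \<subseteq> (\<lambda>\<alpha>. - b \<alpha>) ` A"
begin

abbreviation H :: "real \<Rightarrow> real" where "H \<equiv> hamiltonian A b l"

lemma velocity_exists: "\<bar>v\<bar> \<le> \<delta> \<Longrightarrow> \<exists>\<alpha>\<in>A. b \<alpha> = v"
proof -
  assume "\<bar>v\<bar> \<le> \<delta>"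
  then have "- v \<in> {-\<delta>..\<delta>}" by auto
  then have "- v \<in> (\<lambda>\<alpha>. - b \<alpha>) ` A" using controllable by blast
  then show ?thesis by auto
qed

lemma nonempty: "A \<noteq> {}"
  using velocity_exists[of 0] delta_pos by auto

lemma bdd_above_affine: "bdd_above ((\<lambda>\<alpha>. - b \<alpha> * q - l \<alpha>) ` A)"
proof -
  obtain B where B: "\<And>\<alpha>. \<alpha> \<in> A \<Longrightarrow> \<bar>b \<alpha>\<bar> \<le> B" using bounded_b by (auto simp: bounded_iff)
  obtain L where L: "\<And>\<alpha>. \<alpha> \<in> A \<Longrightarrow> \<bar>l \<alpha>\<bar> \<le> L" using bounded_l by (auto simp: bounded_iff)
  have "- b \<alpha> * q - l \<alpha> \<le> B * \<bar>q\<bar> + L" if "\<alpha> \<in> A" for \<alpha>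
  proof -
    have "- b \<alpha> * q \<le> \<bar>b \<alpha>\<bar> * \<bar>q\<bar>" by (metis abs_ge_minus_self abs_mult mult_minus_left)
    also have "\<dots> \<le> B * \<bar>q\<bar>" using B[OF that] by (intro mult_right_mono) auto
    finally show ?thesis using L[OF that] by linarith
  qed
  then show ?thesis by (auto intro!: bdd_aboveI)
qed

lemma ham_ge: "\<alpha> \<in> A \<Longrightarrow> - b \<alpha> * q - l \<alpha> \<le> H q"
  unfolding hamiltonian_def by (rule cSUP_upper[OF _ bdd_above_affine])

lemma ham_le: "(\<And>\<alpha>. \<alpha> \<in> A \<Longrightarrow> - b \<alpha> * q - l \<alpha> \<le> M) \<Longrightarrow> H q \<le> M"
  unfolding hamiltonian_def using nonempty by (intro cSUP_least) auto

lemma ham_shift_le: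
  assumes "\<And>\<alpha>. \<alpha> \<in> A \<Longrightarrow> \<bar>b \<alpha>\<bar> \<le> C"
  shows "H (q + r) \<le> H q + C * \<bar>r\<bar>"
proof (rule ham_le)
  fix \<alpha> assume a: "\<alpha> \<in> A"
  have "- b \<alpha> * r \<le> \<bar>b \<alpha>\<bar> * \<bar>r\<bar>" by (metis abs_ge_minus_self abs_mult mult_minus_left)
  also have "\<dots> \<le> C * \<bar>r\<bar>" using assms[OF a] by (intro mult_right_mono) auto
  finally show "- b \<alpha> * (q + r) - l \<alpha> \<le> H q + C * \<bar>r\<bar>"
    using ham_ge[OF a, of q] by (simp add: algebra_simps)
qed

text \<open>Both velocities \<open>\<plusminus> \<delta>\<close> are available, which makes \<open>H\<close> grow at least like \<open>\<delta> \<bar>q\<bar>\<close>.\<close>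

lemma ham_coercive: "\<exists>K\<ge>0. \<forall>q. \<bar>q\<bar> \<ge> K \<longrightarrow> M < H q"
proof -
  obtain \<alpha>1 where 1: "\<alpha>1 \<in> A" "b \<alpha>1 = \<delta>" using velocity_exists[of \<delta>] delta_pos by auto
  obtain \<alpha>2 where 2: "\<alpha>2 \<in> A" "b \<alpha>2 = - \<delta>" using velocity_exists[of "-\<delta>"] delta_pos by auto
  define m where "m = \<bar>M\<bar> + \<bar>l \<alpha>1\<bar> + \<bar>l \<alpha>2\<bar> + 1"
  have "M < H q" if "\<bar>q\<bar> \<ge> m / \<delta>" for q
  proof -
    have "m \<le> \<delta> * \<bar>q\<bar>" using that delta_pos by (simp add: field_simps)
    then show ?thesis
      using ham_ge[OF 1(1), of q] ham_ge[OF 2(1), of q] 1(2) 2(2)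
      by (cases "q \<ge> 0") (auto simp: m_def abs_if split: if_splits)
  qed
  moreover have "m / \<delta> \<ge> 0" using delta_pos by (simp add: m_def)
  ultimately show ?thesis by blast
qed

text \<open>Convex duality in one dimension: \<open>- min H\<close> is the least running cost at velocity zero. If \<open>(0, - min H)\<close> were missing from the closed convex set of pairs (velocity, cost), the
  slope of a separating line would be a momentum at which \<open>H\<close> is below its minimum.\<close>

lemma resting_control:
  assumes min: "is_arg_min H (\<lambda>_. True) p"
  shows "\<exists>\<alpha>\<in>A. b \<alpha> = 0 \<and> - l \<alpha> = H p"
proof -
  let ?S = "(\<lambda>\<alpha>. (b \<alpha>, l \<alpha>)) ` A"
  have minp: "H p \<le> H q" for q using min by (auto simp: is_arg_min_linorder)
  have "(0, - H p) \<in> ?S"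
  proof (rule ccontr)
    assume "(0, - H p) \<notin> ?S"
    from separating_hyperplane_closed_point[OF convex_graph closed_graph this]
    obtain n c where n: "n \<bullet> (0, - H p) < c" "\<forall>s\<in>?S. c < n \<bullet> s" by auto
    obtain n1 n2 where nn: "n = (n1, n2)" by (cases n)
    have lo: "- (n2 * H p) < c" using n(1) by (simp add: nn)
    have hi: "c < n1 * b \<alpha> + n2 * l \<alpha>" if "\<alpha> \<in> A" for \<alpha> using n(2) that by (auto simp: nn)
    obtain \<alpha>0 where a0: "\<alpha>0 \<in> A" "b \<alpha>0 = 0" using velocity_exists[of 0] delta_pos by auto
    show False
    proof (cases "n2 > 0")
      case True
      have "H (n1 / n2) \<le> - c / n2"
      proof (rule ham_le)
        fix \<alpha> assume "\<alpha> \<in> A"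
        then show "- b \<alpha> * (n1 / n2) - l \<alpha> \<le> - c / n2"
          using mult_strict_left_mono[OF hi[of \<alpha>] True] True by (simp add: field_simps)
      qed
      also have "\<dots> < H p" using lo True by (simp add: field_simps)
      finally show False using minp[of "n1 / n2"] by simp
    next
      case False
      have "n2 * (l \<alpha>0 + H p) > 0" using hi[OF a0(1)] a0(2) lo by (simp add: algebra_simps)
      moreover have "l \<alpha>0 + H p \<ge> 0" using ham_ge[OF a0(1), of p] a0(2) by simp
      ultimately show False using False
        by (metis linorder_not_less mult_nonpos_nonneg)
    qed
  qed
  then show ?thesis by force
qed

lemma incr_part_eq: "incr_part H p q = H (max q p)"
  by (auto simp: incr_part_def max_def)

lemma decr_part_eq: "decr_part H p q = H (min q p)"
  by (auto simp: decr_part_def min_def)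

text \<open>Controls with velocity of the other sign do not contribute to the monotone parts: beyond
  the minimum point of \<open>H\<close> they are dominated by standing still.\<close>

lemma incr_part_le:
  assumes "is_arg_min H (\<lambda>_. True) p"
    and "\<And>\<alpha>. \<alpha> \<in> A \<Longrightarrow> b \<alpha> \<le> 0 \<Longrightarrow> - b \<alpha> * q - l \<alpha> \<le> M"
  shows "incr_part H p q \<le> M"
proof -
  obtain \<alpha>0 where a0: "\<alpha>0 \<in> A" "b \<alpha>0 = 0" "- l \<alpha>0 = H p" using resting_control[OF assms(1)] by blast
  have *: "H p \<le> M" using assms(2)[OF a0(1)] a0 by simp
  show ?thesis
  proof (cases "q \<le> p")
    case True then show ?thesis using * by (simp add: incr_part_def)
  next
    case False
    have "H q \<le> M"
    proof (rule ham_le)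
      fix \<alpha> assume a: "\<alpha> \<in> A"
      show "- b \<alpha> * q - l \<alpha> \<le> M"
      proof (cases "b \<alpha> \<le> 0")
        case True then show ?thesis using assms(2) a by blast
      next
        case bpos: False
        have "b \<alpha> * p \<le> b \<alpha> * q" using bpos False by (intro mult_left_mono) auto
        then show ?thesis using ham_ge[OF a, of p] * by simp
      qed
    qed
    then show ?thesis using False by (simp add: incr_part_def)
  qed
qed

lemma decr_part_le:
  assumes "is_arg_min H (\<lambda>_. True) p"
    and "\<And>\<alpha>. \<alpha> \<in> A \<Longrightarrow> 0 \<le> b \<alpha> \<Longrightarrow> - b \<alpha> * q - l \<alpha> \<le> M"
  shows "decr_part H p q \<le> M"
proof -
  obtain \<alpha>0 where a0: "\<alpha>0 \<in> A" "b \<alpha>0 = 0" "- l \<alpha>0 = H p" using resting_control[OF assms(1)] by blast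
  have *: "H p \<le> M" using assms(2)[OF a0(1)] a0 by simp
  show ?thesis
  proof (cases "q \<le> p")
    case False then show ?thesis using * by (simp add: decr_part_def)
  next
    case True
    have "H q \<le> M"
    proof (rule ham_le)
      fix \<alpha> assume a: "\<alpha> \<in> A"
      show "- b \<alpha> * q - l \<alpha> \<le> M"
      proof (cases "0 \<le> b \<alpha>")
        case True then show ?thesis using assms(2) a by blast
      next
        case bneg: False
        have "b \<alpha> * p \<le> b \<alpha> * q" using bneg True by (intro mult_left_mono_neg) auto
        then show ?thesis using ham_ge[OF a, of p] * by simp
      qed
    qed
    then show ?thesis using True by (simp add: decr_part_def)
  qed
qed

lemma incr_part_ge:
  assumes "\<alpha> \<in> A" "b \<alpha> \<le> 0" shows "- b \<alpha> * q - l \<alpha> \<le> incr_part H p q"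
proof -
  have "b \<alpha> * max q p \<le> b \<alpha> * q" using assms(2) by (intro mult_left_mono_neg) auto
  then show ?thesis using ham_ge[OF assms(1), of "max q p"] by (simp add: incr_part_eq)
qed

lemma decr_part_ge:
  assumes "\<alpha> \<in> A" "0 \<le> b \<alpha>" shows "- b \<alpha> * q - l \<alpha> \<le> decr_part H p q"
proof -
  have "b \<alpha> * min q p \<le> b \<alpha> * q" using assms(2) by (intro mult_left_mono) auto
  then show ?thesis using ham_ge[OF assms(1), of "min q p"] by (simp add: decr_part_eq)
qed

lemma monotone_parts_le_ham:
  assumes "is_arg_min H (\<lambda>_. True) p"
  shows "incr_part H p q \<le> H q" "decr_part H p q \<le> H q"
  using assms by (auto simp: incr_part_def decr_part_def is_arg_min_linorder)

end

section \<open>Test functions glued from two half-lines\<close>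

text \<open>The test functions constructed below consist of two functions that are \<open>C\<^sup>1\<close> on the whole plane and
  agree at \<open>x = 0\<close>, so that no one-sided derivative has to be computed for them.\<close>

definition has_partials ::
  "(real \<times> real \<Rightarrow> real) \<Rightarrow> (real \<times> real \<Rightarrow> real) \<Rightarrow> (real \<times> real \<Rightarrow> real) \<Rightarrow> bool" where
  "has_partials \<phi> p q \<longleftrightarrow> continuous_on UNIV p \<and> continuous_on UNIV q \<and>
     (\<forall>z. (\<phi> has_derivative (\<lambda>h. p z * fst h + q z * snd h)) (at z))"

definition glue :: "(real \<times> real \<Rightarrow> real) \<Rightarrow> (real \<times> real \<Rightarrow> real) \<Rightarrow> real \<times> real \<Rightarrow> real" where
  "glue \<phi>L \<phi>R z = (if snd z \<le> 0 then \<phi>L z else \<phi>R z)"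

lemma has_partials_add:
  assumes "has_partials f p q" "has_partials g p' q'"
  shows "has_partials (\<lambda>z. f z + g z) (\<lambda>z. p z + p' z) (\<lambda>z. q z + q' z)"
  using assms unfolding has_partials_def
  by (auto intro!: continuous_intros derivative_eq_intros simp: algebra_simps fun_eq_iff)

lemma has_partials_cmult:
  assumes "has_partials f p q"
  shows "has_partials (\<lambda>z. c * f z) (\<lambda>z. c * p z) (\<lambda>z. c * q z)"
  using assms unfolding has_partials_def
  by (auto intro!: continuous_intros derivative_eq_intros simp: algebra_simps fun_eq_iff)

lemma has_partials_continuous: "has_partials f p q \<Longrightarrow> continuous_on S f"
  unfolding has_partials_def
  by (meson continuous_at_imp_continuous_on has_derivative_continuous)

abbreviation left_space :: "(real \<times> real) set" where "left_space \<equiv> {0<..} \<times> {..0}"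
abbreviation right_space :: "(real \<times> real) set" where "right_space \<equiv> {0<..} \<times> {0..}"

lemma time_deriv_eq:
  fixes J :: "real set"
  assumes d: "(\<phi> has_derivative (\<lambda>h. p * fst h + q * snd h)) (at (t, x) within {0<..} \<times> J)"
    and "t > 0" "x \<in> J"
  shows "time_deriv \<phi> t x = p"
proof -
  have i: "((\<lambda>s. (s, x)) has_derivative (\<lambda>h. (h, 0))) (at t within {0<..})"
    by (auto intro!: derivative_eq_intros)
  have "(\<phi> has_derivative (\<lambda>h. p * fst h + q * snd h)) (at (t, x) within (\<lambda>s. (s, x)) ` {0<..})"
    by (rule has_derivative_subset[OF d]) (use assms in auto)
  from has_derivative_in_compose[OF i this]
  have "((\<lambda>s. \<phi> (s, x)) has_derivative (\<lambda>h. p * h)) (at t within {0<..})" by simp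
  then have "((\<lambda>s. \<phi> (s, x)) has_field_derivative p) (at t)"
    using assms by (simp add: has_field_derivative_def at_within_open[of t "{0<..}"])
  then show ?thesis unfolding time_deriv_def by (rule DERIV_imp_deriv)
qed

lemma slice_derivative:
  fixes J :: "real set"
  assumes d: "(\<phi> has_derivative (\<lambda>h. p * fst h + q * snd h)) (at (t, x) within {0<..} \<times> J)"
    and "t > 0"
  shows "((\<lambda>y. \<phi> (t, y)) has_field_derivative q) (at x within J)"
proof -
  have i: "((\<lambda>y. (t, y)) has_derivative (\<lambda>h. (0, h))) (at x within J)"
    by (auto intro!: derivative_eq_intros)
  have "(\<phi> has_derivative (\<lambda>h. p * fst h + q * snd h)) (at (t, x) within (\<lambda>y. (t, y)) ` J)"
    by (rule has_derivative_subset[OF d]) (use assms in auto)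
  from has_derivative_in_compose[OF i this]
  show ?thesis by (simp add: has_field_derivative_def)
qed

lemma space_deriv_eq:
  fixes J :: "real set"
  assumes d: "(\<phi> has_derivative (\<lambda>h. p * fst h + q * snd h)) (at (t, x) within {0<..} \<times> J)"
    and "t > 0" "x \<in> interior J"
  shows "space_deriv \<phi> t x = q"
  using slice_derivative[OF d assms(2)] at_within_interior[OF assms(3)]
  unfolding space_deriv_def by (auto intro: DERIV_imp_deriv)

lemma left_slope_eq:
  assumes "(\<phi> has_derivative (\<lambda>h. p * fst h + q * snd h)) (at (t, 0) within left_space)" "t > 0"
  shows "left_slope \<phi> t = q"
proof -
  have "((\<lambda>y. \<phi> (t, y)) has_field_derivative q) (at 0 within {..<0})"
    using slice_derivative[OF assms] by (rule has_field_derivative_subset) auto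
  then show ?thesis unfolding left_slope_def
    by (intro vector_derivative_within)
      (auto simp: has_real_derivative_iff_has_vector_derivative)
qed

lemma right_slope_eq:
  assumes "(\<phi> has_derivative (\<lambda>h. p * fst h + q * snd h)) (at (t, 0) within right_space)" "t > 0"
  shows "right_slope \<phi> t = q"
proof -
  have "((\<lambda>y. \<phi> (t, y)) has_field_derivative q) (at 0 within {0<..})"
    using slice_derivative[OF assms] by (rule has_field_derivative_subset) auto
  then show ?thesis unfolding right_slope_def
    by (intro vector_derivative_within)
      (auto simp: has_real_derivative_iff_has_vector_derivative)
qed

lemma junction_lhs_left:
  assumes d: "(\<phi> has_derivative (\<lambda>h. p * fst h + q * snd h)) (at (t, x) within left_space)"
    and "t > 0" "x < 0"
  shows "junction_lhs H1 H2 F \<phi> t x = p + H1 q"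
  using time_deriv_eq[OF d] space_deriv_eq[OF d] assms by (simp add: junction_lhs_def)

lemma junction_lhs_right:
  assumes d: "(\<phi> has_derivative (\<lambda>h. p * fst h + q * snd h)) (at (t, x) within right_space)"
    and "t > 0" "x > 0"
  shows "junction_lhs H1 H2 F \<phi> t x = p + H2 q"
  using time_deriv_eq[OF d] space_deriv_eq[OF d] assms by (simp add: junction_lhs_def)

lemma junction_lhs_zero:
  assumes L: "(\<phi> has_derivative (\<lambda>h. p * fst h + qL * snd h)) (at (t, 0) within left_space)"
    and R: "(\<phi> has_derivative (\<lambda>h. p' * fst h + qR * snd h)) (at (t, 0) within right_space)"
    and "t > 0"
  shows "junction_lhs H1 H2 F \<phi> t 0 = p + F qL qR" "p' = p"
  using time_deriv_eq[OF L] time_deriv_eq[OF R] left_slope_eq[OF L] right_slope_eq[OF R] assms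
  by (simp_all add: junction_lhs_def)

context
  fixes \<phi>L pL qL \<phi>R pR qR :: "real \<times> real \<Rightarrow> real"
  assumes L: "has_partials \<phi>L pL qL" and R: "has_partials \<phi>R pR qR"
    and agree: "\<And>t. \<phi>L (t, 0) = \<phi>R (t, 0)"
begin

lemma glue_derivative_left:
  assumes "z \<in> left_space"
  shows "(glue \<phi>L \<phi>R has_derivative (\<lambda>h. pL z * fst h + qL z * snd h)) (at z within left_space)"
proof (rule has_derivative_transform[OF assms])
  show "(\<phi>L has_derivative (\<lambda>h. pL z * fst h + qL z * snd h)) (at z within left_space)"
    using L unfolding has_partials_def by (blast intro: has_derivative_at_withinI)
qed (auto simp: glue_def)

lemma glue_derivative_right:
  assumes "z \<in> right_space"
  shows "(glue \<phi>L \<phi>R has_derivative (\<lambda>h. pR z * fst h + qR z * snd h)) (at z within right_space)"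
proof (rule has_derivative_transform[OF assms])
  show "(\<phi>R has_derivative (\<lambda>h. pR z * fst h + qR z * snd h)) (at z within right_space)"
    using R unfolding has_partials_def by (blast intro: has_derivative_at_withinI)
  show "glue \<phi>L \<phi>R z = \<phi>R z" if "z \<in> right_space" for z
    using that agree[of "fst z"] by (cases z) (auto simp: glue_def)
qed

lemma glue_continuous: "continuous_on UNIV (glue \<phi>L \<phi>R)"
proof -
  have "continuous_on UNIV (\<lambda>z. if snd z \<le> (0::real) then \<phi>L z else \<phi>R z)"
    by (rule continuous_on_cases_le)
      (use has_partials_continuous[OF L] has_partials_continuous[OF R] agree
       in \<open>auto intro!: continuous_intros\<close>)
  then show ?thesis by (simp add: glue_def[abs_def])
qed

lemma glue_test_function: "test_function (glue \<phi>L \<phi>R)"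
  unfolding test_function_def C1_on_def
proof (intro conjI exI ballI)
  show "continuous_on ({0<..} \<times> UNIV) (glue \<phi>L \<phi>R)"
    using glue_continuous continuous_on_subset by blast
  show "continuous_on left_space pL" "continuous_on left_space qL"
    "continuous_on right_space pR" "continuous_on right_space qR"
    using L R continuous_on_subset by (auto simp: has_partials_def)
qed (blast intro: glue_derivative_left glue_derivative_right)+

lemma glue_lhs:
  assumes "t > 0"
  shows "x < 0 \<Longrightarrow> junction_lhs H1 H2 F (glue \<phi>L \<phi>R) t x = pL (t, x) + H1 (qL (t, x))"
    and "x > 0 \<Longrightarrow> junction_lhs H1 H2 F (glue \<phi>L \<phi>R) t x = pR (t, x) + H2 (qR (t, x))"
    and "junction_lhs H1 H2 F (glue \<phi>L \<phi>R) t 0 = pL (t, 0) + F (qL (t, 0)) (qR (t, 0))"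
  using junction_lhs_left[OF glue_derivative_left] junction_lhs_right[OF glue_derivative_right]
    junction_lhs_zero(1)[OF glue_derivative_left glue_derivative_right] assms by auto

end

section \<open>Semicontinuous envelopes\<close>

text \<open>Semicontinuity and extrema only refer to \<open>time_space\<close>, since values at negative times are
  arbitrary. For locally bounded functions the envelopes are finite, so that nothing is lost by
  passing to real values.\<close>

definition usc :: "(real \<times> real \<Rightarrow> real) \<Rightarrow> bool" where
  "usc w \<longleftrightarrow> (\<forall>z\<in>time_space. \<forall>c>w z. \<forall>\<^sub>F y in nhds z. y \<in> time_space \<longrightarrow> w y < c)"

definition upper :: "(real \<times> real \<Rightarrow> real) \<Rightarrow> real \<times> real \<Rightarrow> real" where
  "upper v z = real_of_ereal (usc_env v z)"

definition lower :: "(real \<times> real \<Rightarrow> real) \<Rightarrow> real \<times> real \<Rightarrow> real" where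
  "lower v z = real_of_ereal (lsc_env v z)"

lemma eventually_time_space:
  "eventually P (inf (nhds z) (principal time_space)) \<longleftrightarrow>
   (\<forall>\<^sub>F y in nhds z. y \<in> time_space \<longrightarrow> P y)"
  by (simp add: eventually_inf_principal)

lemma le_usc_env:
  assumes "z \<in> time_space" shows "ereal (v z) \<le> usc_env v z"
proof (rule ccontr)
  assume "\<not> ereal (v z) \<le> usc_env v z"
  then have "Limsup (inf (nhds z) (principal time_space)) (\<lambda>w. ereal (v w)) < ereal (v z)"
    by (simp add: usc_env_def)
  then have "\<forall>\<^sub>F y in nhds z. y \<in> time_space \<longrightarrow> ereal (v y) < ereal (v z)"
    unfolding eventually_time_space[symmetric] by (rule Limsup_lessD)
  from eventually_nhds_x_imp_x[OF this] show False using assms by simp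
qed

lemma usc_env_le:
  assumes "\<forall>\<^sub>F y in nhds z. y \<in> time_space \<longrightarrow> v y \<le> c"
  shows "usc_env v z \<le> ereal c"
  unfolding usc_env_def by (rule Limsup_bounded, unfold eventually_time_space) (use assms in simp)

lemma locally_bounded_near:
  assumes "locally_bounded v" "z \<in> time_space"
  shows "\<exists>B. \<forall>\<^sub>F y in nhds z. y \<in> time_space \<longrightarrow> \<bar>v y\<bar> \<le> B"
proof -
  have "closed (time_space)" unfolding time_space_def
    by (rule closed_Times[OF closed_atLeast closed_UNIV])
  then have "compact (cball z 1 \<inter> time_space)" by (rule compact_Int_closed[OF compact_cball])
  moreover have "cball z 1 \<inter> time_space \<subseteq> time_space" by (rule Int_lower2)
  ultimately have "bounded (v ` (cball z 1 \<inter> time_space))"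
    using assms(1) unfolding locally_bounded_def by blast
  then obtain B where "\<forall>x\<in>v ` (cball z 1 \<inter> time_space). norm x \<le> B"
    unfolding bounded_iff by blast
  then have B: "\<And>y. y \<in> cball z 1 \<inter> time_space \<Longrightarrow> \<bar>v y\<bar> \<le> B" by simp
  have "\<forall>\<^sub>F y in nhds z. y \<in> ball z 1" by (rule eventually_nhds_in_open[OF open_ball]) simp
  moreover have "y \<in> time_space \<longrightarrow> \<bar>v y\<bar> \<le> B" if "y \<in> ball z 1" for y
    using B[of y] subsetD[OF ball_subset_cball that] by blast
  ultimately have "\<forall>\<^sub>F y in nhds z. y \<in> time_space \<longrightarrow> \<bar>v y\<bar> \<le> B"
    by (rule eventually_mono)
  then show ?thesis by blast
qed

lemma ereal_upper:
  assumes "locally_bounded v" "z \<in> time_space"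
  shows "ereal (upper v z) = usc_env v z"
proof -
  obtain B where "\<forall>\<^sub>F y in nhds z. y \<in> time_space \<longrightarrow> \<bar>v y\<bar> \<le> B"
    using locally_bounded_near[OF assms] by blast
  then have "\<forall>\<^sub>F y in nhds z. y \<in> time_space \<longrightarrow> v y \<le> B"
    by (rule eventually_mono) auto
  then have "usc_env v z \<le> ereal B" by (rule usc_env_le)
  moreover have "ereal (v z) \<le> usc_env v z" by (rule le_usc_env[OF assms(2)])
  ultimately have "\<bar>usc_env v z\<bar> \<noteq> \<infinity>" by (cases "usc_env v z") simp_all
  then show ?thesis unfolding upper_def by (rule ereal_real')
qed

lemma le_upper:
  assumes "locally_bounded v" "z \<in> time_space" shows "v z \<le> upper v z"
proof -
  have "ereal (v z) \<le> ereal (upper v z)"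
    unfolding ereal_upper[OF assms] by (rule le_usc_env[OF assms(2)])
  then show ?thesis by simp
qed

lemma upper_usc:
  assumes "locally_bounded v" shows "usc (upper v)"
  unfolding usc_def
proof (intro ballI allI impI)
  fix z c assume z: "z \<in> time_space" and c: "upper v z < c"
  obtain d where d: "upper v z < d" "d < c" using dense[OF c] by blast
  have "Limsup (inf (nhds z) (principal time_space)) (\<lambda>w. ereal (v w)) < ereal d"
    using d(1) ereal_upper[OF assms z, symmetric] by (simp add: usc_env_def)
  then have "\<forall>\<^sub>F y in nhds z. y \<in> time_space \<longrightarrow> ereal (v y) < ereal d"
    unfolding eventually_time_space[symmetric] by (rule Limsup_lessD)
  then have "\<forall>\<^sub>F x in nhds z. \<forall>\<^sub>F y in nhds x. y \<in> time_space \<longrightarrow> v y \<le> d"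
    unfolding eventually_eventually by (rule eventually_mono) auto
  then show "\<forall>\<^sub>F y in nhds z. y \<in> time_space \<longrightarrow> upper v y < c"
  proof (rule eventually_mono, intro impI)
    fix x assume "\<forall>\<^sub>F y in nhds x. y \<in> time_space \<longrightarrow> v y \<le> d" and x: "x \<in> time_space"
    then have "ereal (upper v x) \<le> ereal d" using usc_env_le ereal_upper[OF assms x] by simp
    then show "upper v x < c" using d(2) by simp
  qed
qed

lemma lsc_env_uminus: "lsc_env v z = - usc_env (\<lambda>z. - v z) z"
proof -
  have "usc_env (\<lambda>z. - v z) z =
      Limsup (inf (nhds z) (principal time_space)) (\<lambda>w. - ereal (v w))"
    unfolding usc_env_def by simp
  also have "\<dots> = - lsc_env v z" unfolding lsc_env_def by (rule ereal_Limsup_uminus)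
  finally show ?thesis by simp
qed

lemma lower_uminus: "lower v z = - upper (\<lambda>z. - v z) z"
  by (simp add: lower_def upper_def lsc_env_uminus)

lemma locally_bounded_uminus: "locally_bounded v \<Longrightarrow> locally_bounded (\<lambda>z. - v z)"
  unfolding locally_bounded_def bounded_iff by simp

lemma ereal_lower:
  assumes "locally_bounded v" "z \<in> time_space"
  shows "ereal (lower v z) = lsc_env v z"
  using ereal_upper[OF locally_bounded_uminus[OF assms(1)] assms(2), symmetric]
  by (simp add: lower_uminus lsc_env_uminus)

lemma lower_le: "locally_bounded v \<Longrightarrow> z \<in> time_space \<Longrightarrow> lower v z \<le> v z"
  using le_upper[OF locally_bounded_uminus, of v z] by (simp add: lower_uminus)

lemma upper_continuous:
  assumes "continuous_on time_space v" "z \<in> time_space"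
  shows "usc_env v z = ereal (v z)"
proof (rule antisym)
  show "usc_env v z \<le> ereal (v z)"
  proof (rule ereal_le_epsilon2)
    fix e :: real assume "e > 0"
    have "\<forall>\<^sub>F y in nhds z. y \<in> time_space \<longrightarrow> v y \<le> v z + e"
    proof -
      obtain d where d: "d > 0" "\<And>y. y \<in> time_space \<Longrightarrow> dist y z < d \<Longrightarrow> dist (v y) (v z) < e"
        using assms \<open>e > 0\<close> unfolding continuous_on_iff by metis
      have "\<forall>\<^sub>F y in nhds z. y \<in> ball z d" by (rule eventually_nhds_in_open) (use d in auto)
      then show ?thesis
      proof (rule eventually_mono, intro impI)
        fix y assume "y \<in> ball z d" "y \<in> time_space"
        then have "dist (v y) (v z) < e" using d(2) by (simp add: dist_commute)
        then show "v y \<le> v z + e" by (auto simp: dist_real_def)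
      qed
    qed
    from usc_env_le[OF this] show "usc_env v z \<le> ereal (v z) + ereal e" by simp
  qed
qed (rule le_usc_env[OF assms(2)])

lemma lower_continuous:
  assumes "continuous_on time_space v" "z \<in> time_space"
  shows "lsc_env v z = ereal (v z)"
  using upper_continuous[of "\<lambda>z. - v z" z] assms
  by (simp add: lsc_env_uminus continuous_on_minus)

text \<open>If the supremum were not attained, the strict sublevel sets at values of \<open>f\<close> would form an
  open cover without a finite subcover.\<close>

lemma usc_attains_max:
  fixes f :: "'x::topological_space \<Rightarrow> real"
  assumes "compact K" "K \<noteq> {}"
    and f: "\<And>z c. z \<in> K \<Longrightarrow> f z < c \<Longrightarrow> \<forall>\<^sub>F y in nhds z. y \<in> K \<longrightarrow> f y < c"
  shows "\<exists>z\<in>K. \<forall>y\<in>K. f y \<le> f z"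
proof (rule ccontr)
  assume "\<not> ?thesis"
  then obtain s where s: "\<And>z. z \<in> K \<Longrightarrow> s z \<in> K \<and> f z < f (s z)"
    by (metis linorder_not_less)
  have "\<exists>T. open T \<and> z \<in> T \<and> (\<forall>y\<in>T. y \<in> K \<longrightarrow> f y < f (s z))" if "z \<in> K" for z
    using f[OF that, of "f (s z)"] s[OF that] by (auto simp: eventually_nhds)
  then obtain T where T: "\<And>z. z \<in> K \<Longrightarrow> open (T z) \<and> z \<in> T z \<and> (\<forall>y\<in>T z. y \<in> K \<longrightarrow> f y < f (s z))"
    by metis
  obtain C where C: "C \<subseteq> K" "finite C" "K \<subseteq> (\<Union>z\<in>C. T z)"
    using compactE_image[OF assms(1), of K T] T by blast
  with assms(2) have "C \<noteq> {}" by auto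
  define m where "m = Max ((\<lambda>z. f (s z)) ` C)"
  have "m \<in> (\<lambda>z. f (s z)) ` C" unfolding m_def using C \<open>C \<noteq> {}\<close> by (intro Max_in) auto
  then obtain k where k: "k \<in> C" "m = f (s k)" by auto
  then have "s k \<in> K" using s C by auto
  then obtain j where j: "j \<in> C" "s k \<in> T j" using C(3) by auto
  then have "f (s k) < f (s j)" using T C(1) \<open>s k \<in> K\<close> by blast
  moreover have "f (s j) \<le> m" unfolding m_def using C j by (intro Max_ge) auto
  ultimately show False using k by simp
qed

lemma usc_diff_attains_max:
  assumes w: "usc w" and \<phi>: "continuous_on UNIV \<phi>" and K: "compact K" "K \<noteq> {}" "K \<subseteq> time_space"
  shows "\<exists>z\<in>K. \<forall>y\<in>K. w y - \<phi> y \<le> w z - \<phi> z"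
proof (rule usc_attains_max[OF K(1,2)])
  fix z c assume z: "z \<in> K" and c: "w z - \<phi> z < c"
  define e where "e = (c - (w z - \<phi> z)) / 2"
  have e: "e > 0" using c by (simp add: e_def)
  have 1: "\<forall>\<^sub>F y in nhds z. y \<in> time_space \<longrightarrow> w y < w z + e"
    using w z K(3) e unfolding usc_def by (meson less_add_same_cancel1 subsetD)
  have "(\<phi> \<longlongrightarrow> \<phi> z) (nhds z)"
    using \<phi> unfolding continuous_on_eq_continuous_at[OF open_UNIV] isCont_def
      tendsto_at_iff_tendsto_nhds by blast
  then have 2: "\<forall>\<^sub>F y in nhds z. \<phi> z - e < \<phi> y" using e by (intro order_tendstoD(1)) auto
  from 1 2 show "\<forall>\<^sub>F y in nhds z. y \<in> K \<longrightarrow> w y - \<phi> y < c"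
  proof eventually_elim
    case (elim y)
    show ?case
    proof
      assume "y \<in> K"
      then have "w y < w z + e" using elim K(3) by auto
      then show "w y - \<phi> y < c" using elim(2) by (simp add: e_def field_simps)
    qed
  qed
qed

text \<open>The part of the notion of solution that is used for uniqueness: real-valued functions, glued test
  functions, and contact expressed by increments, so that additive constants do not matter.\<close>

definition glued_subsolution :: "(real \<Rightarrow> real) \<Rightarrow> (real \<Rightarrow> real) \<Rightarrow> (real \<Rightarrow> real \<Rightarrow> real) \<Rightarrow>
    (real \<times> real \<Rightarrow> real) \<Rightarrow> bool" where
  "glued_subsolution H1 H2 F w \<longleftrightarrow> usc w \<and>
     (\<forall>\<phi>L pL qL \<phi>R pR qR t x. has_partials \<phi>L pL qL \<longrightarrow> has_partials \<phi>R pR qR \<longrightarrow>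
        (\<forall>s. \<phi>L (s, 0) = \<phi>R (s, 0)) \<longrightarrow> t > 0 \<longrightarrow>
        (\<forall>\<^sub>F y in nhds (t, x). w y - glue \<phi>L \<phi>R y \<le> w (t, x) - glue \<phi>L \<phi>R (t, x)) \<longrightarrow>
        (x < 0 \<longrightarrow> pL (t, x) + H1 (qL (t, x)) \<le> 0) \<and>
        (x > 0 \<longrightarrow> pR (t, x) + H2 (qR (t, x)) \<le> 0) \<and>
        (x = 0 \<longrightarrow> pL (t, 0) + F (qL (t, 0)) (qR (t, 0)) \<le> 0))"

definition glued_supersolution :: "(real \<Rightarrow> real) \<Rightarrow> (real \<Rightarrow> real) \<Rightarrow> (real \<Rightarrow> real \<Rightarrow> real) \<Rightarrow>
    (real \<times> real \<Rightarrow> real) \<Rightarrow> bool" where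
  "glued_supersolution H1 H2 F w \<longleftrightarrow> usc (\<lambda>z. - w z) \<and>
     (\<forall>\<phi>L pL qL \<phi>R pR qR t x. has_partials \<phi>L pL qL \<longrightarrow> has_partials \<phi>R pR qR \<longrightarrow>
        (\<forall>s. \<phi>L (s, 0) = \<phi>R (s, 0)) \<longrightarrow> t > 0 \<longrightarrow>
        (\<forall>\<^sub>F y in nhds (t, x). glue \<phi>L \<phi>R y - w y \<le> glue \<phi>L \<phi>R (t, x) - w (t, x)) \<longrightarrow>
        (x < 0 \<longrightarrow> 0 \<le> pL (t, x) + H1 (qL (t, x))) \<and>
        (x > 0 \<longrightarrow> 0 \<le> pR (t, x) + H2 (qR (t, x))) \<and>
        (x = 0 \<longrightarrow> 0 \<le> pL (t, 0) + F (qL (t, 0)) (qR (t, 0))))"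

lemma has_partials_add_const: "has_partials f p q \<Longrightarrow> has_partials (\<lambda>z. f z + c) p q"
  unfolding has_partials_def by (auto intro!: has_derivative_add_const)

lemma eventually_positive_time:
  assumes "t > 0" shows "\<forall>\<^sub>F y in nhds (t, x::real). y \<in> time_space"
proof -
  have "open ({0::real<..} \<times> (UNIV :: real set))" by (intro open_Times) auto
  then have "\<forall>\<^sub>F y in nhds (t, x). y \<in> {0<..} \<times> UNIV"
    using assms by (intro eventually_nhds_in_open) auto
  then show ?thesis by (rule eventually_mono) (auto simp: time_space_def)
qed

lemma junction_solution_subsolution:
  assumes sol: "junction_solution H1 H2 F g v"
  shows "glued_subsolution H1 H2 F (upper v)"
  unfolding glued_subsolution_def
proof (intro conjI allI impI)
  have lb: "locally_bounded v" using sol by (simp add: junction_solution_def)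
  show "usc (upper v)" by (rule upper_usc[OF lb])
  fix \<phi>L pL qL \<phi>R pR qR t x
  assume L: "has_partials \<phi>L pL qL" and R: "has_partials \<phi>R pR qR"
    and agree: "\<forall>s. \<phi>L (s, 0) = \<phi>R (s, 0)" and t: "t > 0"
    and touch: "\<forall>\<^sub>F y in nhds (t, x). upper v y - glue \<phi>L \<phi>R y \<le> upper v (t, x) - glue \<phi>L \<phi>R (t, x)"
  define c where "c = upper v (t, x) - glue \<phi>L \<phi>R (t, x)"
  define \<psi>L \<psi>R where "\<psi>L = (\<lambda>z. \<phi>L z + c)" and "\<psi>R = (\<lambda>z. \<phi>R z + c)"
  have L': "has_partials \<psi>L pL qL" and R': "has_partials \<psi>R pR qR"
    unfolding \<psi>L_def \<psi>R_def using L R by (auto intro: has_partials_add_const)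
  have agree': "\<And>s. \<psi>L (s, 0) = \<psi>R (s, 0)" using agree by (simp add: \<psi>L_def \<psi>R_def)
  have ge: "glue \<psi>L \<psi>R y = glue \<phi>L \<phi>R y + c" for y by (simp add: glue_def \<psi>L_def \<psi>R_def)
  have "touches_from_above (glue \<psi>L \<psi>R) (usc_env v) (t, x)"
    unfolding touches_from_above_def
  proof
    show "ereal (glue \<psi>L \<psi>R (t, x)) = usc_env v (t, x)"
      using t by (simp add: ge c_def time_space_def ereal_upper[OF lb, symmetric])
    show "\<forall>\<^sub>F y in nhds (t, x). usc_env v y \<le> ereal (glue \<psi>L \<psi>R y)"
      using touch eventually_positive_time[OF t, of x]
      by eventually_elim (simp add: ge c_def ereal_upper[OF lb, symmetric])
  qed
  then have "junction_lhs H1 H2 F (glue \<psi>L \<psi>R) t x \<le> 0"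
    using sol glue_test_function[OF L' R' agree'] t unfolding junction_solution_def by blast
  then show "x < 0 \<Longrightarrow> pL (t, x) + H1 (qL (t, x)) \<le> 0"
    and "0 < x \<Longrightarrow> pR (t, x) + H2 (qR (t, x)) \<le> 0"
    and "x = 0 \<Longrightarrow> pL (t, 0) + F (qL (t, 0)) (qR (t, 0)) \<le> 0"
    using glue_lhs[OF L' R' agree' t] by auto
qed

lemma junction_solution_supersolution:
  assumes sol: "junction_solution H1 H2 F g v"
  shows "glued_supersolution H1 H2 F (lower v)"
  unfolding glued_supersolution_def
proof (intro conjI allI impI)
  have lb: "locally_bounded v" using sol by (simp add: junction_solution_def)
  show "usc (\<lambda>z. - lower v z)"
    using upper_usc[OF locally_bounded_uminus[OF lb]] by (simp add: lower_uminus)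
  fix \<phi>L pL qL \<phi>R pR qR t x
  assume L: "has_partials \<phi>L pL qL" and R: "has_partials \<phi>R pR qR"
    and agree: "\<forall>s. \<phi>L (s, 0) = \<phi>R (s, 0)" and t: "t > 0"
    and touch: "\<forall>\<^sub>F y in nhds (t, x). glue \<phi>L \<phi>R y - lower v y \<le> glue \<phi>L \<phi>R (t, x) - lower v (t, x)"
  define c where "c = lower v (t, x) - glue \<phi>L \<phi>R (t, x)"
  define \<psi>L \<psi>R where "\<psi>L = (\<lambda>z. \<phi>L z + c)" and "\<psi>R = (\<lambda>z. \<phi>R z + c)"
  have L': "has_partials \<psi>L pL qL" and R': "has_partials \<psi>R pR qR"
    unfolding \<psi>L_def \<psi>R_def using L R by (auto intro: has_partials_add_const)
  have agree': "\<And>s. \<psi>L (s, 0) = \<psi>R (s, 0)" using agree by (simp add: \<psi>L_def \<psi>R_def)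
  have ge: "glue \<psi>L \<psi>R y = glue \<phi>L \<phi>R y + c" for y by (simp add: glue_def \<psi>L_def \<psi>R_def)
  have "touches_from_below (glue \<psi>L \<psi>R) (lsc_env v) (t, x)"
    unfolding touches_from_below_def
  proof
    show "ereal (glue \<psi>L \<psi>R (t, x)) = lsc_env v (t, x)"
      using t by (simp add: ge c_def time_space_def ereal_lower[OF lb, symmetric])
    show "\<forall>\<^sub>F y in nhds (t, x). ereal (glue \<psi>L \<psi>R y) \<le> lsc_env v y"
      using touch eventually_positive_time[OF t, of x]
      by eventually_elim (simp add: ge c_def ereal_lower[OF lb, symmetric])
  qed
  then have "junction_lhs H1 H2 F (glue \<psi>L \<psi>R) t x \<ge> 0"
    using sol glue_test_function[OF L' R' agree'] t unfolding junction_solution_def by blast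
  then show "x < 0 \<Longrightarrow> 0 \<le> pL (t, x) + H1 (qL (t, x))"
    and "0 < x \<Longrightarrow> 0 \<le> pR (t, x) + H2 (qR (t, x))"
    and "x = 0 \<Longrightarrow> 0 \<le> pL (t, 0) + F (qL (t, 0)) (qR (t, 0))"
    using glue_lhs[OF L' R' agree' t] by auto
qed

lemma junction_solution_initial:
  assumes sol: "junction_solution H1 H2 F g v"
  shows "upper v (0, x) \<le> g x" "g x \<le> lower v (0, x)"
proof -
  have lb: "locally_bounded v" using sol by (simp add: junction_solution_def)
  have "(0, x) \<in> time_space" by (simp add: time_space_def)
  then have e: "ereal (upper v (0, x)) = usc_env v (0, x)" "ereal (lower v (0, x)) = lsc_env v (0, x)"
    using ereal_upper[OF lb] ereal_lower[OF lb] by auto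
  have "usc_env v (0, x) \<le> ereal (g x)" "ereal (g x) \<le> lsc_env v (0, x)"
    using sol unfolding junction_solution_def by auto
  then show "upper v (0, x) \<le> g x" "g x \<le> lower v (0, x)" by (simp_all flip: e)
qed

section \<open>Subsolutions along straight characteristics\<close>

lemma has_partials_affine: "has_partials (\<lambda>z. c + \<beta> * fst z + \<gamma> * snd z) (\<lambda>_. \<beta>) (\<lambda>_. \<gamma>)"
  unfolding has_partials_def
  by (auto intro!: continuous_intros derivative_eq_intros simp: fun_eq_iff)

lemma has_partials_power2:
  assumes "has_partials f p q"
  shows "has_partials (\<lambda>z. (f z)\<^sup>2) (\<lambda>z. 2 * f z * p z) (\<lambda>z. 2 * f z * q z)"
  using assms has_partials_continuous[OF assms, of UNIV] unfolding has_partials_def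
  by (auto intro!: continuous_intros derivative_eq_intros simp: fun_eq_iff algebra_simps)

lemma has_derivative_pos_part_power2:
  "((\<lambda>r. (max 0 r)\<^sup>2) has_field_derivative 2 * max 0 r) (at (r::real))"
proof -
  consider "r > 0" | "r < 0" | "r = 0" by linarith
  then show ?thesis
  proof cases
    case 1
    have "((\<lambda>r. r\<^sup>2) has_field_derivative 2 * max 0 r) (at r)"
      using 1 by (auto intro!: derivative_eq_intros)
    then show ?thesis
      by (rule has_field_derivative_transform_within_open[where S="{0<..}"]) (use 1 in auto)
  next
    case 2
    have "((\<lambda>r. 0) has_field_derivative 2 * max 0 r) (at r)"
      using 2 by (auto intro!: derivative_eq_intros)
    then show ?thesis
      by (rule has_field_derivative_transform_within_open[where S="{..<0}"]) (use 2 in auto)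
  next
    case 3
    have "((\<lambda>h. (max 0 h)\<^sup>2 / h) \<longlongrightarrow> 0) (at (0::real))"
    proof (rule Lim_null_comparison)
      show "\<forall>\<^sub>F h in at 0. norm ((max 0 h)\<^sup>2 / h) \<le> \<bar>h::real\<bar>"
        by (rule always_eventually) (auto simp: max_def power2_eq_square)
      show "((\<lambda>h. \<bar>h::real\<bar>) \<longlongrightarrow> 0) (at 0)" using tendsto_rabs_zero[OF tendsto_ident_at] .
    qed
    then show ?thesis using 3 by (simp add: DERIV_def)
  qed
qed

lemma has_partials_pos_part_power2:
  assumes "has_partials f p q"
  shows "has_partials (\<lambda>z. (max 0 (f z))\<^sup>2) (\<lambda>z. 2 * max 0 (f z) * p z) (\<lambda>z. 2 * max 0 (f z) * q z)"
  unfolding has_partials_def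
proof (intro conjI allI)
  have c: "continuous_on UNIV f" "continuous_on UNIV p" "continuous_on UNIV q"
    using has_partials_continuous[OF assms] assms by (auto simp: has_partials_def)
  show "continuous_on UNIV (\<lambda>z. 2 * max 0 (f z) * p z)" "continuous_on UNIV (\<lambda>z. 2 * max 0 (f z) * q z)"
    using c by (auto intro!: continuous_intros)
  fix z
  have f: "(f has_derivative (\<lambda>h. p z * fst h + q z * snd h)) (at z)"
    using assms unfolding has_partials_def by blast
  have "((\<lambda>r. (max 0 r)\<^sup>2) has_derivative (*) (2 * max 0 (f z))) (at (f z))"
    using has_derivative_pos_part_power2[of "f z"] by (simp add: has_field_derivative_def)
  from has_derivative_compose[OF f this]
  show "((\<lambda>z. (max 0 (f z))\<^sup>2) has_derivative
      (\<lambda>h. 2 * max 0 (f z) * p z * fst h + 2 * max 0 (f z) * q z * snd h)) (at z)"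
    by (simp add: algebra_simps)
qed

text \<open>The test function for the characteristic \<open>x0 + b (t0 - t)\<close> is \<open>(l + \<eta>) t\<close>, plus a parabola of
  steepness \<open>\<kappa>\<close> around the characteristic and a penalty after \<open>t0\<close>, plus the slopes \<open>- KL\<close> and \<open>KR\<close> on the
  two half-lines. It forms a barrier if it violates the subsolution inequality everywhere in the
  tube of radius \<open>r\<close>.\<close>

definition barrier :: "(real \<Rightarrow> real) \<Rightarrow> (real \<Rightarrow> real) \<Rightarrow> (real \<Rightarrow> real \<Rightarrow> real) \<Rightarrow> real \<Rightarrow> real \<Rightarrow> real \<Rightarrow>
    real \<Rightarrow> real \<Rightarrow> real \<Rightarrow> real \<Rightarrow> real \<Rightarrow> real \<Rightarrow> real \<Rightarrow> bool" where
  "barrier H1 H2 F t0 h r x0 b l \<eta> \<kappa> KL KR \<longleftrightarrow>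
     (\<forall>t x. 0 < t \<longrightarrow> t0 - h < t \<longrightarrow> t < t0 + r \<longrightarrow> \<bar>x - (x0 + b * (t0 - t))\<bar> \<le> r \<longrightarrow>
       (let y = x - (x0 + b * (t0 - t)); p = l + \<eta> + 2 * \<kappa> * max 0 (t - t0) + 2 * \<kappa> * b * y in
        (x < 0 \<longrightarrow> 0 < p + H1 (2 * \<kappa> * y - KL)) \<and>
        (x > 0 \<longrightarrow> 0 < p + H2 (2 * \<kappa> * y + KR)) \<and>
        (x = 0 \<longrightarrow> 0 < p + F (2 * \<kappa> * y - KL) (2 * \<kappa> * y + KR))))"

text \<open>A subsolution cannot touch a barrier, so \<open>w\<close> is at most as large at \<open>(t0, x0)\<close> as at the other end of the
  characteristic plus the cost. Barriers exist for the following reason. The parabola travels with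
  the characteristic, so its contributions to \<open>u\<^sub>t - b u\<^sub>x\<close> cancel and a surplus \<open>\<eta>\<close> remains; this
  settles the side on which the Hamiltonian dominates \<open>- b q - l\<close>. On the other side a large slope
  \<open>KL\<close> or \<open>KR\<close> makes coercivity win.\<close>

lemma transport:
  assumes sub: "glued_subsolution H1 H2 F w"
    and h: "0 \<le> h" "h \<le> t0" and r: "r > 0"
    and barrier: "\<And>\<eta> \<kappa>. \<eta> > 0 \<Longrightarrow> \<kappa> \<ge> 0 \<Longrightarrow> \<exists>KL\<ge>0. \<exists>KR\<ge>0.
       (x0 < 0 \<longrightarrow> KL = 0) \<and> (x0 > 0 \<longrightarrow> KR = 0) \<and> barrier H1 H2 F t0 h r x0 b l \<eta> \<kappa> KL KR"
  shows "w (t0, x0) \<le> w (t0 - h, x0 + b * h) + h * l"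
proof (rule ccontr)
  assume neg: "\<not> ?thesis"
  then have hpos: "h > 0" using h by (cases "h = 0") auto
  define \<tau> where "\<tau> = t0 - h"
  define E where "E = w (t0, x0) - w (\<tau>, x0 + b * h) - h * l"
  have E: "E > 0" using neg by (simp add: E_def \<tau>_def)
  define \<eta> where "\<eta> = E / (4 * h)"
  have \<eta>: "\<eta> > 0" "\<eta> * h = E / 4" using E hpos by (auto simp: \<eta>_def)
  define c where "c = (\<lambda>t. x0 + b * (t0 - t))"
  have c_cont: "continuous_on UNIV (\<lambda>z::real\<times>real. c (fst z))"
    unfolding c_def by (intro continuous_intros)
  have usc: "usc w" using sub by (simp add: glued_subsolution_def)
  have \<tau>: "0 \<le> \<tau>" "\<tau> < t0" using h hpos by (auto simp: \<tau>_def)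
  have "\<forall>\<^sub>F y in nhds (\<tau>, c \<tau>). y \<in> time_space \<longrightarrow> w y < w (\<tau>, c \<tau>) + E / 4"
    using usc \<tau>(1) E unfolding usc_def by (simp add: time_space_def)
  then obtain r1 where r1: "r1 > 0"
    "\<And>y. dist y (\<tau>, c \<tau>) < r1 \<Longrightarrow> y \<in> time_space \<Longrightarrow> w y < w (\<tau>, c \<tau>) + E / 4"
    unfolding eventually_nhds_metric by blast
  \<comment> \<open>The tube has half the admissible width, so that its closure still satisfies both conditions.\<close>
  define r2 where "r2 = min r r1 / 2"
  have r2: "r2 > 0" "r2 < r" "r2 < r1" using r r1(1) by (auto simp: r2_def)
  have near_start: "w (\<tau>, x) < w (\<tau>, c \<tau>) + E / 4" if "\<bar>x - c \<tau>\<bar> \<le> r2" for x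
    using r1(2)[of "(\<tau>, x)"] that r2(3) \<tau>(1) by (simp add: dist_Pair_Pair dist_real_def time_space_def)
  define K where "K = {z. \<tau> \<le> fst z \<and> fst z \<le> t0 + r2 \<and> \<bar>snd z - c (fst z)\<bar> \<le> r2}"
  have "K = (\<lambda>z. (fst z, c (fst z) + snd z)) ` ({\<tau>..t0 + r2} \<times> {-r2..r2})"
  proof (intro equalityI subsetI)
    fix z assume "z \<in> K"
    then have "(fst z, snd z - c (fst z)) \<in> {\<tau>..t0 + r2} \<times> {-r2..r2}" by (auto simp: K_def)
    moreover have "z = (fst (fst z, snd z - c (fst z)), c (fst (fst z, snd z - c (fst z))) + snd (fst z, snd z - c (fst z)))"
      by simp
    ultimately show "z \<in> (\<lambda>z. (fst z, c (fst z) + snd z)) ` ({\<tau>..t0 + r2} \<times> {-r2..r2})" by blast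
  qed (auto simp: K_def)
  moreover have "compact ((\<lambda>z. (fst z, c (fst z) + snd z)) ` ({\<tau>..t0 + r2} \<times> {-r2..r2}))"
    by (intro compact_continuous_image compact_Times continuous_intros continuous_on_subset[OF c_cont]) auto
  ultimately have K: "compact K" by simp
  have "(t0, x0) \<in> K" using \<tau> r2(1) by (simp add: K_def c_def)
  then have K': "K \<noteq> {}" "K \<subseteq> time_space" using \<tau>(1) by (blast, auto simp: K_def time_space_def)
  obtain zB where "zB \<in> K" "\<forall>y\<in>K. w y - 0 \<le> w zB - 0"
    using usc_diff_attains_max[OF usc continuous_on_const K K'] by blast
  then obtain Bw where Bw: "\<And>z. z \<in> K \<Longrightarrow> w z \<le> Bw" by auto
  define V where "V = w (t0, x0) - (l + \<eta>) * h"
  \<comment> \<open>Large enough that on the lateral and the final boundary of the tube the maximum is not reached.\<close>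
  define \<kappa> where "\<kappa> = (\<bar>Bw\<bar> + \<bar>l + \<eta>\<bar> * (h + r2) + \<bar>V\<bar> + 1) / r2\<^sup>2"
  have \<kappa>0: "\<kappa> \<ge> 0" unfolding \<kappa>_def using r2(1) hpos by (intro divide_nonneg_nonneg add_nonneg_nonneg mult_nonneg_nonneg) auto
  have \<kappa>: "\<kappa> * r2\<^sup>2 = \<bar>Bw\<bar> + \<bar>l + \<eta>\<bar> * (h + r2) + \<bar>V\<bar> + 1" using r2(1) by (simp add: \<kappa>_def)
  obtain KL KR where KK: "KL \<ge> 0" "KR \<ge> 0" "x0 < 0 \<longrightarrow> KL = 0" "x0 > 0 \<longrightarrow> KR = 0"
    and bar: "barrier H1 H2 F t0 h r x0 b l \<eta> \<kappa> KL KR"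
    using barrier[OF \<eta>(1) \<kappa>0] by blast
  define \<phi> where "\<phi> = (\<lambda>k z. (- (l + \<eta>) * \<tau> + (l + \<eta>) * fst z + k * snd z)
     + (\<kappa> * (((- x0 - b * t0) + b * fst z + 1 * snd z)\<^sup>2) + \<kappa> * ((max 0 (- t0 + 1 * fst z + 0 * snd z))\<^sup>2)))"
  define p where "p = (\<lambda>z. (l + \<eta>) + (\<kappa> * (2 * ((- x0 - b * t0) + b * fst z + 1 * snd z) * b)
     + \<kappa> * (2 * max 0 (- t0 + 1 * fst z + 0 * snd z) * 1)))"
  define q where "q = (\<lambda>k z. k + (\<kappa> * (2 * ((- x0 - b * t0) + b * fst z + 1 * snd z) * 1)
     + \<kappa> * (2 * max 0 (- t0 + 1 * fst z + 0 * snd z) * 0)))"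
  have part: "has_partials (\<phi> k) p (q k)" for k
    unfolding \<phi>_def p_def q_def
    by (intro has_partials_add has_partials_affine has_partials_cmult has_partials_power2
        has_partials_pos_part_power2)
  have agree: "\<forall>s. \<phi> (- KL) (s, 0) = \<phi> KR (s, 0)" by (simp add: \<phi>_def)
  let ?\<Phi> = "glue (\<phi> (- KL)) (\<phi> KR)"
  have \<Phi>_cont: "continuous_on UNIV ?\<Phi>" by (rule glue_continuous[OF part part]) (use agree in auto)
  have \<Phi>_ge: "(l + \<eta>) * (t - \<tau>) + \<kappa> * (x - c t)\<^sup>2 + \<kappa> * (max 0 (t - t0))\<^sup>2 \<le> ?\<Phi> (t, x)" for t x
    using KK(1,2) mult_nonneg_nonpos[of KL x] mult_nonneg_nonneg[of KR x]
    by (auto simp: glue_def \<phi>_def c_def algebra_simps)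
  have \<Phi>_0: "?\<Phi> (t0, x0) = (l + \<eta>) * h"
    using KK(3,4) by (cases "x0 \<le> 0"; cases "x0 = 0") (auto simp: glue_def \<phi>_def \<tau>_def algebra_simps)
  obtain z where z: "z \<in> K" and zmax: "\<And>y. y \<in> K \<Longrightarrow> w y - ?\<Phi> y \<le> w z - ?\<Phi> z"
    using usc_diff_attains_max[OF usc \<Phi>_cont K K'] by blast
  obtain t x where tx: "z = (t, x)" by (cases z)
  have V: "V \<le> w (t, x) - ?\<Phi> (t, x)" using zmax[OF \<open>(t0, x0) \<in> K\<close>] by (simp add: V_def \<Phi>_0 tx)
  have tK: "\<tau> \<le> t" "t \<le> t0 + r2" "\<bar>x - c t\<bar> \<le> r2" using z by (auto simp: K_def tx)
  have lin: "- (\<bar>l + \<eta>\<bar> * (h + r2)) \<le> (l + \<eta>) * (t - \<tau>)"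
  proof -
    have "\<bar>(l + \<eta>) * (t - \<tau>)\<bar> \<le> \<bar>l + \<eta>\<bar> * (h + r2)"
      unfolding abs_mult using tK by (intro mult_left_mono) (auto simp: \<tau>_def)
    then show ?thesis by linarith
  qed
  have nn: "0 \<le> \<kappa> * (x - c t)\<^sup>2" "0 \<le> \<kappa> * (max 0 (t - t0))\<^sup>2" using \<kappa>0 by auto
  have far: "False" if "\<kappa> * r2\<^sup>2 \<le> \<kappa> * (x - c t)\<^sup>2 + \<kappa> * (max 0 (t - t0))\<^sup>2"
    using that V \<Phi>_ge[of t x] lin Bw[OF z] \<kappa> unfolding tx by linarith
  have "t < t0 + r2"
  proof (rule ccontr)
    assume "\<not> t < t0 + r2"
    then have "t - t0 = r2" using tK by linarith
    then show False using far nn r2(1) by simp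
  qed
  moreover have "\<bar>x - c t\<bar> < r2"
  proof (rule ccontr)
    assume "\<not> \<bar>x - c t\<bar> < r2"
    then have "\<bar>x - c t\<bar> = r2" using tK by linarith
    then have "(x - c t)\<^sup>2 = r2\<^sup>2" by (metis power2_abs)
    then show False using far nn by simp
  qed
  moreover have "\<tau> < t"
  proof (rule ccontr)
    assume "\<not> \<tau> < t"
    then have t: "t = \<tau>" using tK by linarith
    have "w (t, x) < w (\<tau>, c \<tau>) + E / 4" unfolding t by (rule near_start) (use tK t in simp)
    moreover have "V \<le> w (t, x)" using V \<Phi>_ge[of t x] nn t by simp
    moreover have "V = w (\<tau>, c \<tau>) + E - E / 4" using \<eta>(2) by (simp add: V_def E_def c_def \<tau>_def algebra_simps)
    ultimately show False using E by simp
  qed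
  ultimately have inner: "\<tau> < t" "t < t0 + r2" "\<bar>x - c t\<bar> < r2" by auto
  have "open {z. \<tau> < fst z \<and> fst z < t0 + r2 \<and> \<bar>snd z - c (fst z)\<bar> < r2}"
    by (intro open_Collect_conj open_Collect_less continuous_intros c_cont)
  then have "\<forall>\<^sub>F y in nhds (t, x). y \<in> {z. \<tau> < fst z \<and> fst z < t0 + r2 \<and> \<bar>snd z - c (fst z)\<bar> < r2}"
    by (rule eventually_nhds_in_open) (use inner in auto)
  then have "\<forall>\<^sub>F y in nhds (t, x). w y - ?\<Phi> y \<le> w (t, x) - ?\<Phi> (t, x)"
    by (rule eventually_mono) (rule zmax[unfolded tx], auto simp: K_def)
  moreover have tpos: "t > 0" using \<tau>(1) inner by simp
  ultimately have "(x < 0 \<longrightarrow> p (t, x) + H1 (q (- KL) (t, x)) \<le> 0) \<and>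
      (x > 0 \<longrightarrow> p (t, x) + H2 (q KR (t, x)) \<le> 0) \<and>
      (x = 0 \<longrightarrow> p (t, 0) + F (q (- KL) (t, 0)) (q KR (t, 0)) \<le> 0)"
    using sub part agree unfolding glued_subsolution_def by blast
  moreover have "p (t, x) = l + \<eta> + 2 * \<kappa> * max 0 (t - t0) + 2 * \<kappa> * b * (x - (x0 + b * (t0 - t)))"
    by (simp add: p_def algebra_simps)
  moreover have "q k (t, x) = 2 * \<kappa> * (x - (x0 + b * (t0 - t))) + k" for k
    by (simp add: q_def algebra_simps)
  moreover have "t0 - h < t" "t < t0 + r" "\<bar>x - (x0 + b * (t0 - t))\<bar> \<le> r"
    using inner r2 by (auto simp: \<tau>_def c_def)
  note bar[unfolded barrier_def Let_def, rule_format, OF tpos this]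
  ultimately show False
    by (cases x "0::real" rule: linorder_cases) auto
qed

section \<open>The control problem at the junction\<close>

text \<open>\<open>Z\<close> is the set of controls admitted while the state is at the junction. The two extreme choices of
  \<open>Z\<close> give the two value functions; everything in between behaves in the same way. \<open>C\<close> bounds all
  speeds and costs, and \<open>Lg\<close> is a Lipschitz constant of the initial datum.\<close>

locale junction_control =
  S1: half_line_control A1 b1 l1 \<delta> + S2: half_line_control A2 b2 l2 \<delta>
  for A1 :: "'a::metric_space set" and A2 :: "'b::metric_space set"
    and b1 l1 :: "'a \<Rightarrow> real" and b2 l2 :: "'b \<Rightarrow> real" and \<delta> :: real +
  fixes p1 p2 C Lg :: real and g :: "real \<Rightarrow> real" and Z :: "('a \<times> 'b \<times> real) set"
  assumes b1_cont: "continuous_on A1 b1" and l1_cont: "continuous_on A1 l1"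
    and b2_cont: "continuous_on A2 b2" and l2_cont: "continuous_on A2 l2"
    and b1_le: "\<And>\<alpha>. \<alpha> \<in> A1 \<Longrightarrow> \<bar>b1 \<alpha>\<bar> \<le> C" and l1_le: "\<And>\<alpha>. \<alpha> \<in> A1 \<Longrightarrow> \<bar>l1 \<alpha>\<bar> \<le> C"
    and b2_le: "\<And>\<alpha>. \<alpha> \<in> A2 \<Longrightarrow> \<bar>b2 \<alpha>\<bar> \<le> C" and l2_le: "\<And>\<alpha>. \<alpha> \<in> A2 \<Longrightarrow> \<bar>l2 \<alpha>\<bar> \<le> C"
    and C_pos: "C > 0"
    and g_lipschitz: "\<And>x y. \<bar>g x - g y\<bar> \<le> Lg * \<bar>x - y\<bar>" and Lg: "Lg \<ge> 0"
    and p1: "is_arg_min (hamiltonian A1 b1 l1) (\<lambda>_. True) p1"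
    and p2: "is_arg_min (hamiltonian A2 b2 l2) (\<lambda>_. True) p2"
    and Z_lower: "controls0_reg A1 A2 b1 b2 \<subseteq> Z" and Z_upper: "Z \<subseteq> controls0 A1 A2 b1 b2"
begin

abbreviation H1 :: "real \<Rightarrow> real" where "H1 \<equiv> hamiltonian A1 b1 l1"
abbreviation H2 :: "real \<Rightarrow> real" where "H2 \<equiv> hamiltonian A2 b2 l2"

definition A :: real where "A = (SUP a\<in>Z. - mix l1 l2 a)"

abbreviation F :: "real \<Rightarrow> real \<Rightarrow> real" where "F \<equiv> flux_limited H1 p1 H2 p2 A"

text \<open>A dynamic programming inequality for the simplest controls only: constant control and straight
  motion inside one closed half-line, or rest at the junction. It involves no derivative and is stable
  under averaging.\<close>

definition moves :: "(real \<times> real \<Rightarrow> real) \<Rightarrow> bool" where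
  "moves w \<longleftrightarrow>
     (\<forall>\<alpha>\<in>A1. \<forall>t h x. 0 \<le> h \<longrightarrow> h \<le> t \<longrightarrow> x \<le> 0 \<longrightarrow> x + b1 \<alpha> * h \<le> 0 \<longrightarrow>
        w (t, x) \<le> w (t - h, x + b1 \<alpha> * h) + h * l1 \<alpha>) \<and>
     (\<forall>\<alpha>\<in>A2. \<forall>t h x. 0 \<le> h \<longrightarrow> h \<le> t \<longrightarrow> 0 \<le> x \<longrightarrow> 0 \<le> x + b2 \<alpha> * h \<longrightarrow>
        w (t, x) \<le> w (t - h, x + b2 \<alpha> * h) + h * l2 \<alpha>) \<and>
     (\<forall>t h. 0 \<le> h \<longrightarrow> h \<le> t \<longrightarrow> w (t, 0) \<le> w (t - h, 0) - h * A)"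

lemma moves_left:
  assumes "moves w" "\<alpha> \<in> A1" "0 \<le> h" "h \<le> t" "x \<le> 0" "x + b1 \<alpha> * h \<le> 0"
  shows "w (t, x) \<le> w (t - h, x + b1 \<alpha> * h) + h * l1 \<alpha>"
  using assms unfolding moves_def by blast

lemma moves_right:
  assumes "moves w" "\<alpha> \<in> A2" "0 \<le> h" "h \<le> t" "0 \<le> x" "0 \<le> x + b2 \<alpha> * h"
  shows "w (t, x) \<le> w (t - h, x + b2 \<alpha> * h) + h * l2 \<alpha>"
  using assms unfolding moves_def by blast

lemma moves_stay:
  assumes "moves w" "0 \<le> h" "h \<le> t"
  shows "w (t, 0) \<le> w (t - h, 0) - h * A"
  using assms unfolding moves_def by blast

lemma F_ge: "A \<le> F q1 q2" "incr_part H1 p1 q1 \<le> F q1 q2" "decr_part H2 p2 q2 \<le> F q1 q2"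
  by (auto simp: flux_limited_def)

text \<open>A motion that reaches the junction only at its end is a limit of motions that stop
  before; upper semicontinuity has the right direction for this limit.\<close>

lemma usc_at_end:
  assumes w: "usc w" and end_point: "t - h \<ge> 0" "h > 0"
    and le: "\<And>s. 0 < s \<Longrightarrow> s < h \<Longrightarrow> u \<le> w (t - s, x + b * s) + s * l"
  shows "u \<le> w (t - h, x + b * h) + h * l"
proof (rule field_le_epsilon)
  fix e :: real assume e: "e > 0"
  have "(t - h, x + b * h) \<in> time_space" using end_point by (simp add: time_space_def)
  with w e have ev: "\<forall>\<^sub>F y in nhds (t - h, x + b * h). y \<in> time_space \<longrightarrow> w y < w (t - h, x + b * h) + e"
    unfolding usc_def by simp
  have "((\<lambda>s. (t - s, x + b * s)) \<longlongrightarrow> (t - h, x + b * h)) (at_left h)"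
    by (intro tendsto_intros)
  then have ev1: "\<forall>\<^sub>F s in at_left h. (t - s, x + b * s) \<in> time_space \<longrightarrow>
      w (t - s, x + b * s) < w (t - h, x + b * h) + e"
    using ev unfolding filterlim_iff by blast
  have ev2: "\<forall>\<^sub>F s in at_left h. 0 < s \<and> s < h"
    using eventually_at_left_real[OF end_point(2)] by (rule eventually_mono) auto
  have "\<forall>\<^sub>F s in at_left h. u - s * l \<le> w (t - h, x + b * h) + e"
    using ev1 ev2
  proof eventually_elim
    case (elim s)
    then have "(t - s, x + b * s) \<in> time_space" using end_point by (simp add: time_space_def)
    then show ?case using elim le[of s] by simp
  qed
  moreover have "((\<lambda>s. u - s * l) \<longlongrightarrow> u - h * l) (at_left h)" by (intro tendsto_intros)
  ultimately have "u - h * l \<le> w (t - h, x + b * h) + e"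
    by (intro tendsto_upperbound) auto
  then show "u \<le> w (t - h, x + b * h) + h * l + e" by simp
qed

text \<open>This bounds the terms of a barrier that do not contain the Hamiltonian; on the half-line which the
  characteristic avoids, coercivity only has to beat the bound.\<close>

lemma barrier_drift_ge:
  fixes y :: real
  assumes "\<bar>y\<bar> \<le> 1" "\<kappa> \<ge> 0"
  shows "- (\<bar>m\<bar> + 2 * \<kappa> * \<bar>b\<bar>) \<le> m + 2 * \<kappa> * max 0 s + 2 * \<kappa> * b * y"
proof -
  have "\<bar>2 * \<kappa> * b * y\<bar> \<le> 2 * \<kappa> * \<bar>b\<bar>"
    using assms mult_left_mono[of "\<bar>y\<bar>" 1 "2 * \<kappa> * \<bar>b\<bar>"] by (simp add: abs_mult)
  moreover have "0 \<le> 2 * \<kappa> * max 0 s" using assms by simp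
  ultimately show ?thesis by (smt (verit))
qed

text \<open>Moving away from the junction is covered by \<open>incr_part\<close>, which is the supremum over the controls
  with nonpositive velocity; hence the characteristic may even start at the junction. Moving towards
  it, the equation at the junction gives nothing, and the end point is approached from inside.\<close>

lemma subsolution_left_move:
  assumes sub: "glued_subsolution H1 H2 F w" and a: "\<alpha> \<in> A1"
    and h: "0 \<le> h" "h \<le> t" and x: "x \<le> 0" "x + b1 \<alpha> * h \<le> 0"
  shows "w (t, x) \<le> w (t - h, x + b1 \<alpha> * h) + h * l1 \<alpha>"
proof -
  have H1: "0 < l1 \<alpha> + \<eta> + 2 * \<kappa> * max 0 s + 2 * \<kappa> * b1 \<alpha> * y + H1 (2 * \<kappa> * y)"
    if "\<eta> > 0" "\<kappa> \<ge> 0" for \<eta> \<kappa> s y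
  proof -
    have "0 \<le> 2 * \<kappa> * max 0 s" using that by simp
    moreover have "2 * \<kappa> * b1 \<alpha> * y = b1 \<alpha> * (2 * \<kappa> * y)" by simp
    ultimately show ?thesis using S1.ham_ge[OF a, of "2 * \<kappa> * y"] \<open>\<eta> > 0\<close> by linarith
  qed
  show ?thesis
  proof (cases "b1 \<alpha> \<le> 0")
    case True
    have incr: "0 < l1 \<alpha> + \<eta> + 2 * \<kappa> * max 0 s + 2 * \<kappa> * b1 \<alpha> * y + F (2 * \<kappa> * y) q"
      if "\<eta> > 0" "\<kappa> \<ge> 0" for \<eta> \<kappa> s y q
    proof -
      have "0 \<le> 2 * \<kappa> * max 0 s" using that by simp
      moreover have "2 * \<kappa> * b1 \<alpha> * y = b1 \<alpha> * (2 * \<kappa> * y)" by simp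
      ultimately show ?thesis
        using S1.incr_part_ge[OF a True, of "2 * \<kappa> * y" p1] F_ge(2)[of "2 * \<kappa> * y" q] \<open>\<eta> > 0\<close>
        by linarith
    qed
    show ?thesis
    proof (rule transport[OF sub h zero_less_one])
      fix \<eta> \<kappa> :: real assume \<eta>: "\<eta> > 0" and \<kappa>: "\<kappa> \<ge> 0"
      obtain K where K: "K \<ge> 0" "\<And>q. \<bar>q\<bar> \<ge> K \<Longrightarrow> \<bar>l1 \<alpha> + \<eta>\<bar> + 2 * \<kappa> * \<bar>b1 \<alpha>\<bar> < H2 q"
        using S2.ham_coercive by blast
      have far: "0 < l1 \<alpha> + \<eta> + 2 * \<kappa> * max 0 s + 2 * \<kappa> * b1 \<alpha> * y + H2 (2 * \<kappa> * y + (K + 2 * \<kappa>))"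
        if "\<bar>y\<bar> \<le> 1" for s y
      proof -
        have "2 * \<kappa> * (y + 1) \<ge> 0" using that \<kappa> by (intro mult_nonneg_nonneg) auto
        then have "\<bar>2 * \<kappa> * y + (K + 2 * \<kappa>)\<bar> \<ge> K" using K(1) by (simp add: algebra_simps)
        from K(2)[OF this] show ?thesis
          using barrier_drift_ge[OF that \<kappa>, of "l1 \<alpha> + \<eta>" "b1 \<alpha>" s] by linarith
      qed
      show "\<exists>KL\<ge>0. \<exists>KR\<ge>0. (x < 0 \<longrightarrow> KL = 0) \<and> (0 < x \<longrightarrow> KR = 0) \<and>
          barrier H1 H2 F t h 1 x (b1 \<alpha>) (l1 \<alpha>) \<eta> \<kappa> KL KR"
        by (rule exI[of _ 0], simp, rule exI[of _ "K + 2 * \<kappa>"])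
          (use K(1) \<kappa> x far H1[OF \<eta> \<kappa>] incr[OF \<eta> \<kappa>] in \<open>auto simp: barrier_def Let_def\<close>)
    qed
  next
    case False
    have open_end: "w (t, x) \<le> w (t - s, x + b1 \<alpha> * s) + s * l1 \<alpha>"
      if "0 \<le> s" "s \<le> t" "x + b1 \<alpha> * s < 0" for s
    proof (rule transport[OF sub that(1,2)])
      show "- (x + b1 \<alpha> * s) / 2 > 0" using that by simp
      fix \<eta> \<kappa> :: real assume \<eta>: "\<eta> > 0" and \<kappa>: "\<kappa> \<ge> 0"
      have neg: "xa < 0" if t: "t - s < ta" and xa: "\<bar>xa - (x + b1 \<alpha> * (t - ta))\<bar> \<le> - (x + b1 \<alpha> * s) / 2" for ta xa
      proof -
        have "b1 \<alpha> * (t - ta) \<le> b1 \<alpha> * s" using False t by (intro mult_left_mono) auto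
        moreover have "\<bar>xa - (x + c)\<bar> \<le> - (x + d) / 2 \<Longrightarrow> c \<le> d \<Longrightarrow> x + d < 0 \<Longrightarrow> xa < 0" for c d :: real
          by (drule abs_le_D1) (simp add: field_simps)
        ultimately show ?thesis using xa \<open>x + b1 \<alpha> * s < 0\<close> by blast
      qed
      show "\<exists>KL\<ge>0. \<exists>KR\<ge>0. (x < 0 \<longrightarrow> KL = 0) \<and> (0 < x \<longrightarrow> KR = 0) \<and>
          barrier H1 H2 F t s (- (x + b1 \<alpha> * s) / 2) x (b1 \<alpha>) (l1 \<alpha>) \<eta> \<kappa> KL KR"
        by (rule exI[of _ 0], simp only: order_refl simp_thms, rule exI[of _ 0])
          (use neg H1[OF \<eta> \<kappa>] in \<open>fastforce simp: barrier_def Let_def\<close>)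
    qed
    show ?thesis
    proof (cases "h = 0")
      case True then show ?thesis by simp
    next
      case hne: False
      show ?thesis
      proof (rule usc_at_end)
        show "usc w" using sub by (simp add: glued_subsolution_def)
        fix s assume s: "0 < s" "s < h"
        have "b1 \<alpha> * s < b1 \<alpha> * h" using s False by simp
        then show "w (t, x) \<le> w (t - s, x + b1 \<alpha> * s) + s * l1 \<alpha>"
          using s h x by (intro open_end) auto
      qed (use h hne in auto)
    qed
  qed
qed

lemma subsolution_right_move:
  assumes sub: "glued_subsolution H1 H2 F w" and a: "\<alpha> \<in> A2"
    and h: "0 \<le> h" "h \<le> t" and x: "0 \<le> x" "0 \<le> x + b2 \<alpha> * h"
  shows "w (t, x) \<le> w (t - h, x + b2 \<alpha> * h) + h * l2 \<alpha>"
proof -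
  have H2: "0 < l2 \<alpha> + \<eta> + 2 * \<kappa> * max 0 s + 2 * \<kappa> * b2 \<alpha> * y + H2 (2 * \<kappa> * y)"
    if "\<eta> > 0" "\<kappa> \<ge> 0" for \<eta> \<kappa> s y
  proof -
    have "0 \<le> 2 * \<kappa> * max 0 s" using that by simp
    moreover have "2 * \<kappa> * b2 \<alpha> * y = b2 \<alpha> * (2 * \<kappa> * y)" by simp
    ultimately show ?thesis using S2.ham_ge[OF a, of "2 * \<kappa> * y"] \<open>\<eta> > 0\<close> by linarith
  qed
  show ?thesis
  proof (cases "0 \<le> b2 \<alpha>")
    case True
    have decr: "0 < l2 \<alpha> + \<eta> + 2 * \<kappa> * max 0 s + 2 * \<kappa> * b2 \<alpha> * y + F q (2 * \<kappa> * y)"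
      if "\<eta> > 0" "\<kappa> \<ge> 0" for \<eta> \<kappa> s y q
    proof -
      have "0 \<le> 2 * \<kappa> * max 0 s" using that by simp
      moreover have "2 * \<kappa> * b2 \<alpha> * y = b2 \<alpha> * (2 * \<kappa> * y)" by simp
      ultimately show ?thesis
        using S2.decr_part_ge[OF a True, of "2 * \<kappa> * y" p2] F_ge(3)[of "2 * \<kappa> * y" q] \<open>\<eta> > 0\<close>
        by linarith
    qed
    show ?thesis
    proof (rule transport[OF sub h zero_less_one])
      fix \<eta> \<kappa> :: real assume \<eta>: "\<eta> > 0" and \<kappa>: "\<kappa> \<ge> 0"
      obtain K where K: "K \<ge> 0" "\<And>q. \<bar>q\<bar> \<ge> K \<Longrightarrow> \<bar>l2 \<alpha> + \<eta>\<bar> + 2 * \<kappa> * \<bar>b2 \<alpha>\<bar> < H1 q"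
        using S1.ham_coercive by blast
      have far: "0 < l2 \<alpha> + \<eta> + 2 * \<kappa> * max 0 s + 2 * \<kappa> * b2 \<alpha> * y + H1 (2 * \<kappa> * y - (K + 2 * \<kappa>))"
        if "\<bar>y\<bar> \<le> 1" for s y
      proof -
        have "2 * \<kappa> * (1 - y) \<ge> 0" using that \<kappa> by (intro mult_nonneg_nonneg) auto
        then have "\<bar>2 * \<kappa> * y - (K + 2 * \<kappa>)\<bar> \<ge> K" using K(1) by (simp add: algebra_simps)
        from K(2)[OF this] show ?thesis
          using barrier_drift_ge[OF that \<kappa>, of "l2 \<alpha> + \<eta>" "b2 \<alpha>" s] by linarith
      qed
      show "\<exists>KL\<ge>0. \<exists>KR\<ge>0. (x < 0 \<longrightarrow> KL = 0) \<and> (0 < x \<longrightarrow> KR = 0) \<and>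
          barrier H1 H2 F t h 1 x (b2 \<alpha>) (l2 \<alpha>) \<eta> \<kappa> KL KR"
        by (rule exI[of _ "K + 2 * \<kappa>"], rule conjI[OF add_nonneg_nonneg], rule K(1), use \<kappa> in simp, rule exI[of _ 0])
          (use K(1) \<kappa> x far H2[OF \<eta> \<kappa>] decr[OF \<eta> \<kappa>] in \<open>auto simp: barrier_def Let_def\<close>)
    qed
  next
    case False
    have open_end: "w (t, x) \<le> w (t - s, x + b2 \<alpha> * s) + s * l2 \<alpha>"
      if "0 \<le> s" "s \<le> t" "0 < x + b2 \<alpha> * s" for s
    proof (rule transport[OF sub that(1,2)])
      show "(x + b2 \<alpha> * s) / 2 > 0" using that by simp
      fix \<eta> \<kappa> :: real assume \<eta>: "\<eta> > 0" and \<kappa>: "\<kappa> \<ge> 0"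
      have pos: "0 < xa" if t: "t - s < ta" and xa: "\<bar>xa - (x + b2 \<alpha> * (t - ta))\<bar> \<le> (x + b2 \<alpha> * s) / 2" for ta xa
      proof -
        have "b2 \<alpha> * s \<le> b2 \<alpha> * (t - ta)" using False t by (intro mult_left_mono_neg) auto
        moreover have "\<bar>xa - (x + c)\<bar> \<le> (x + d) / 2 \<Longrightarrow> d \<le> c \<Longrightarrow> 0 < x + d \<Longrightarrow> 0 < xa" for c d :: real
          by (drule abs_le_D2) (simp add: field_simps)
        ultimately show ?thesis using xa \<open>0 < x + b2 \<alpha> * s\<close> by blast
      qed
      show "\<exists>KL\<ge>0. \<exists>KR\<ge>0. (x < 0 \<longrightarrow> KL = 0) \<and> (0 < x \<longrightarrow> KR = 0) \<and>
          barrier H1 H2 F t s ((x + b2 \<alpha> * s) / 2) x (b2 \<alpha>) (l2 \<alpha>) \<eta> \<kappa> KL KR"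
        by (rule exI[of _ 0], simp only: order_refl simp_thms, rule exI[of _ 0])
          (use pos H2[OF \<eta> \<kappa>] in \<open>fastforce simp: barrier_def Let_def\<close>)
    qed
    show ?thesis
    proof (cases "h = 0")
      case True then show ?thesis by simp
    next
      case hne: False
      show ?thesis
      proof (rule usc_at_end)
        show "usc w" using sub by (simp add: glued_subsolution_def)
        fix s assume s: "0 < s" "s < h"
        have "b2 \<alpha> * h < b2 \<alpha> * s" using s False by simp
        then show "w (t, x) \<le> w (t - s, x + b2 \<alpha> * s) + s * l2 \<alpha>"
          using s h x by (intro open_end) auto
      qed (use h hne in auto)
    qed
  qed
qed

text \<open>At the junction only the bound \<open>F \<ge> A\<close> is used; on both half-lines steep slopes and coercivity
  exclude contact.\<close>

lemma subsolution_stay: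
  assumes sub: "glued_subsolution H1 H2 F w" and h: "0 \<le> h" "h \<le> t"
  shows "w (t, 0) \<le> w (t - h, 0) - h * A"
proof -
  have "w (t, 0) \<le> w (t - h, 0 + 0 * h) + h * (- A)"
  proof (rule transport[OF sub h zero_less_one])
    fix \<eta> \<kappa> :: real assume \<eta>: "\<eta> > 0" and \<kappa>: "\<kappa> \<ge> 0"
    obtain K1 where K1: "K1 \<ge> 0" "\<And>q. \<bar>q\<bar> \<ge> K1 \<Longrightarrow> \<bar>- A + \<eta>\<bar> < H1 q"
      using S1.ham_coercive by blast
    obtain K2 where K2: "K2 \<ge> 0" "\<And>q. \<bar>q\<bar> \<ge> K2 \<Longrightarrow> \<bar>- A + \<eta>\<bar> < H2 q"
      using S2.ham_coercive by blast
    have m: "0 \<le> 2 * \<kappa> * max 0 s" for s using \<kappa> by simp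
    have far1: "0 < - A + \<eta> + 2 * \<kappa> * max 0 s + H1 (2 * \<kappa> * y - (K1 + 2 * \<kappa>))"
      if "\<bar>y\<bar> \<le> 1" for s y
    proof -
      have "2 * \<kappa> * (1 - y) \<ge> 0" using that \<kappa> by (intro mult_nonneg_nonneg) auto
      then have "\<bar>2 * \<kappa> * y - (K1 + 2 * \<kappa>)\<bar> \<ge> K1" using K1(1) by (simp add: algebra_simps)
      from K1(2)[OF this] m[of s] show ?thesis by linarith
    qed
    have far2: "0 < - A + \<eta> + 2 * \<kappa> * max 0 s + H2 (2 * \<kappa> * y + (K2 + 2 * \<kappa>))"
      if "\<bar>y\<bar> \<le> 1" for s y
    proof -
      have "2 * \<kappa> * (1 + y) \<ge> 0" using that \<kappa> by (intro mult_nonneg_nonneg) auto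
      then have "\<bar>2 * \<kappa> * y + (K2 + 2 * \<kappa>)\<bar> \<ge> K2" using K2(1) by (simp add: algebra_simps)
      from K2(2)[OF this] m[of s] show ?thesis by linarith
    qed
    have zero: "0 < - A + \<eta> + 2 * \<kappa> * max 0 s + F q1 q2" for s q1 q2
      using F_ge(1)[of q1 q2] m[of s] \<eta> by linarith
    show "\<exists>KL\<ge>0. \<exists>KR\<ge>0. (0 < (0::real) \<longrightarrow> KL = 0) \<and> (0 < (0::real) \<longrightarrow> KR = 0) \<and>
          barrier H1 H2 F t h 1 0 0 (- A) \<eta> \<kappa> KL KR"
      by (rule exI[of _ "K1 + 2 * \<kappa>"], rule conjI[OF add_nonneg_nonneg], rule K1(1), use \<kappa> in simp,
          rule exI[of _ "K2 + 2 * \<kappa>"])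
        (use K2(1) \<kappa> far1 far2 zero in \<open>auto simp: barrier_def Let_def\<close>)
  qed
  then show ?thesis by simp
qed

lemma subsolution_moves: "glued_subsolution H1 H2 F w \<Longrightarrow> moves w"
  unfolding moves_def
  using subsolution_left_move subsolution_right_move subsolution_stay by blast

end

section \<open>One-sided Steklov averages\<close>

lemma has_partialsI:
  assumes f1: "\<And>t x. ((\<lambda>s. f (s, x)) has_real_derivative p (t, x)) (at t)"
    and f2: "\<And>t x. ((\<lambda>y. f (t, y)) has_real_derivative q (t, x)) (at x)"
    and p: "continuous_on UNIV p" and q: "continuous_on UNIV q"
  shows "has_partials f p q"
  unfolding has_partials_def
proof (intro conjI allI p q)
  fix z :: "real \<times> real"
  obtain t x where z: "z = (t, x)" by (cases z)
  have "((\<lambda>(s, y). f (s, y)) has_derivative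
      (\<lambda>(h, k). h * p (t, x) + blinfun_apply (blinfun_scaleR_left (q (t, x))) k)) (at (t, x) within UNIV \<times> UNIV)"
  proof (rule has_derivative_partialsI[where fx = "\<lambda>h. h * p (t, x)" and fy = "\<lambda>s y. blinfun_scaleR_left (q (s, y))"])
    show "((\<lambda>s. f (s, x)) has_derivative (\<lambda>h. h * p (t, x))) (at t within UNIV)"
      using f1[of x t] by (simp add: has_field_derivative_def mult.commute[of _ "p (t, x)"])
    show "((\<lambda>y. f (s, y)) has_derivative blinfun_apply (blinfun_scaleR_left (q (s, y)))) (at y within UNIV)" for s y
      using f2[of s y] by (simp add: has_field_derivative_def mult.commute[of _ "q (s, y)"])
    have "continuous_on UNIV (\<lambda>z. blinfun_scaleR_left (q z))"
      using q by (intro continuous_intros)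
    then show "continuous (at (t, x) within UNIV \<times> UNIV) (\<lambda>(s, y). blinfun_scaleR_left (q (s, y)))"
      by (simp add: continuous_on_eq_continuous_within case_prod_beta')
  qed auto
  then show "(f has_derivative (\<lambda>h. p z * fst h + q z * snd h)) (at z)"
    by (simp add: z case_prod_beta' mult.commute)
qed

text \<open>The reason for averaging over a window: the average of a merely continuous function is \<open>C\<^sup>1\<close>, with
  a difference quotient as derivative.\<close>

lemma steklov_derivative:
  fixes g :: "real \<Rightarrow> real"
  assumes g: "continuous_on UNIV g" and \<eta>: "\<eta> > 0"
  shows "((\<lambda>t. integral {0..\<eta>} (\<lambda>s. g (t + s))) has_real_derivative g (t + \<eta>) - g t) (at t)"
proof -
  define a where "a = t - 1"
  define e where "e = t + \<eta> + 1"
  have gc: "continuous_on S g" for S using g continuous_on_subset by blast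
  have D: "((\<lambda>u. integral {a..u} g) has_real_derivative g u) (at u)" if "a < u" "u < e" for u
    using integral_has_real_derivative[OF gc, of u a e] that
    by (simp add: at_within_Icc_at)
  have "((\<lambda>u. integral {a..u + \<eta>} g) has_real_derivative g (t + \<eta>)) (at t)"
    using DERIV_shift[of "\<lambda>u. integral {a..u} g" "g (t + \<eta>)" t \<eta>] D[of "t + \<eta>"] \<eta>
    by (simp add: a_def e_def)
  moreover have "((\<lambda>u. integral {a..u} g) has_real_derivative g t) (at t)"
    using D[of t] \<eta> by (simp add: a_def e_def)
  ultimately have "((\<lambda>u. integral {a..u + \<eta>} g - integral {a..u} g) has_real_derivative g (t + \<eta>) - g t) (at t)"
    by (rule DERIV_diff)
  then show ?thesis
  proof (rule has_field_derivative_transform_within_open[where S = "{a<..}"])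
    fix u assume "u \<in> {a<..}"
    then have "integral {a..u} g + integral {u..u + \<eta>} g = integral {a..u + \<eta>} g"
      using \<eta> by (intro Henstock_Kurzweil_Integration.integral_combine integrable_continuous_real gc) auto
    moreover have "integral {0..\<eta>} (\<lambda>s. g (u + s)) = integral {u..u + \<eta>} g"
      using integral_shift_Icc_real[of 0 \<eta> g u] by (simp add: o_def add.commute)
    ultimately show "integral {a..u + \<eta>} g - integral {a..u} g = integral {0..\<eta>} (\<lambda>s. g (u + s))" by simp
  qed (auto simp: a_def)
qed

lemma average_bounds:
  fixes f :: "real \<Rightarrow> real"
  assumes "continuous_on {0..\<eta>} f" "\<eta> > 0" "\<And>s. 0 \<le> s \<Longrightarrow> s \<le> \<eta> \<Longrightarrow> \<bar>f s - c\<bar> \<le> e"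
  shows "\<bar>integral {0..\<eta>} f / \<eta> - c\<bar> \<le> e"
proof -
  have i: "f integrable_on {0..\<eta>}" by (rule integrable_continuous_real[OF assms(1)])
  have "integral {0..\<eta>} f \<le> integral {0..\<eta>} (\<lambda>_. c + e)"
  proof (intro integral_le i integrable_const_ivl)
    show "f s \<le> c + e" if "s \<in> {0..\<eta>}" for s using assms(3)[of s] that by (simp add: abs_le_iff)
  qed
  moreover have "integral {0..\<eta>} (\<lambda>_. c - e) \<le> integral {0..\<eta>} f"
  proof (intro integral_le i integrable_const_ivl)
    show "c - e \<le> f s" if "s \<in> {0..\<eta>}" for s using assms(3)[of s] that by (simp add: abs_le_iff)
  qed
  ultimately show ?thesis using assms(2) by (simp add: abs_le_iff field_simps)
qed

lemma lipschitz_plane_continuous: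
  fixes W :: "real \<times> real \<Rightarrow> real"
  assumes lip: "\<And>t s x y. \<bar>W (t, x) - W (s, y)\<bar> \<le> L * (\<bar>t - s\<bar> + \<bar>x - y\<bar>)"
  shows "continuous_on S W"
proof -
  have L: "L \<ge> 0" using lip[of 0 0 1 0] by simp
  have "(2 * L)-lipschitz_on UNIV W"
  proof (rule lipschitz_onI)
    fix z y :: "real \<times> real"
    have "\<bar>fst z - fst y\<bar> \<le> dist z y" "\<bar>snd z - snd y\<bar> \<le> dist z y"
      using dist_fst_le[of z y] dist_snd_le[of z y] by (auto simp: dist_real_def)
    then have "L * (\<bar>fst z - fst y\<bar> + \<bar>snd z - snd y\<bar>) \<le> L * (2 * dist z y)"
      using L by (intro mult_left_mono) auto
    then show "dist (W z) (W y) \<le> 2 * L * dist z y"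
      using lip[of "fst z" "snd z" "fst y" "snd y"] by (simp add: dist_real_def)
  qed (use L in simp)
  then show ?thesis using lipschitz_on_continuous_on continuous_on_subset by blast
qed

text \<open>The average over a window of length \<open>\<eta>\<close> in time and \<open>\<epsilon>\<close> in space; the spatial window lies
  to the left of \<open>x\<close> so that a function on the left half-line never sees the other one.\<close>

definition window_average :: "(real \<times> real \<Rightarrow> real) \<Rightarrow> real \<Rightarrow> real \<Rightarrow> real \<times> real \<Rightarrow> real" where
  "window_average W \<eta> \<epsilon> z =
     integral {0..\<epsilon>} (\<lambda>y. integral {0..\<eta>} (\<lambda>s. W (fst z + s, snd z - \<epsilon> + y)) / \<eta>) / \<epsilon>"

context
  fixes W :: "real \<times> real \<Rightarrow> real" and L \<eta> \<epsilon> :: real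
  assumes lip: "\<And>t s x y. \<bar>W (t, x) - W (s, y)\<bar> \<le> L * (\<bar>t - s\<bar> + \<bar>x - y\<bar>)"
    and \<eta>: "\<eta> > 0" and \<epsilon>: "\<epsilon> > 0"
begin

lemma W_continuous: "continuous_on S W"
  by (rule lipschitz_plane_continuous[OF lip])

lemma W_continuous_comp: "continuous_on S f \<Longrightarrow> continuous_on S (\<lambda>z. W (f z))"
  using continuous_on_compose2[OF W_continuous[of UNIV]] by auto

lemma time_average_continuous:
  "continuous_on S (\<lambda>z. integral {0..\<eta>} (\<lambda>s. W (fst z + s, snd z)) / \<eta>)"
proof -
  have "continuous_on S (\<lambda>z. integral (cbox 0 \<eta>) (\<lambda>s. W (fst z + s, snd z)))"
    by (rule integral_continuous_on_param)
      (auto simp: case_prod_beta' intro!: W_continuous_comp continuous_intros)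
  then show ?thesis using \<eta> by (auto intro!: continuous_intros)
qed

lemma time_average_continuous_slice:
  assumes "continuous_on S f"
  shows "continuous_on S (\<lambda>y. integral {0..\<eta>} (\<lambda>s. W (t + s, f y)) / \<eta>)"
proof -
  have "continuous_on S (\<lambda>y. (t, f y))" using assms by (intro continuous_intros)
  from continuous_on_compose2[OF time_average_continuous[of UNIV] this]
  show ?thesis by simp
qed

lemma time_average_near:
  "\<bar>integral {0..\<eta>} (\<lambda>s. W (t + s, x)) / \<eta> - W (t, x')\<bar> \<le> L * (\<eta> + \<bar>x - x'\<bar>)"
proof (rule average_bounds[OF _ \<eta>])
  have L: "L \<ge> 0" using lip[of 0 0 1 0] by simp
  show "continuous_on {0..\<eta>} (\<lambda>s. W (t + s, x))" by (intro W_continuous_comp continuous_intros)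
  fix s assume "0 \<le> s" "s \<le> \<eta>"
  then show "\<bar>W (t + s, x) - W (t, x')\<bar> \<le> L * (\<eta> + \<bar>x - x'\<bar>)"
    using lip[of "t + s" x t x'] mult_left_mono[of "s + \<bar>x - x'\<bar>" "\<eta> + \<bar>x - x'\<bar>" L] L by simp
qed

lemma window_average_near: "\<bar>window_average W \<eta> \<epsilon> (t, x) - W (t, x)\<bar> \<le> L * (\<eta> + \<epsilon>)"
  unfolding window_average_def fst_conv snd_conv
proof (rule average_bounds[OF _ \<epsilon>])
  have L: "L \<ge> 0" using lip[of 0 0 1 0] by simp
  show "continuous_on {0..\<epsilon>} (\<lambda>y. integral {0..\<eta>} (\<lambda>s. W (t + s, x - \<epsilon> + y)) / \<eta>)"
    by (intro time_average_continuous_slice continuous_intros)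
  fix y assume "0 \<le> y" "y \<le> \<epsilon>"
  then show "\<bar>integral {0..\<eta>} (\<lambda>s. W (t + s, x - \<epsilon> + y)) / \<eta> - W (t, x)\<bar> \<le> L * (\<eta> + \<epsilon>)"
    using time_average_near[of t "x - \<epsilon> + y" x] mult_left_mono[of "\<eta> + (\<epsilon> - y)" "\<eta> + \<epsilon>" L] L by simp
qed

lemma window_average_near_time_average:
  "\<bar>window_average W \<eta> \<epsilon> (t, x) - integral {0..\<eta>} (\<lambda>s. W (t + s, x)) / \<eta>\<bar> \<le> L * \<epsilon>"
  unfolding window_average_def fst_conv snd_conv
proof (rule average_bounds[OF _ \<epsilon>])
  have L: "L \<ge> 0" using lip[of 0 0 1 0] by simp
  show "continuous_on {0..\<epsilon>} (\<lambda>y. integral {0..\<eta>} (\<lambda>s. W (t + s, x - \<epsilon> + y)) / \<eta>)"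
    by (intro time_average_continuous_slice continuous_intros)
  fix y assume y: "0 \<le> y" "y \<le> \<epsilon>"
  have i: "(\<lambda>s. W (t + s, x')) integrable_on {0..\<eta>}" for x'
    by (intro integrable_continuous_real W_continuous_comp continuous_intros)
  have "\<bar>integral {0..\<eta>} (\<lambda>s. W (t + s, x - \<epsilon> + y) - W (t + s, x)) / \<eta> - 0\<bar> \<le> L * \<epsilon>"
  proof (rule average_bounds[OF _ \<eta>])
    show "continuous_on {0..\<eta>} (\<lambda>s. W (t + s, x - \<epsilon> + y) - W (t + s, x))"
      by (intro W_continuous_comp continuous_intros)
    show "\<bar>W (t + s, x - \<epsilon> + y) - W (t + s, x) - 0\<bar> \<le> L * \<epsilon>" for s
      using lip[of "t + s" "x - \<epsilon> + y" "t + s" x] mult_left_mono[of "\<epsilon> - y" \<epsilon> L] L y by simp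
  qed
  then show "\<bar>integral {0..\<eta>} (\<lambda>s. W (t + s, x - \<epsilon> + y)) / \<eta> - integral {0..\<eta>} (\<lambda>s. W (t + s, x)) / \<eta>\<bar> \<le> L * \<epsilon>"
    by (simp add: integral_diff[OF i i] diff_divide_distrib)
qed

lemma window_average_has_partials:
  "has_partials (window_average W \<eta> \<epsilon>)
     (\<lambda>z. integral {0..\<epsilon>} (\<lambda>y. (W (fst z + \<eta>, snd z - \<epsilon> + y) - W (fst z, snd z - \<epsilon> + y)) / \<eta>) / \<epsilon>)
     (\<lambda>z. (integral {0..\<eta>} (\<lambda>s. W (fst z + s, snd z)) / \<eta>
         - integral {0..\<eta>} (\<lambda>s. W (fst z + s, snd z - \<epsilon>)) / \<eta>) / \<epsilon>)"
proof (rule has_partialsI)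
  fix t x :: real
  have dt: "((\<lambda>t. integral {0..\<eta>} (\<lambda>s. W (t + s, u)) / \<eta>) has_real_derivative (W (t + \<eta>, u) - W (t, u)) / \<eta>) (at t)" for t u
    by (intro DERIV_cdivide steklov_derivative[OF _ \<eta>] W_continuous_comp continuous_intros)
  have "((\<lambda>t. integral (cbox 0 \<epsilon>) (\<lambda>y. integral {0..\<eta>} (\<lambda>s. W (t + s, x - \<epsilon> + y)) / \<eta>)) has_real_derivative
      integral (cbox 0 \<epsilon>) (\<lambda>y. (W (t + \<eta>, x - \<epsilon> + y) - W (t, x - \<epsilon> + y)) / \<eta>)) (at t)"
  proof (rule leibniz_rule_field_derivative[where U = UNIV])
    show "((\<lambda>t. integral {0..\<eta>} (\<lambda>s. W (t + s, x - \<epsilon> + y)) / \<eta>) has_real_derivative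
        (W (t + \<eta>, x - \<epsilon> + y) - W (t, x - \<epsilon> + y)) / \<eta>) (at t)" for t y by (rule dt)
    show "(\<lambda>y. integral {0..\<eta>} (\<lambda>s. W (t + s, x - \<epsilon> + y)) / \<eta>) integrable_on cbox 0 \<epsilon>" for t
      by (intro integrable_continuous time_average_continuous_slice continuous_intros)
    show "continuous_on (UNIV \<times> cbox 0 \<epsilon>) (\<lambda>(t, y). (W (t + \<eta>, x - \<epsilon> + y) - W (t, x - \<epsilon> + y)) / \<eta>)"
      using \<eta> by (auto simp: case_prod_beta' intro!: W_continuous_comp continuous_intros)
  qed auto
  then show "((\<lambda>s. window_average W \<eta> \<epsilon> (s, x)) has_real_derivative
      integral {0..\<epsilon>} (\<lambda>y. (W (fst (t, x) + \<eta>, snd (t, x) - \<epsilon> + y) - W (fst (t, x), snd (t, x) - \<epsilon> + y)) / \<eta>) / \<epsilon>) (at t)"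
    unfolding window_average_def fst_conv snd_conv cbox_interval by (rule DERIV_cdivide)
  define T where "T = (\<lambda>x. integral {0..\<eta>} (\<lambda>s. W (t + s, x)) / \<eta>)"
  have T: "continuous_on UNIV T"
    unfolding T_def by (intro time_average_continuous_slice continuous_intros)
  have "((\<lambda>u. integral {0..\<epsilon>} (\<lambda>y. T (u + y))) has_real_derivative T (x - \<epsilon> + \<epsilon>) - T (x - \<epsilon>)) (at (x + (- \<epsilon>)))"
    using steklov_derivative[OF T \<epsilon>, of "x - \<epsilon>"] by simp
  then have "((\<lambda>x. integral {0..\<epsilon>} (\<lambda>y. T (x + (- \<epsilon>) + y))) has_real_derivative T x - T (x - \<epsilon>)) (at x)"
    unfolding DERIV_shift by simp
  from DERIV_cdivide[OF this, of \<epsilon>]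
  have "((\<lambda>x. integral {0..\<epsilon>} (\<lambda>y. T (x + (- \<epsilon>) + y)) / \<epsilon>) has_real_derivative (T x - T (x - \<epsilon>)) / \<epsilon>) (at x)" .
  moreover have "(\<lambda>y. window_average W \<eta> \<epsilon> (t, y)) = (\<lambda>x. integral {0..\<epsilon>} (\<lambda>y. T (x + (- \<epsilon>) + y)) / \<epsilon>)"
    unfolding window_average_def T_def by simp
  ultimately show "((\<lambda>y. window_average W \<eta> \<epsilon> (t, y)) has_real_derivative
      (integral {0..\<eta>} (\<lambda>s. W (fst (t, x) + s, snd (t, x))) / \<eta>
         - integral {0..\<eta>} (\<lambda>s. W (fst (t, x) + s, snd (t, x) - \<epsilon>)) / \<eta>) / \<epsilon>) (at x)"
    unfolding T_def fst_conv snd_conv by (simp only:)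
next
  have "continuous_on UNIV (\<lambda>z. integral (cbox 0 \<epsilon>) (\<lambda>y. (W (fst z + \<eta>, snd z - \<epsilon> + y) - W (fst z, snd z - \<epsilon> + y)) / \<eta>))"
    by (rule integral_continuous_on_param)
      (use \<eta> in \<open>auto simp: case_prod_beta' intro!: W_continuous_comp continuous_intros\<close>)
  then show "continuous_on UNIV (\<lambda>z. integral {0..\<epsilon>} (\<lambda>y. (W (fst z + \<eta>, snd z - \<epsilon> + y) - W (fst z, snd z - \<epsilon> + y)) / \<eta>) / \<epsilon>)"
    unfolding cbox_interval by (rule continuous_on_divide[OF _ continuous_on_const]) (use \<epsilon> in simp)
  show "continuous_on UNIV (\<lambda>z. (integral {0..\<eta>} (\<lambda>s. W (fst z + s, snd z)) / \<eta>
         - integral {0..\<eta>} (\<lambda>s. W (fst z + s, snd z - \<epsilon>)) / \<eta>) / \<epsilon>)"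
  proof -
    have "continuous_on UNIV (\<lambda>z::real\<times>real. (fst z, snd z - \<epsilon>))" by (intro continuous_intros)
    from continuous_on_compose2[OF time_average_continuous[of UNIV] this]
    have "continuous_on UNIV (\<lambda>z. integral {0..\<eta>} (\<lambda>s. W (fst z + s, snd z - \<epsilon>)) / \<eta>)" by simp
    from continuous_on_diff[OF time_average_continuous[of UNIV] this]
    show ?thesis by (rule continuous_on_divide[OF _ continuous_on_const]) (use \<epsilon> in simp)
  qed
qed

lemma window_average_le:
  assumes "\<And>s y. 0 \<le> s \<Longrightarrow> s \<le> \<eta> \<Longrightarrow> 0 \<le> y \<Longrightarrow> y \<le> \<epsilon> \<Longrightarrow>
      W (t + s, x - \<epsilon> + y) \<le> W (t' + s, x' - \<epsilon> + y) + c"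
  shows "window_average W \<eta> \<epsilon> (t, x) \<le> window_average W \<eta> \<epsilon> (t', x') + c"
proof -
  let ?T = "\<lambda>t x. integral {0..\<eta>} (\<lambda>s. W (t + s, x)) / \<eta>"
  have i: "(\<lambda>s. W (t + s, x)) integrable_on {0..\<eta>}" for t x
    by (intro integrable_continuous_real W_continuous_comp continuous_intros)
  have T: "?T t (x - \<epsilon> + y) \<le> ?T t' (x' - \<epsilon> + y) + c" if "0 \<le> y" "y \<le> \<epsilon>" for y
  proof -
    have "integral {0..\<eta>} (\<lambda>s. W (t + s, x - \<epsilon> + y)) \<le> integral {0..\<eta>} (\<lambda>s. W (t' + s, x' - \<epsilon> + y) + c)"
      using assms that by (intro integral_le integrable_add i integrable_const_ivl) auto
    also have "\<dots> = integral {0..\<eta>} (\<lambda>s. W (t' + s, x' - \<epsilon> + y)) + \<eta> * c"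
      using \<eta> by (subst integral_add) (auto intro: i)
    finally show ?thesis using \<eta> by (simp add: field_simps)
  qed
  have j: "(\<lambda>y. ?T t (x - \<epsilon> + y)) integrable_on {0..\<epsilon>}" for t x
    by (intro integrable_continuous_real time_average_continuous_slice continuous_intros)
  have "integral {0..\<epsilon>} (\<lambda>y. ?T t (x - \<epsilon> + y)) \<le> integral {0..\<epsilon>} (\<lambda>y. ?T t' (x' - \<epsilon> + y) + c)"
    using T by (intro integral_le integrable_add j integrable_const_ivl) auto
  also have "\<dots> = integral {0..\<epsilon>} (\<lambda>y. ?T t' (x' - \<epsilon> + y)) + \<epsilon> * c"
    using \<epsilon> by (subst integral_add) (auto intro: j)
  finally show ?thesis
    using divide_right_mono[of _ _ \<epsilon>] \<epsilon> by (fastforce simp: window_average_def add_divide_distrib)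
qed

end

section \<open>Smoothing Lipschitz subsolutions\<close>

lemma right_derivative_nonneg:
  fixes f :: "real \<Rightarrow> real"
  assumes d: "(f has_real_derivative d) (at 0 within {0..h0})" and "f 0 \<le> 0" "h0 > 0"
    and nn: "\<And>h. 0 < h \<Longrightarrow> h < h0 \<Longrightarrow> 0 \<le> f h"
  shows "0 \<le> d"
proof (rule tendsto_lowerbound)
  have "((\<lambda>h. (f h - f 0) / (h - 0)) \<longlongrightarrow> d) (at 0 within {0..h0})"
    using d by (simp add: has_field_derivative_iff)
  then have "((\<lambda>h. (f h - f 0) / (h - 0)) \<longlongrightarrow> d) (at 0 within {0<..<h0})"
    by (rule tendsto_within_subset) auto
  moreover have "at 0 within {0<..<h0} = at_right (0::real)"
    by (rule at_within_nhd[where S = "{..<h0}"]) (use assms(3) in auto)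
  ultimately show "((\<lambda>h. (f h - f 0) / (h - 0)) \<longlongrightarrow> d) (at_right 0)" by simp
  show "\<forall>\<^sub>F h in at_right 0. 0 \<le> (f h - f 0) / (h - 0)"
    using eventually_at_right_real[OF assms(3)]
  proof (rule eventually_mono)
    fix h assume "h \<in> {0<..<h0}"
    then show "0 \<le> (f h - f 0) / (h - 0)" using nn[of h] assms(2) by simp
  qed
qed simp

text \<open>Averaging over \<open>[t, t + \<eta>] \<times> [x - \<epsilon>, x]\<close> yields a \<open>C\<^sup>1\<close> function that satisfies the same moves, and
  these become the differential inequality \<open>p - b q \<le> l\<close>. A function of time alone then
  corrects the trace at \<open>x = 0\<close> to the average of \<open>W\<close> over \<open>[t, t + \<eta>] \<times> {0}\<close>, which is the same from
  both sides. The time derivative of the correction is of order \<open>L \<epsilon> / \<eta>\<close>, thus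
  small if \<open>\<epsilon>\<close> is chosen after \<open>\<eta>\<close>.\<close>

lemma smooth_from_left:
  fixes W :: "real \<times> real \<Rightarrow> real"
  assumes lip: "\<And>t s x y. \<bar>W (t, x) - W (s, y)\<bar> \<le> L * (\<bar>t - s\<bar> + \<bar>x - y\<bar>)"
    and \<theta>: "\<theta> > 0" and \<eta>: "0 < \<eta>" "\<eta> \<le> 1" "L * \<eta> \<le> \<theta> / 2"
  shows "\<exists>\<psi> p q. has_partials \<psi> p q \<and>
    (\<forall>t. \<psi> (t, 0) = integral {0..\<eta>} (\<lambda>s. W (t + s, 0)) / \<eta>) \<and>
    (\<forall>t. p (t, 0) = (W (t + \<eta>, 0) - W (t, 0)) / \<eta>) \<and>
    (\<forall>z. \<bar>\<psi> z - W z\<bar> \<le> \<theta>) \<and>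
    (\<forall>b l. (\<forall>t h x. 0 \<le> h \<longrightarrow> h \<le> t \<longrightarrow> x \<le> 0 \<longrightarrow> x + b * h \<le> 0 \<longrightarrow> W (t, x) \<le> W (t - h, x + b * h) + h * l) \<longrightarrow>
       (\<forall>t x. t > 0 \<longrightarrow> x \<le> 0 \<longrightarrow> p (t, x) - b * q (t, x) \<le> l + \<theta>))"
proof -
  have L: "L \<ge> 0" using lip[of 0 0 1 0] by simp
  define \<epsilon> where "\<epsilon> = \<theta> * \<eta> / (4 * (L + 1))"
  have \<epsilon>: "\<epsilon> > 0" using \<theta> \<eta> L by (simp add: \<epsilon>_def)
  have "2 * L * \<epsilon> \<le> 2 * (L + 1) * \<epsilon>" using \<epsilon> by simp
  also have "\<dots> = \<theta> * \<eta> / 2"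
    using L unfolding \<epsilon>_def by (simp add: divide_simps)
  finally have \<epsilon>\<eta>: "2 * L * \<epsilon> \<le> \<theta> * \<eta> / 2" .
  have "\<theta> * \<eta> \<le> \<theta> * 1" using \<eta>(2) \<theta> by (intro mult_left_mono) auto
  with \<epsilon>\<eta> have \<epsilon>2: "2 * L * \<epsilon> \<le> \<theta> / 2" by linarith
  note ctxt = lip \<eta>(1) \<epsilon>
  define \<Phi> where "\<Phi> = window_average W \<eta> \<epsilon>"
  define P where "P = (\<lambda>z. integral {0..\<epsilon>} (\<lambda>y. (W (fst z + \<eta>, snd z - \<epsilon> + y) - W (fst z, snd z - \<epsilon> + y)) / \<eta>) / \<epsilon>)"
  define Q where "Q = (\<lambda>z. (integral {0..\<eta>} (\<lambda>s. W (fst z + s, snd z)) / \<eta>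
         - integral {0..\<eta>} (\<lambda>s. W (fst z + s, snd z - \<epsilon>)) / \<eta>) / \<epsilon>)"
  define m where "m = (\<lambda>t. integral {0..\<eta>} (\<lambda>s. W (t + s, 0)) / \<eta>)"
  define m' where "m' = (\<lambda>t. (W (t + \<eta>, 0) - W (t, 0)) / \<eta>)"
  have \<Phi>: "has_partials \<Phi> P Q" unfolding \<Phi>_def P_def Q_def
    by (rule window_average_has_partials[OF ctxt])
  define \<psi> where "\<psi> = (\<lambda>z. \<Phi> z + (m (fst z) - \<Phi> (fst z, 0)))"
  define p where "p = (\<lambda>z. P z + (m' (fst z) - P (fst z, 0)))"
  have Wc: "continuous_on S f \<Longrightarrow> continuous_on S (\<lambda>z. W (f z))" for S and f :: "real \<times> real \<Rightarrow> real \<times> real"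
    by (rule W_continuous_comp[OF ctxt])
  have corr: "has_partials (\<lambda>z. m (fst z) - \<Phi> (fst z, 0)) (\<lambda>z. m' (fst z) - P (fst z, 0)) (\<lambda>z. 0)"
  proof (rule has_partialsI)
    fix t x :: real
    have "(m has_real_derivative m' t) (at t)" unfolding m_def m'_def
      by (intro DERIV_cdivide steklov_derivative[OF _ \<eta>(1)] W_continuous_comp[OF ctxt] continuous_intros)
    moreover have "((\<lambda>s. \<Phi> (s, 0)) has_real_derivative P (t, 0)) (at t)"
    proof -
      have i: "((\<lambda>s. (s, 0::real)) has_derivative (\<lambda>h. (h, 0))) (at t)"
        by (auto intro!: derivative_eq_intros)
      have d: "(\<Phi> has_derivative (\<lambda>h. P (t, 0) * fst h + Q (t, 0) * snd h)) (at (t, 0))"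
        using \<Phi> unfolding has_partials_def by blast
      from has_derivative_compose[OF i d] show ?thesis by (simp add: has_field_derivative_def)
    qed
    ultimately show "((\<lambda>s. m (fst (s, x)) - \<Phi> (fst (s, x), 0)) has_real_derivative m' (fst (t, x)) - P (fst (t, x), 0)) (at t)"
      by (auto intro: DERIV_diff)
    show "((\<lambda>y. m (fst (t, y)) - \<Phi> (fst (t, y), 0)) has_real_derivative 0) (at x)" by simp
  next
    have "continuous_on UNIV P" using \<Phi> by (simp add: has_partials_def)
    then have "continuous_on UNIV (\<lambda>z::real\<times>real. P (fst z, 0))"
      by (rule continuous_on_compose2) (auto intro!: continuous_intros)
    moreover have "continuous_on UNIV (\<lambda>z::real\<times>real. m' (fst z))"
      unfolding m'_def using \<eta>(1) by (auto intro!: Wc continuous_intros)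
    ultimately show "continuous_on UNIV (\<lambda>z::real\<times>real. m' (fst z) - P (fst z, 0))"
      by (intro continuous_on_diff)
  qed simp
  have \<psi>: "has_partials \<psi> p Q"
    unfolding \<psi>_def p_def using has_partials_add[OF \<Phi> corr] by simp
  have P_near: "\<bar>P (t, 0) - m' t\<bar> \<le> \<theta> / 2" for t
    unfolding P_def fst_conv snd_conv
  proof (rule average_bounds[OF _ \<epsilon>])
    show "continuous_on {0..\<epsilon>} (\<lambda>y. (W (t + \<eta>, 0 - \<epsilon> + y) - W (t, 0 - \<epsilon> + y)) / \<eta>)"
      using \<eta>(1) by (auto intro!: W_continuous_comp[OF ctxt] continuous_intros)
    fix y assume y: "0 \<le> y" "y \<le> \<epsilon>"
    have "\<bar>W (t', 0 - \<epsilon> + y) - W (t', 0)\<bar> \<le> L * \<epsilon>" for t'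
      using lip[of t' "0 - \<epsilon> + y" t' 0] mult_left_mono[of "\<epsilon> - y" \<epsilon> L] L y by simp
    from this[of "t + \<eta>"] this[of t]
    have "\<bar>(W (t + \<eta>, 0 - \<epsilon> + y) - W (t, 0 - \<epsilon> + y)) - (W (t + \<eta>, 0) - W (t, 0))\<bar> \<le> 2 * L * \<epsilon>"
      by linarith
    also have "\<dots> \<le> \<theta> * \<eta> / 2" by (rule \<epsilon>\<eta>)
    finally have "\<bar>((W (t + \<eta>, 0 - \<epsilon> + y) - W (t, 0 - \<epsilon> + y)) - (W (t + \<eta>, 0) - W (t, 0))) / \<eta>\<bar> \<le> \<theta> / 2"
      using \<eta>(1) by (simp add: abs_divide field_simps)
    then show "\<bar>(W (t + \<eta>, 0 - \<epsilon> + y) - W (t, 0 - \<epsilon> + y)) / \<eta> - m' t\<bar> \<le> \<theta> / 2"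
      by (simp add: m'_def diff_divide_distrib)
  qed
  have near: "\<bar>\<psi> z - W z\<bar> \<le> \<theta>" for z
  proof -
    have "\<bar>\<Phi> z - W z\<bar> \<le> L * (\<eta> + \<epsilon>)"
      using window_average_near[OF ctxt, of "fst z" "snd z"] by (simp add: \<Phi>_def)
    moreover have "\<bar>\<Phi> (fst z, 0) - m (fst z)\<bar> \<le> L * \<epsilon>"
      using window_average_near_time_average[OF ctxt, of "fst z" 0] by (simp add: \<Phi>_def m_def)
    moreover have "L * (\<eta> + \<epsilon>) + L * \<epsilon> \<le> \<theta>" using \<eta>(3) \<epsilon>2 by (simp add: algebra_simps)
    ultimately show ?thesis unfolding \<psi>_def by linarith
  qed
  have ineq: "p (t, x) - b * Q (t, x) \<le> l + \<theta>"
    if W: "\<And>t h x. 0 \<le> h \<Longrightarrow> h \<le> t \<Longrightarrow> x \<le> 0 \<Longrightarrow> x + b * h \<le> 0 \<Longrightarrow> W (t, x) \<le> W (t - h, x + b * h) + h * l"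
      and t: "t > 0" and x: "x \<le> 0" for b l t x
  proof -
    have int: "P (t, x) - b * Q (t, x) \<le> l" if x: "x < 0" for x
    proof -
      define h0 where "h0 = min t (- x / (\<bar>b\<bar> + 1))"
      have h0: "h0 > 0" "h0 \<le> t" using t x by (auto simp: h0_def intro!: divide_neg_pos)
      have "0 \<le> - P (t, x) + b * Q (t, x) + l"
      proof (rule right_derivative_nonneg[OF _ _ h0(1)])
        have i: "((\<lambda>h. (t - h, x + b * h)) has_derivative (\<lambda>h. (- h, b * h))) (at 0 within {0..h0})"
          by (auto intro!: derivative_eq_intros)
        have "(\<Phi> has_derivative (\<lambda>h. P (t, x) * fst h + Q (t, x) * snd h)) (at (t - 0, x + b * 0))"
          using \<Phi> unfolding has_partials_def by simp
        from has_derivative_compose[OF i this]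
        have "((\<lambda>h. \<Phi> (t - h, x + b * h)) has_derivative (\<lambda>h. P (t, x) * (- h) + Q (t, x) * (b * h))) (at 0 within {0..h0})"
          by (simp only: fst_conv snd_conv)
        moreover have "(\<lambda>h. P (t, x) * (- h) + Q (t, x) * (b * h)) = (*) (- P (t, x) + b * Q (t, x))"
          by (simp add: fun_eq_iff algebra_simps)
        ultimately have "((\<lambda>h. \<Phi> (t - h, x + b * h)) has_real_derivative - P (t, x) + b * Q (t, x)) (at 0 within {0..h0})"
          by (simp only: has_field_derivative_def)
        then show "((\<lambda>h. \<Phi> (t - h, x + b * h) + h * l - \<Phi> (t, x)) has_real_derivative
            - P (t, x) + b * Q (t, x) + l) (at 0 within {0..h0})"
          by (auto intro!: derivative_eq_intros)
        fix h assume h: "0 < h" "h < h0"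
        have "\<bar>b\<bar> * h + h \<le> - x" using h by (simp add: h0_def field_simps)
        moreover have "b * h \<le> \<bar>b\<bar> * h" using h by (intro mult_right_mono) auto
        ultimately have xb: "x + b * h \<le> 0" using h by linarith
        have "\<Phi> (t, x) \<le> \<Phi> (t - h, x + b * h) + h * l"
          unfolding \<Phi>_def
        proof (rule window_average_le[OF ctxt])
          fix s y assume sy: "0 \<le> s" "s \<le> \<eta>" "0 \<le> y" "y \<le> \<epsilon>"
          have "W (t + s, x - \<epsilon> + y) \<le> W (t + s - h, x - \<epsilon> + y + b * h) + h * l"
            using sy h h0 x xb by (intro W) auto
          then show "W (t + s, x - \<epsilon> + y) \<le> W (t - h + s, x + b * h - \<epsilon> + y) + h * l"
            by (simp add: algebra_simps)
        qed
        then show "0 \<le> \<Phi> (t - h, x + b * h) + h * l - \<Phi> (t, x)" by simp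
      qed simp
      then show ?thesis by simp
    qed
    have "P (t, x) - b * Q (t, x) \<le> l"
    proof (rule tendsto_upperbound)
      have c: "continuous_on UNIV P" "continuous_on UNIV Q" using \<Phi> by (auto simp: has_partials_def)
      have i: "continuous_on UNIV (\<lambda>x::real. (t, x))" by (intro continuous_intros)
      have "continuous_on UNIV (\<lambda>x. P (t, x) - b * Q (t, x))"
        by (intro continuous_on_diff continuous_on_mult continuous_on_const
            continuous_on_compose2[OF c(1) i] continuous_on_compose2[OF c(2) i] subset_UNIV)
      then have "((\<lambda>x. P (t, x) - b * Q (t, x)) \<longlongrightarrow> P (t, x) - b * Q (t, x)) (at x within UNIV)"
        unfolding continuous_on_def by blast
      then show "((\<lambda>x. P (t, x) - b * Q (t, x)) \<longlongrightarrow> P (t, x) - b * Q (t, x)) (at_left x)"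
        by (rule tendsto_within_subset) simp
      show "\<forall>\<^sub>F x in at_left x. P (t, x) - b * Q (t, x) \<le> l"
        using eventually_at_left_real[of "x - 1" x] by (rule eventually_mono) (use int x in auto)
    qed simp
    then show ?thesis unfolding p_def fst_conv using P_near[of t] \<theta> by linarith
  qed
  have "\<psi> (t, 0) = m t" "p (t, 0) = m' t" for t by (simp_all add: \<psi>_def p_def)
  then show ?thesis using \<psi> near ineq unfolding m_def m'_def
    by (intro exI[of _ \<psi>] exI[of _ p] exI[of _ Q]) blast
qed

lemma has_partials_reflect:
  assumes "has_partials f p q"
  shows "has_partials (\<lambda>z. f (fst z, - snd z)) (\<lambda>z. p (fst z, - snd z)) (\<lambda>z. - q (fst z, - snd z))"
  unfolding has_partials_def
proof (intro conjI allI)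
  have c: "continuous_on UNIV (\<lambda>z::real\<times>real. (fst z, - snd z))" by (intro continuous_intros)
  have "continuous_on UNIV p" "continuous_on UNIV q" using assms by (auto simp: has_partials_def)
  then show "continuous_on UNIV (\<lambda>z. p (fst z, - snd z))" "continuous_on UNIV (\<lambda>z. - q (fst z, - snd z))"
    using continuous_on_compose2[OF _ c, of UNIV p] continuous_on_compose2[OF _ c, of UNIV q]
    by (auto intro: continuous_on_minus)
  fix z :: "real \<times> real"
  have i: "((\<lambda>z. (fst z, - snd z)) has_derivative (\<lambda>h. (fst h, - snd h))) (at z)"
    by (auto intro!: derivative_eq_intros)
  have "(f has_derivative (\<lambda>h. p (fst z, - snd z) * fst h + q (fst z, - snd z) * snd h)) (at (fst z, - snd z))"
    using assms unfolding has_partials_def by blast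
  from has_derivative_compose[OF i this]
  show "((\<lambda>z. f (fst z, - snd z)) has_derivative
      (\<lambda>h. p (fst z, - snd z) * fst h + - q (fst z, - snd z) * snd h)) (at z)" by simp
qed

lemma smooth_from_right:
  fixes W :: "real \<times> real \<Rightarrow> real"
  assumes lip: "\<And>t s x y. \<bar>W (t, x) - W (s, y)\<bar> \<le> L * (\<bar>t - s\<bar> + \<bar>x - y\<bar>)"
    and \<theta>: "\<theta> > 0" and \<eta>: "0 < \<eta>" "\<eta> \<le> 1" "L * \<eta> \<le> \<theta> / 2"
  shows "\<exists>\<psi> p q. has_partials \<psi> p q \<and>
    (\<forall>t. \<psi> (t, 0) = integral {0..\<eta>} (\<lambda>s. W (t + s, 0)) / \<eta>) \<and>
    (\<forall>t. p (t, 0) = (W (t + \<eta>, 0) - W (t, 0)) / \<eta>) \<and>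
    (\<forall>z. \<bar>\<psi> z - W z\<bar> \<le> \<theta>) \<and>
    (\<forall>b l. (\<forall>t h x. 0 \<le> h \<longrightarrow> h \<le> t \<longrightarrow> 0 \<le> x \<longrightarrow> 0 \<le> x + b * h \<longrightarrow> W (t, x) \<le> W (t - h, x + b * h) + h * l) \<longrightarrow>
       (\<forall>t x. t > 0 \<longrightarrow> 0 \<le> x \<longrightarrow> p (t, x) - b * q (t, x) \<le> l + \<theta>))"
proof -
  define W' where "W' = (\<lambda>z. W (fst z, - snd z))"
  have lip': "\<bar>W' (t, x) - W' (s, y)\<bar> \<le> L * (\<bar>t - s\<bar> + \<bar>x - y\<bar>)" for t s x y
    using lip[of t "- x" s "- y"] by (simp add: W'_def abs_minus_commute)
  obtain \<psi> p q where *: "has_partials \<psi> p q"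
    "\<And>t. \<psi> (t, 0) = integral {0..\<eta>} (\<lambda>s. W' (t + s, 0)) / \<eta>"
    "\<And>t. p (t, 0) = (W' (t + \<eta>, 0) - W' (t, 0)) / \<eta>"
    "\<And>z. \<bar>\<psi> z - W' z\<bar> \<le> \<theta>"
    "\<And>b l t x. (\<forall>t h x. 0 \<le> h \<longrightarrow> h \<le> t \<longrightarrow> x \<le> 0 \<longrightarrow> x + b * h \<le> 0 \<longrightarrow> W' (t, x) \<le> W' (t - h, x + b * h) + h * l) \<Longrightarrow>
       t > 0 \<Longrightarrow> x \<le> 0 \<Longrightarrow> p (t, x) - b * q (t, x) \<le> l + \<theta>"
    using smooth_from_left[of W' L \<theta> \<eta>, OF lip' \<theta> \<eta>] by blast
  show ?thesis
  proof (intro exI conjI allI impI)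
    show "has_partials (\<lambda>z. \<psi> (fst z, - snd z)) (\<lambda>z. p (fst z, - snd z)) (\<lambda>z. - q (fst z, - snd z))"
      by (rule has_partials_reflect[OF *(1)])
    show "\<psi> (fst (t, 0), - snd (t, 0::real)) = integral {0..\<eta>} (\<lambda>s. W (t + s, 0)) / \<eta>" for t
      using *(2)[of t] by (simp add: W'_def)
    show "p (fst (t, 0), - snd (t, 0::real)) = (W (t + \<eta>, 0) - W (t, 0)) / \<eta>" for t
      using *(3)[of t] by (simp add: W'_def)
    show "\<bar>\<psi> (fst z, - snd z) - W z\<bar> \<le> \<theta>" for z
      using *(4)[of "(fst z, - snd z)"] by (simp add: W'_def)
    fix b l t x :: real
    assume W: "\<forall>t h x. 0 \<le> h \<longrightarrow> h \<le> t \<longrightarrow> 0 \<le> x \<longrightarrow> 0 \<le> x + b * h \<longrightarrow> W (t, x) \<le> W (t - h, x + b * h) + h * l"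
      and "t > 0" "0 \<le> x"
    have "W' (t, x) \<le> W' (t - h, x + - b * h) + h * l"
      if "0 \<le> h" "h \<le> t" "x \<le> 0" "x + - b * h \<le> 0" for t h x
      using W[rule_format, of h t "- x"] that by (simp add: W'_def algebra_simps)
    then have "p (t, - x) - - b * q (t, - x) \<le> l + \<theta>"
      by (intro *(5)) (use \<open>t > 0\<close> \<open>0 \<le> x\<close> in auto)
    then show "p (fst (t, x), - snd (t, x)) - b * - q (fst (t, x), - snd (t, x)) \<le> l + \<theta>" by simp
  qed
qed

section \<open>Comparison with Lipschitz subsolutions\<close>

context junction_control begin

text \<open>The smoothed and penalized subsolution is a strict classical subsolution and may be used as a test
  function for \<open>\<zeta>\<close> from below. At the junction its two halves have the common time derivative
  \<open>(W (t + \<eta>, 0) - W (t, 0)) / \<eta>\<close>, which is at most \<open>- A\<close> because resting is a move.\<close>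

lemma comparison:
  assumes moves: "moves W"
    and lip: "\<And>t s x y. \<bar>W (t, x) - W (s, y)\<bar> \<le> L * (\<bar>t - s\<bar> + \<bar>x - y\<bar>)"
    and super: "glued_supersolution H1 H2 F \<zeta>"
    and init: "\<And>x. W (0, x) \<le> \<zeta> (0, x)"
    and t0: "t0 \<ge> 0"
  shows "W (t0, x0) \<le> \<zeta> (t0, x0)"
proof (rule ccontr)
  define E where "E = W (t0, x0) - \<zeta> (t0, x0)"
  assume "\<not> ?thesis"
  then have E: "E > 0" by (simp add: E_def)
  have L: "L \<ge> 0" using lip[of 0 0 1 0] by simp
  define \<sigma> where "\<sigma> = E / (4 * (t0 + 1))"
  have \<sigma>: "\<sigma> > 0" using E t0 by (simp add: \<sigma>_def)
  have "\<sigma> * (t0 + 1) = E / 4" using t0 unfolding \<sigma>_def by (simp add: divide_simps)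
  then have \<sigma>t: "\<sigma> * t0 + \<sigma> = E / 4" by (simp add: algebra_simps)
  have "0 \<le> \<sigma> * t0" using \<sigma> t0 by simp
  with \<sigma>t have \<sigma>b: "\<sigma> * t0 \<le> E / 4" "\<sigma> \<le> E / 4" using \<sigma> by linarith+
  define \<theta> where "\<theta> = \<sigma> / 2"
  have \<theta>: "\<theta> > 0" "\<theta> < \<sigma>" "\<theta> \<le> E / 8" using \<sigma> \<sigma>b by (auto simp: \<theta>_def)
  define \<eta> where "\<eta> = min 1 (\<theta> / (2 * (L + 1)))"
  have \<eta>: "0 < \<eta>" "\<eta> \<le> 1" using \<theta>(1) L by (auto simp: \<eta>_def)
  have "L * \<eta> \<le> (L + 1) * \<eta>" using \<eta> by (intro mult_right_mono) auto
  also have "\<dots> \<le> (L + 1) * (\<theta> / (2 * (L + 1)))" using L by (intro mult_left_mono) (auto simp: \<eta>_def)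
  also have "\<dots> = \<theta> / 2" using L by (simp add: divide_simps)
  finally have \<eta>3: "L * \<eta> \<le> \<theta> / 2" .
  obtain \<psi>L pL qL where L1: "has_partials \<psi>L pL qL"
    and L2: "\<And>t. \<psi>L (t, 0) = integral {0..\<eta>} (\<lambda>s. W (t + s, 0)) / \<eta>"
    and L3: "\<And>t. pL (t, 0) = (W (t + \<eta>, 0) - W (t, 0)) / \<eta>"
    and L4: "\<And>z. \<bar>\<psi>L z - W z\<bar> \<le> \<theta>"
    and L5: "\<And>b l t x. (\<forall>t h x. 0 \<le> h \<longrightarrow> h \<le> t \<longrightarrow> x \<le> 0 \<longrightarrow> x + b * h \<le> 0 \<longrightarrow> W (t, x) \<le> W (t - h, x + b * h) + h * l) \<Longrightarrow>
       t > 0 \<Longrightarrow> x \<le> 0 \<Longrightarrow> pL (t, x) - b * qL (t, x) \<le> l + \<theta>"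
    using smooth_from_left[OF lip \<theta>(1) \<eta> \<eta>3] by blast
  obtain \<psi>R pR qR where R1: "has_partials \<psi>R pR qR"
    and R2: "\<And>t. \<psi>R (t, 0) = integral {0..\<eta>} (\<lambda>s. W (t + s, 0)) / \<eta>"
    and R3: "\<And>t. pR (t, 0) = (W (t + \<eta>, 0) - W (t, 0)) / \<eta>"
    and R4: "\<And>z. \<bar>\<psi>R z - W z\<bar> \<le> \<theta>"
    and R5: "\<And>b l t x. (\<forall>t h x. 0 \<le> h \<longrightarrow> h \<le> t \<longrightarrow> 0 \<le> x \<longrightarrow> 0 \<le> x + b * h \<longrightarrow> W (t, x) \<le> W (t - h, x + b * h) + h * l) \<Longrightarrow>
       t > 0 \<Longrightarrow> 0 \<le> x \<Longrightarrow> pR (t, x) - b * qR (t, x) \<le> l + \<theta>"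
    using smooth_from_right[OF lip \<theta>(1) \<eta> \<eta>3] by blast
  have subL: "pL (t, x) + H1 (qL (t, x)) \<le> \<theta>" if "t > 0" "x \<le> 0" for t x
  proof -
    have "H1 (qL (t, x)) \<le> \<theta> - pL (t, x)"
    proof (rule S1.ham_le)
      fix \<alpha> assume a: "\<alpha> \<in> A1"
      have "pL (t, x) - b1 \<alpha> * qL (t, x) \<le> l1 \<alpha> + \<theta>"
        by (rule L5[OF _ that], intro allI impI) (rule moves_left[OF moves a])
      then show "- b1 \<alpha> * qL (t, x) - l1 \<alpha> \<le> \<theta> - pL (t, x)" by simp
    qed
    then show ?thesis by simp
  qed
  have subR: "pR (t, x) + H2 (qR (t, x)) \<le> \<theta>" if "t > 0" "0 \<le> x" for t x
  proof -
    have "H2 (qR (t, x)) \<le> \<theta> - pR (t, x)"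
    proof (rule S2.ham_le)
      fix \<alpha> assume a: "\<alpha> \<in> A2"
      have "pR (t, x) - b2 \<alpha> * qR (t, x) \<le> l2 \<alpha> + \<theta>"
        by (rule R5[OF _ that], intro allI impI) (rule moves_right[OF moves a])
      then show "- b2 \<alpha> * qR (t, x) - l2 \<alpha> \<le> \<theta> - pR (t, x)" by simp
    qed
    then show ?thesis by simp
  qed
  have sub0: "pL (t, 0) + A \<le> 0" if "t > 0" for t
  proof -
    have "W (t + \<eta>, 0) \<le> W (t + \<eta> - \<eta>, 0) - \<eta> * A"
      using that \<eta>(1) by (intro moves_stay[OF moves]) auto
    then show ?thesis using \<eta>(1) by (simp add: L3 field_simps)
  qed
  \<comment> \<open>Since speeds are at most \<open>C\<close>, the backward cone \<open>\<bar>x\<bar> + C t \<le> R\<close> is a domain of dependence: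
    a penalty that is a nondecreasing function of \<open>\<bar>x\<bar> + C t\<close> preserves subsolutions.\<close>
  define R where "R = \<bar>x0\<bar> + C * t0"
  define K where "K = {z. 0 \<le> fst z \<and> \<bar>snd z\<bar> + C * fst z \<le> R + 1}"
  have "closed K" unfolding K_def
    by (intro closed_Collect_conj closed_Collect_le continuous_intros)
  moreover have "bounded K"
  proof -
    have "K \<subseteq> {0..(R + 1) / C} \<times> {- (R + 1)..R + 1}"
    proof
      fix z assume z: "z \<in> K"
      then have "0 \<le> C * fst z" using C_pos by (auto simp: K_def)
      then have "\<bar>snd z\<bar> \<le> R + 1" "C * fst z \<le> R + 1" "0 \<le> fst z" using z by (auto simp: K_def)
      then show "z \<in> {0..(R + 1) / C} \<times> {- (R + 1)..R + 1}"
        using C_pos by (cases z) (auto simp: field_simps)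
    qed
    then show ?thesis by (rule bounded_subset[rotated]) (intro bounded_Times bounded_closed_interval)
  qed
  ultimately have Kc: "compact K" by (simp add: compact_eq_bounded_closed)
  have z0: "(t0, x0) \<in> K" using t0 by (simp add: K_def R_def)
  have K': "K \<noteq> {}" "K \<subseteq> time_space" using z0 by (blast, auto simp: K_def time_space_def)
  have usc: "usc (\<lambda>z. - \<zeta> z)" using super by (simp add: glued_supersolution_def)
  obtain B where B: "\<And>z. z \<in> K \<Longrightarrow> - \<zeta> z + \<psi>L z \<le> B"
  proof -
    have "continuous_on UNIV (\<lambda>z. - \<psi>L z)" using has_partials_continuous[OF L1] by (intro continuous_on_minus)
    from usc_diff_attains_max[OF usc this Kc K'] obtain z where
      "\<forall>y\<in>K. - \<zeta> y - - \<psi>L y \<le> - \<zeta> z - - \<psi>L z" by blast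
    then show thesis by (intro that[of "- \<zeta> z + \<psi>L z"]) auto
  qed
  \<comment> \<open>On the lateral boundary of \<open>K\<close>, where the penalty equals \<open>\<kappa>\<close>, the maximum is then not reached.\<close>
  define \<kappa> where "\<kappa> = \<bar>B\<bar> + 2 * \<theta>"
  have \<kappa>: "\<kappa> \<ge> 0" using \<theta> by (simp add: \<kappa>_def)
  define pen where "pen = (\<lambda>k z. (0 + (- \<sigma>) * fst z + 0 * snd z)
     + (- \<kappa>) * ((max 0 (- R + C * fst z + k * snd z))\<^sup>2))"
  define pp where "pp = (\<lambda>k z. (- \<sigma>) + (- \<kappa>) * (2 * max 0 (- R + C * fst z + k * snd z) * C))"
  define pq where "pq = (\<lambda>k z. 0 + (- \<kappa>) * (2 * max 0 (- R + C * fst z + k * snd z) * k))"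
  have pen: "has_partials (pen k) (pp k) (pq k)" for k
    unfolding pen_def pp_def pq_def
    by (intro has_partials_add has_partials_affine has_partials_cmult has_partials_pos_part_power2)
  define \<phi>L where "\<phi>L = (\<lambda>z. \<psi>L z + pen (- 1) z)"
  define \<phi>R where "\<phi>R = (\<lambda>z. \<psi>R z + pen 1 z)"
  have pL: "has_partials \<phi>L (\<lambda>z. pL z + pp (- 1) z) (\<lambda>z. qL z + pq (- 1) z)"
    unfolding \<phi>L_def by (rule has_partials_add[OF L1 pen])
  have pR: "has_partials \<phi>R (\<lambda>z. pR z + pp 1 z) (\<lambda>z. qR z + pq 1 z)"
    unfolding \<phi>R_def by (rule has_partials_add[OF R1 pen])
  have agree: "\<forall>s. \<phi>L (s, 0) = \<phi>R (s, 0)" by (simp add: \<phi>L_def \<phi>R_def L2 R2 pen_def)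
  let ?\<Phi> = "glue \<phi>L \<phi>R"
  have \<Phi>c: "continuous_on UNIV (\<lambda>z. - ?\<Phi> z)"
    using glue_continuous[OF pL pR] agree by (intro continuous_on_minus) auto
  have \<Phi>: "\<bar>?\<Phi> z + \<sigma> * fst z + \<kappa> * (max 0 (\<bar>snd z\<bar> + C * fst z - R))\<^sup>2 - W z\<bar> \<le> \<theta>" for z
    using L4[of z] R4[of z] by (auto simp: glue_def \<phi>L_def \<phi>R_def pen_def algebra_simps abs_if)
  obtain z where z: "z \<in> K" and zmax: "\<And>y. y \<in> K \<Longrightarrow> - \<zeta> y - - ?\<Phi> y \<le> - \<zeta> z - - ?\<Phi> z"
    using usc_diff_attains_max[OF usc \<Phi>c Kc K'] by blast
  obtain t x where tx: "z = (t, x)" by (cases z)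
  have tK: "0 \<le> t" "\<bar>x\<bar> + C * t \<le> R + 1" using z by (auto simp: K_def tx)
  have V: "E / 2 \<le> ?\<Phi> (t, x) - \<zeta> (t, x)"
  proof -
    have "?\<Phi> (t0, x0) - \<zeta> (t0, x0) \<le> ?\<Phi> (t, x) - \<zeta> (t, x)" using zmax[OF z0] by (simp add: tx)
    moreover have "W (t0, x0) - \<theta> - \<sigma> * t0 \<le> ?\<Phi> (t0, x0)"
      using \<Phi>[of "(t0, x0)"] by (simp add: R_def)
    moreover have "W (t0, x0) = E + \<zeta> (t0, x0)" by (simp add: E_def)
    ultimately show ?thesis using \<theta>(3) \<sigma>b(1) E by linarith
  qed
  have nn: "0 \<le> \<sigma> * t" "0 \<le> \<kappa> * (max 0 (\<bar>x\<bar> + C * t - R))\<^sup>2" using \<sigma> \<kappa> tK by auto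
  have inner1: "t > 0"
  proof (rule ccontr)
    assume "\<not> t > 0"
    then have t: "t = 0" using tK by simp
    have "?\<Phi> (t, x) - \<zeta> (t, x) \<le> \<theta>" using \<Phi>[of "(t, x)"] nn init[of x] t by simp
    then show False using V \<theta>(3) E by simp
  qed
  have inner2: "\<bar>x\<bar> + C * t < R + 1"
  proof (rule ccontr)
    assume "\<not> \<bar>x\<bar> + C * t < R + 1"
    then have "\<bar>x\<bar> + C * t - R = 1" using tK by simp
    then have "?\<Phi> (t, x) \<le> W (t, x) + \<theta> - \<kappa>" using \<Phi>[of "(t, x)"] nn by simp
    moreover have "W (t, x) \<le> \<psi>L (t, x) + \<theta>" using L4[of "(t, x)"] by simp
    ultimately show False using B[OF z] V E unfolding \<kappa>_def tx by linarith
  qed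
  have "open {z. 0 < fst z \<and> \<bar>snd z\<bar> + C * fst z < R + 1}"
    by (intro open_Collect_conj open_Collect_less continuous_intros)
  then have "\<forall>\<^sub>F y in nhds (t, x). y \<in> {z. 0 < fst z \<and> \<bar>snd z\<bar> + C * fst z < R + 1}"
    by (rule eventually_nhds_in_open) (use inner1 inner2 in auto)
  then have touch: "\<forall>\<^sub>F y in nhds (t, x). ?\<Phi> y - \<zeta> y \<le> ?\<Phi> (t, x) - \<zeta> (t, x)"
  proof (rule eventually_mono)
    fix y assume "y \<in> {z. 0 < fst z \<and> \<bar>snd z\<bar> + C * fst z < R + 1}"
    then have "y \<in> K" by (auto simp: K_def)
    from zmax[OF this] show "?\<Phi> y - \<zeta> y \<le> ?\<Phi> (t, x) - \<zeta> (t, x)" by (simp add: tx)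
  qed
  have visc: "(x < 0 \<longrightarrow> 0 \<le> pL (t, x) + pp (- 1) (t, x) + H1 (qL (t, x) + pq (- 1) (t, x))) \<and>
      (x > 0 \<longrightarrow> 0 \<le> pR (t, x) + pp 1 (t, x) + H2 (qR (t, x) + pq 1 (t, x))) \<and>
      (x = 0 \<longrightarrow> 0 \<le> pL (t, 0) + pp (- 1) (t, 0) + F (qL (t, 0) + pq (- 1) (t, 0)) (qR (t, 0) + pq 1 (t, 0)))"
    using super pL pR agree inner1 touch unfolding glued_supersolution_def by blast
  have shift: "pp k (t, x) + C * \<bar>pq k (t, x)\<bar> \<le> - \<sigma>" if "\<bar>k\<bar> = 1" for k x
  proof -
    define r where "r = max 0 (- R + C * t + k * x)"
    have r: "r \<ge> 0" by (simp add: r_def)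
    have e: "pq k (t, x) = - (\<kappa> * (2 * r) * k)" "pp k (t, x) = - \<sigma> - \<kappa> * (2 * r) * C"
      by (simp_all add: pq_def pp_def r_def)
    have "\<bar>pq k (t, x)\<bar> = \<kappa> * (2 * r)" using \<kappa> r that by (simp add: e abs_mult)
    then show ?thesis by (simp add: e(2))
  qed
  have left: "pL (t, x) + pp (- 1) (t, x) + H1 (qL (t, x) + pq (- 1) (t, x)) \<le> \<theta> - \<sigma>" if "x \<le> 0" for x
    using S1.ham_shift_le[OF b1_le, of "qL (t, x)" "pq (- 1) (t, x)"] subL[OF inner1 that] shift[of "- 1" x]
    by simp
  have right: "pR (t, x) + pp 1 (t, x) + H2 (qR (t, x) + pq 1 (t, x)) \<le> \<theta> - \<sigma>" if "0 \<le> x" for x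
    using S2.ham_shift_le[OF b2_le, of "qR (t, x)" "pq 1 (t, x)"] subR[OF inner1 that] shift[of 1 x]
    by simp
  consider "x < 0" | "x > 0" | "x = 0" by linarith
  then show False
  proof cases
    case 1 then show False using visc left[of x] \<theta> by simp
  next
    case 2 then show False using visc right[of x] \<theta> by simp
  next
    case 3
    have "pR (t, 0) = pL (t, 0)" "pp 1 (t, 0) = pp (- 1) (t, 0)" by (simp_all add: L3 R3 pp_def)
    moreover have "pp (- 1) (t, 0) \<le> - \<sigma>"
    proof -
      have "0 \<le> C * \<bar>pq (- 1) (t, 0)\<bar>" using C_pos by simp
      moreover have "pp (- 1) (t, 0) + C * \<bar>pq (- 1) (t, 0)\<bar> \<le> - \<sigma>" by (rule shift) simp
      ultimately show ?thesis by linarith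
    qed
    moreover have "incr_part H1 p1 q \<le> H1 q" "decr_part H2 p2 q \<le> H2 q" for q
      using S1.monotone_parts_le_ham[OF p1] S2.monotone_parts_le_ham[OF p2] by auto
    ultimately have "pL (t, 0) + pp (- 1) (t, 0) + F (qL (t, 0) + pq (- 1) (t, 0)) (qR (t, 0) + pq 1 (t, 0)) \<le> \<theta> - \<sigma>"
      using left[of 0] right[of 0] sub0[OF inner1] \<theta> unfolding flux_limited_def by (smt (verit))
    then show False using visc 3 \<theta> by simp
  qed
qed

end

section \<open>Lipschitz functions and their derivatives almost everywhere\<close>

lemma integrable_lebesgue_on_const:
  "integrable (lebesgue_on {a<..<b::real}) (\<lambda>_. c::real)"
  by (intro finite_measure.integrable_const finite_measure_lebesgue_on lmeasurable_interval(2))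

text \<open>The difference quotients of \<open>X\<close> are bounded by its Lipschitz constant and converge almost
  everywhere, so their integrals converge to the integral of the derivative. These integrals
  telescope to averages over short intervals at the two ends.\<close>

lemma lipschitz_fundamental_theorem:
  fixes X f :: "real \<Rightarrow> real"
  assumes lip: "L-lipschitz_on {a..b} X" and ab: "a \<le> b"
    and f: "f \<in> borel_measurable (lebesgue_on {a<..<b})"
    and d: "AE s in lebesgue_on {a<..<b}. (X has_real_derivative f s) (at s)"
  shows "(f has_integral X b - X a) {a..b}"
proof -
  define Y where "Y = (\<lambda>s. X (max a (min b s)))"
  have L: "L \<ge> 0" using lip by (rule lipschitz_on_nonneg)
  have Y_lip: "\<bar>Y s - Y u\<bar> \<le> L * \<bar>s - u\<bar>" for s u
  proof -
    have "dist (X (max a (min b s))) (X (max a (min b u))) \<le> L * dist (max a (min b s)) (max a (min b u))"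
      by (rule lipschitz_onD[OF lip]) (use ab in auto)
    also have "\<dots> \<le> L * \<bar>s - u\<bar>" using L by (intro mult_left_mono) (auto simp: dist_real_def)
    finally show ?thesis by (simp add: Y_def dist_real_def)
  qed
  have "L-lipschitz_on UNIV Y" by (rule lipschitz_onI) (use Y_lip L in \<open>auto simp: dist_real_def\<close>)
  then have Yc: "continuous_on S Y" for S
    using lipschitz_on_continuous_on continuous_on_subset by blast
  have Ycc: "continuous_on S (\<lambda>s. Y (s + c))" for S c
    by (rule continuous_on_compose2[OF Yc[of UNIV]]) (auto intro: continuous_intros)
  define h where "h = (\<lambda>n. inverse (real (Suc n)))"
  have h: "h n > 0" "h n \<le> 1" for n by (auto simp: h_def field_simps)
  have h0: "h \<longlonglongrightarrow> 0" unfolding h_def by (rule LIMSEQ_inverse_real_of_nat)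
  define G where "G = (\<lambda>n s. (Y (s + h n) - Y s) / h n)"
  let ?M = "lebesgue_on {a<..<b}"
  have Gc: "continuous_on S (G n)" for S n
    unfolding G_def using h(1)[of n] by (intro continuous_on_divide continuous_on_diff Yc Ycc continuous_on_const) auto
  have Gm: "G n \<in> borel_measurable ?M" for n
    by (rule continuous_imp_measurable_on_sets_lebesgue[OF Gc]) simp
  have lim: "AE s in ?M. (\<lambda>n. G n s) \<longlonglongrightarrow> f s"
    using d AE_space
  proof eventually_elim
    case (elim s)
    then have s: "a < s" "s < b" by auto
    have "(Y has_real_derivative f s) (at s)"
      using elim(1) by (rule has_field_derivative_transform_within_open[where S = "{a<..<b}"]) (use s in \<open>auto simp: Y_def\<close>)
    then have "((\<lambda>h. (Y (s + h) - Y s) / h) \<longlongrightarrow> f s) (at 0)" by (simp add: DERIV_def)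
    moreover have "filterlim h (at 0) sequentially"
      using h0 h(1) by (auto simp: filterlim_at less_imp_neq[symmetric])
    ultimately show ?case unfolding G_def by (rule filterlim_compose)
  qed
  have bound: "AE s in ?M. norm (G n s) \<le> L" for n
  proof (rule AE_I2)
    fix s
    have "\<bar>Y (s + h n) - Y s\<bar> \<le> L * h n" using Y_lip[of "s + h n" s] h(1)[of n] by simp
    then show "norm (G n s) \<le> L" using h(1)[of n] by (simp add: G_def field_simps)
  qed
  note dct = f Gm integrable_lebesgue_on_const lim bound
  have int: "integrable ?M f" by (rule integrable_dominated_convergence[OF dct])
  have tend: "(\<lambda>n. integral\<^sup>L ?M (G n)) \<longlonglongrightarrow> integral\<^sup>L ?M f"
    by (rule integral_dominated_convergence[OF dct])
  have G_int: "integral\<^sup>L ?M (G n) = integral {0..h n} (\<lambda>s. Y (b + s)) / h n - integral {0..h n} (\<lambda>s. Y (a + s)) / h n" for n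
  proof -
    have i: "Y integrable_on S" if "S = {u..v}" for S u v using that Yc integrable_continuous_real by blast
    have "integral\<^sup>L ?M (G n) = integral {a<..<b} (G n)"
      using integrable_dominated_convergence2[OF dct] by (intro lebesgue_integral_eq_integral) auto
    also have "\<dots> = integral {a..b} (G n)" by (rule integral_open_interval_real[symmetric])
    also have "\<dots> = (integral {a..b} (\<lambda>s. Y (s + h n)) - integral {a..b} Y) / h n"
      unfolding G_def using Ycc i by (simp add: integral_diff integrable_continuous_real)
    also have "integral {a..b} (\<lambda>s. Y (s + h n)) = integral {a + h n..b + h n} Y"
      using integral_shift_Icc_real[of a b Y "h n"] by (simp add: o_def add.commute)
    also have "integral {a + h n..b + h n} Y = integral {a..b + h n} Y - integral {a..a + h n} Y"
    proof -
      have "integral {a..a + h n} Y + integral {a + h n..b + h n} Y = integral {a..b + h n} Y"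
        using h(1)[of n] ab by (intro Henstock_Kurzweil_Integration.integral_combine i[OF refl]) auto
      then show ?thesis by simp
    qed
    also have "integral {a..b + h n} Y = integral {a..b} Y + integral {b..b + h n} Y"
    proof -
      have "integral {a..b} Y + integral {b..b + h n} Y = integral {a..b + h n} Y"
        using h(1)[of n] ab by (intro Henstock_Kurzweil_Integration.integral_combine i[OF refl]) auto
      then show ?thesis by simp
    qed
    also have "integral {b..b + h n} Y = integral {0..h n} (\<lambda>s. Y (b + s))"
      using integral_shift_Icc_real[of 0 "h n" Y b] by (simp add: o_def add.commute)
    also have "integral {a..a + h n} Y = integral {0..h n} (\<lambda>s. Y (a + s))"
      using integral_shift_Icc_real[of 0 "h n" Y a] by (simp add: o_def add.commute)
    finally show ?thesis by (simp add: diff_divide_distrib)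
  qed
  have ends: "(\<lambda>n. integral {0..h n} (\<lambda>s. Y (c + s)) / h n) \<longlonglongrightarrow> Y c" for c
  proof (rule LIM_zero_cancel, rule Lim_null_comparison)
    show "\<forall>\<^sub>F n in sequentially. norm (integral {0..h n} (\<lambda>s. Y (c + s)) / h n - Y c) \<le> L * h n"
    proof (rule always_eventually, rule allI)
      fix n
      have "\<bar>integral {0..h n} (\<lambda>s. Y (c + s)) / h n - Y c\<bar> \<le> L * h n"
      proof (rule average_bounds[OF _ h(1)])
        show "continuous_on {0..h n} (\<lambda>s. Y (c + s))" using Ycc[of _ c] by (simp add: add.commute)
        fix s assume "0 \<le> s" "s \<le> h n"
        then show "\<bar>Y (c + s) - Y c\<bar> \<le> L * h n"
          using Y_lip[of "c + s" c] mult_left_mono[of s "h n" L] L by simp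
      qed
      then show "norm (integral {0..h n} (\<lambda>s. Y (c + s)) / h n - Y c) \<le> L * h n" by simp
    qed
    show "(\<lambda>n. L * h n) \<longlonglongrightarrow> 0" using tendsto_mult_right_zero[OF h0] .
  qed
  have "(\<lambda>n. integral\<^sup>L ?M (G n)) \<longlonglongrightarrow> Y b - Y a"
    unfolding G_int by (intro tendsto_diff ends)
  then have "integral\<^sup>L ?M f = Y b - Y a" using tend LIMSEQ_unique by blast
  then have eq: "integral\<^sup>L ?M f = X b - X a" using ab by (simp add: Y_def)
  have "(f has_integral integral\<^sup>L ?M f) {a<..<b}"
    by (rule has_integral_integral_lebesgue_on[OF int]) simp
  then have "(f has_integral integral\<^sup>L ?M f) (box a b)" by simp
  then show ?thesis unfolding eq using has_integral_open_interval[of f _ a b] by simp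
qed

text \<open>A zero at which the derivative does not vanish is isolated among the zeros, and there are
  only countably many isolated points.\<close>

lemma countable_transversal_zeros:
  fixes X :: "real \<Rightarrow> real"
  shows "countable {s. X s = 0 \<and> (\<exists>d. d \<noteq> 0 \<and> (X has_real_derivative d) (at s))}" (is "countable ?N")
proof -
  have "\<forall>s\<in>?N. \<exists>r::rat \<times> rat. of_rat (fst r) < s \<and> s < of_rat (snd r) \<and>
      (\<forall>u\<in>?N. of_rat (fst r) < u \<and> u < of_rat (snd r) \<longrightarrow> u = s)"
  proof
    fix s assume s: "s \<in> ?N"
    obtain d where d: "d \<noteq> 0" "(X has_real_derivative d) (at s)" and X0: "X s = 0" using s by blast
    have "((\<lambda>u. (X u - X s) / (u - s)) \<longlongrightarrow> d) (at s)"
      using d(2) by (simp add: has_field_derivative_iff)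
    then have "\<forall>\<^sub>F u in at s. (X u - X s) / (u - s) \<noteq> 0"
      using d(1) by (rule tendsto_imp_eventually_ne)
    then obtain e where e: "e > 0" "\<And>u. u \<noteq> s \<Longrightarrow> dist u s < e \<Longrightarrow> (X u - X s) / (u - s) \<noteq> 0"
      unfolding eventually_at by blast
    obtain p where p: "s - e < of_rat p" "of_rat p < s" using of_rat_dense[of "s - e" s] e(1) by auto
    obtain q where q: "s < of_rat q" "of_rat q < s + e" using of_rat_dense[of s "s + e"] e(1) by auto
    have "u = s" if u: "u \<in> ?N" "of_rat p < u" "u < of_rat q" for u
    proof (rule ccontr)
      assume "u \<noteq> s"
      moreover have "dist u s < e" using p q u by (auto simp: dist_real_def)
      ultimately have "(X u - X s) / (u - s) \<noteq> 0" by (rule e(2))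
      then show False using u(1) X0 by auto
    qed
    then show "\<exists>r::rat \<times> rat. of_rat (fst r) < s \<and> s < of_rat (snd r) \<and>
      (\<forall>u\<in>?N. of_rat (fst r) < u \<and> u < of_rat (snd r) \<longrightarrow> u = s)"
      using p(2) q(1) by (intro exI[of _ "(p, q)"]) simp
  qed
  from bchoice[OF this] obtain r :: "real \<Rightarrow> rat \<times> rat" where
    r: "\<forall>s\<in>?N. of_rat (fst (r s)) < s \<and> s < of_rat (snd (r s)) \<and>
      (\<forall>u\<in>?N. of_rat (fst (r s)) < u \<and> u < of_rat (snd (r s)) \<longrightarrow> u = s)"
    by blast
  have "inj_on r ?N"
  proof (rule inj_onI)
    fix s u assume s: "s \<in> ?N" and u: "u \<in> ?N" and eq: "r s = r u"
    have "of_rat (fst (r s)) < u" "u < of_rat (snd (r s))" unfolding eq using bspec[OF r u] by blast+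
    then show "s = u" using bspec[OF r s] u by blast
  qed
  then show ?thesis by (rule countableI')
qed

lemma AE_lebesgue_on_iff:
  assumes "S \<in> sets lebesgue"
  shows "(AE s in lebesgue_on S. P s) \<longleftrightarrow> (AE s in lebesgue. s \<in> S \<longrightarrow> P s)"
  by (rule AE_restrict_space_iff) (use assms in simp)

lemma AE_lebesgue_on_subset:
  assumes "AE s in lebesgue_on S. P s" "T \<subseteq> S" "S \<in> sets lebesgue" "T \<in> sets lebesgue"
  shows "AE s in lebesgue_on T. P s"
proof -
  have "AE s in lebesgue. s \<in> S \<longrightarrow> P s" using assms by (simp add: AE_lebesgue_on_iff)
  then have "AE s in lebesgue. s \<in> T \<longrightarrow> P s" by eventually_elim (use assms(2) in auto)
  then show ?thesis using assms by (simp add: AE_lebesgue_on_iff)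
qed

lemma AE_lebesgue_on_not_in_countable:
  fixes N :: "real set"
  assumes "countable N" "S \<in> sets lebesgue"
  shows "AE s in lebesgue_on S. s \<notin> N"
proof -
  have "N \<in> null_sets lebesgue"
    by (rule null_sets_completionI[OF countable_imp_null_set_lborel[OF assms(1)]])
  then have "AE s in lebesgue. s \<notin> N" by (rule AE_not_in)
  then show ?thesis unfolding AE_lebesgue_on_iff[OF assms(2)] by eventually_elim auto
qed

lemma AE_lebesgue_shift:
  fixes h :: real
  assumes "AE s in lebesgue. P s" shows "AE s in lebesgue. P (s + h)"
proof -
  obtain N where N: "N \<in> null_sets lebesgue" "{s \<in> space lebesgue. \<not> P s} \<subseteq> N"
    using assms unfolding eventually_ae_filter by blast
  have "negligible ((+) (- h) ` N)"
    using N(1) negligible_iff_null_sets negligible_translation by blast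
  then have "(+) (- h) ` N \<in> null_sets lebesgue" by (simp add: negligible_iff_null_sets)
  then show ?thesis
  proof (rule AE_I')
    show "{s \<in> space lebesgue. \<not> P (s + h)} \<subseteq> (+) (- h) ` N"
    proof
      fix s assume "s \<in> {s \<in> space lebesgue. \<not> P (s + h)}"
      then have "s + h \<in> N" using N(2) by auto
      then have "- h + (s + h) \<in> (+) (- h) ` N" by (rule imageI)
      then show "s \<in> (+) (- h) ` N" by simp
    qed
  qed
qed

lemma AE_lebesgue_on_shift:
  fixes h :: real
  assumes "AE s in lebesgue_on {a<..<b}. P s"
  shows "AE s in lebesgue_on {a - h<..<b - h}. P (s + h)"
proof -
  have "AE s in lebesgue. s \<in> {a<..<b} \<longrightarrow> P s" using assms by (simp add: AE_lebesgue_on_iff)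
  then have "AE s in lebesgue. s + h \<in> {a<..<b} \<longrightarrow> P (s + h)" by (rule AE_lebesgue_shift)
  then have "AE s in lebesgue. s \<in> {a - h<..<b - h} \<longrightarrow> P (s + h)" by eventually_elim auto
  then show ?thesis by (simp add: AE_lebesgue_on_iff)
qed

lemma measurable_lebesgue_on_shift:
  fixes h :: real
  shows "(\<lambda>s. s + h) \<in> lebesgue_on {a - h<..<b - h} \<rightarrow>\<^sub>M lebesgue_on {a<..<b}"
proof (rule measurable_restrict_space3)
  show "(\<lambda>s. s + h) \<in> lebesgue \<rightarrow>\<^sub>M lebesgue"
    using lebesgue_affine_measurable[of "\<lambda>_::real. 1" h] by (simp add: add.commute)
qed auto

lemma bounded_measurable_integrable:
  fixes f :: "real \<Rightarrow> real"
  assumes f: "f \<in> borel_measurable (lebesgue_on {a<..<b})" and bd: "\<And>s. a < s \<Longrightarrow> s < b \<Longrightarrow> \<bar>f s\<bar> \<le> K"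
  shows "integrable (lebesgue_on {a<..<b}) f" "f integrable_on {a..b}"
    "integral\<^sup>L (lebesgue_on {a<..<b}) f = integral {a..b} f"
proof -
  show int: "integrable (lebesgue_on {a<..<b}) f"
    by (rule Bochner_Integration.integrable_bound[OF integrable_lebesgue_on_const[of a b K] f])
      (use bd in \<open>auto intro!: AE_I2 order_trans[OF _ abs_ge_self]\<close>)
  have "(f has_integral integral\<^sup>L (lebesgue_on {a<..<b}) f) {a<..<b}"
    by (rule has_integral_integral_lebesgue_on[OF int]) simp
  then have *: "(f has_integral integral\<^sup>L (lebesgue_on {a<..<b}) f) {a..b}"
    using has_integral_open_interval[of f _ a b] by simp
  show "f integrable_on {a..b}" using * by blast
  show "integral\<^sup>L (lebesgue_on {a<..<b}) f = integral {a..b} f" using * by (simp add: integral_unique)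
qed

lemma integral_ge_AE:
  fixes f :: "real \<Rightarrow> real"
  assumes f: "f \<in> borel_measurable (lebesgue_on {a<..<b})" and bd: "\<And>s. a < s \<Longrightarrow> s < b \<Longrightarrow> \<bar>f s\<bar> \<le> K"
    and ge: "AE s in lebesgue_on {a<..<b}. c \<le> f s" and ab: "a \<le> b"
  shows "c * (b - a) \<le> integral {a..b} f"
proof -
  have "integral\<^sup>L (lebesgue_on {a<..<b}) (\<lambda>_. c) \<le> integral\<^sup>L (lebesgue_on {a<..<b}) f"
    by (rule integral_mono_AE[OF integrable_lebesgue_on_const bounded_measurable_integrable(1)[OF f bd] ge])
  moreover have "integral\<^sup>L (lebesgue_on {a<..<b}) (\<lambda>_. c) = integral {a..b} (\<lambda>_. c)"
    by (rule bounded_measurable_integrable(3)[where K = "\<bar>c\<bar>"]) auto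
  ultimately have "integral {a..b} (\<lambda>_. c) \<le> integral {a..b} f"
    using bounded_measurable_integrable(3)[OF f bd] by (simp only:)
  then show ?thesis using ab by (simp add: mult.commute)
qed

lemma integral_abs_le_bound:
  fixes f :: "real \<Rightarrow> real"
  assumes f: "f \<in> borel_measurable (lebesgue_on {a<..<b})" and bd: "\<And>s. a < s \<Longrightarrow> s < b \<Longrightarrow> \<bar>f s\<bar> \<le> K"
    and ab: "a \<le> b"
  shows "\<bar>integral {a..b} f\<bar> \<le> K * (b - a)"
proof -
  have ge: "- K * (b - a) \<le> integral {a..b} h"
    if h: "h \<in> borel_measurable (lebesgue_on {a<..<b})" "\<And>s. a < s \<Longrightarrow> s < b \<Longrightarrow> \<bar>h s\<bar> \<le> K" for h
  proof (rule integral_ge_AE[OF h _ ab])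
    show "AE s in lebesgue_on {a<..<b}. - K \<le> h s"
    proof (rule AE_I2)
      fix s assume "s \<in> space (lebesgue_on {a<..<b})"
      then have "\<bar>h s\<bar> \<le> K" using h(2) by simp
      then show "- K \<le> h s" by linarith
    qed
  qed
  have "- K * (b - a) \<le> integral {a..b} (\<lambda>s. - f s)"
    by (rule ge) (use f bd in auto)
  with ge[OF f bd] show ?thesis by (simp add: abs_le_iff)
qed

section \<open>Trajectories\<close>

context junction_control begin

definition admissible :: "real \<Rightarrow> (real \<Rightarrow> real) \<Rightarrow> (real \<Rightarrow> 'a \<times> 'b \<times> real) \<Rightarrow> bool" where
  "admissible t X a \<longleftrightarrow> (X, a) \<in> trajectories A1 A2 b1 b2 t (X 0) \<and>
     (AE s in lebesgue_on {0<..<t}. X s = 0 \<longrightarrow> a s \<in> Z)"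

abbreviation velocity :: "(real \<Rightarrow> real) \<Rightarrow> (real \<Rightarrow> 'a \<times> 'b \<times> real) \<Rightarrow> real \<Rightarrow> real" where
  "velocity X a s \<equiv> piecewise b1 b2 (X s) (a s)"

abbreviation running_cost :: "(real \<Rightarrow> real) \<Rightarrow> (real \<Rightarrow> 'a \<times> 'b \<times> real) \<Rightarrow> real \<Rightarrow> real" where
  "running_cost X a s \<equiv> piecewise l1 l2 (X s) (a s)"

definition cost :: "real \<Rightarrow> (real \<Rightarrow> real) \<Rightarrow> (real \<Rightarrow> 'a \<times> 'b \<times> real) \<Rightarrow> real" where
  "cost t X a = g (X t) + integral {0..t} (running_cost X a)"

definition V :: "real \<times> real \<Rightarrow> real" where
  "V z = (INF (X, a)\<in>{(X, a). admissible (fst z) X a \<and> X 0 = snd z}. cost (fst z) X a)"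

lemma admissible_iff:
  "admissible t X a \<longleftrightarrow> (\<exists>L. L-lipschitz_on {0..t} X) \<and>
     a \<in> lebesgue_on {0<..<t} \<rightarrow>\<^sub>M restrict_space borel (controls A1 A2) \<and>
     (AE s in lebesgue_on {0<..<t}. (X has_real_derivative velocity X a s) (at s)) \<and>
     (AE s in lebesgue_on {0<..<t}. X s = 0 \<longrightarrow> a s \<in> Z)"
  by (auto simp: admissible_def trajectories_def)

lemma admissible_controls:
  assumes "admissible t X a" "0 < s" "s < t" shows "a s \<in> controls A1 A2"
proof -
  have "a \<in> lebesgue_on {0<..<t} \<rightarrow>\<^sub>M restrict_space borel (controls A1 A2)"
    using assms(1) by (simp add: admissible_iff)
  from measurable_space[OF this, of s] show ?thesis using assms by (simp add: space_restrict_space)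
qed

lemma mix_abs_le:
  assumes a: "a \<in> controls A1 A2" and f1: "\<And>\<alpha>. \<alpha> \<in> A1 \<Longrightarrow> \<bar>f1 \<alpha>\<bar> \<le> C" and f2: "\<And>\<alpha>. \<alpha> \<in> A2 \<Longrightarrow> \<bar>f2 \<alpha>\<bar> \<le> C"
  shows "\<bar>mix f1 f2 a\<bar> \<le> C"
proof -
  obtain \<alpha>1 \<alpha>2 \<mu> where e: "a = (\<alpha>1, \<alpha>2, \<mu>)" by (cases a)
  have m: "\<alpha>1 \<in> A1" "\<alpha>2 \<in> A2" "0 \<le> \<mu>" "\<mu> \<le> 1" using a by (auto simp: e controls_def)
  have "\<bar>\<mu> * f1 \<alpha>1\<bar> \<le> \<mu> * C" "\<bar>(1 - \<mu>) * f2 \<alpha>2\<bar> \<le> (1 - \<mu>) * C"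
    using m f1 f2 by (auto simp: abs_mult intro: mult_left_mono)
  then have "\<bar>\<mu> * f1 \<alpha>1 + (1 - \<mu>) * f2 \<alpha>2\<bar> \<le> \<mu> * C + (1 - \<mu>) * C" by linarith
  then show ?thesis by (simp add: e mix_def algebra_simps)
qed

lemma piecewise_abs_le:
  assumes "a \<in> controls A1 A2" "\<And>\<alpha>. \<alpha> \<in> A1 \<Longrightarrow> \<bar>f1 \<alpha>\<bar> \<le> C" "\<And>\<alpha>. \<alpha> \<in> A2 \<Longrightarrow> \<bar>f2 \<alpha>\<bar> \<le> C"
  shows "\<bar>piecewise f1 f2 x a\<bar> \<le> C"
  using mix_abs_le[OF assms] assms by (cases a) (auto simp: piecewise_def controls_def)

lemma velocity_abs_le: "admissible t X a \<Longrightarrow> 0 < s \<Longrightarrow> s < t \<Longrightarrow> \<bar>velocity X a s\<bar> \<le> C"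
  by (intro piecewise_abs_le admissible_controls b1_le b2_le)

lemma running_cost_abs_le: "admissible t X a \<Longrightarrow> 0 < s \<Longrightarrow> s < t \<Longrightarrow> \<bar>running_cost X a s\<bar> \<le> C"
  by (intro piecewise_abs_le admissible_controls l1_le l2_le)

lemma admissible_continuous: "admissible t X a \<Longrightarrow> continuous_on {0..t} X"
  using lipschitz_on_continuous_on by (auto simp: admissible_iff)

lemma piecewise_measurable:
  assumes adm: "admissible t X a" and f: "continuous_on A1 f1" "continuous_on A2 f2"
    and s: "0 \<le> s1" "s2 \<le> t"
  shows "(\<lambda>s. piecewise f1 f2 (X s) (a s)) \<in> borel_measurable (lebesgue_on {s1<..<s2})"
proof -
  have a: "a \<in> lebesgue_on {0<..<t} \<rightarrow>\<^sub>M restrict_space borel (controls A1 A2)"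
    using adm by (simp add: admissible_iff)
  have a: "a \<in> lebesgue_on {s1<..<s2} \<rightarrow>\<^sub>M restrict_space borel (controls A1 A2)"
    by (rule measurable_restrict_mono[OF a]) (use s in auto)
  have "continuous_on {s1<..<s2} X"
    by (rule continuous_on_subset[OF admissible_continuous[OF adm]]) (use s in auto)
  then have X[measurable]: "X \<in> borel_measurable (lebesgue_on {s1<..<s2})"
    by (rule continuous_imp_measurable_on_sets_lebesgue) simp
  have c1: "continuous_on (controls A1 A2) (\<lambda>a. f1 (fst a))"
    by (rule continuous_on_compose2[OF f(1)]) (auto simp: controls_def intro: continuous_intros)
  have c2: "continuous_on (controls A1 A2) (\<lambda>a. f2 (fst (snd a)))"
    by (rule continuous_on_compose2[OF f(2)]) (auto simp: controls_def intro!: continuous_intros)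
  have c3: "continuous_on (controls A1 A2) (\<lambda>a. snd (snd a) * f1 (fst a) + (1 - snd (snd a)) * f2 (fst (snd a)))"
    by (intro continuous_intros c1 c2)
  note m = measurable_compose[OF a borel_measurable_continuous_on_restrict]
  have "(\<lambda>s. if X s < 0 then f1 (fst (a s)) else if X s > 0 then f2 (fst (snd (a s)))
      else snd (snd (a s)) * f1 (fst (a s)) + (1 - snd (snd (a s))) * f2 (fst (snd (a s))))
      \<in> borel_measurable (lebesgue_on {s1<..<s2})"
    by (intro measurable_If m[OF c1] m[OF c2] m[OF c3]) measurable
  moreover have "piecewise f1 f2 x c = (if x < 0 then f1 (fst c) else if x > 0 then f2 (fst (snd c))
      else snd (snd c) * f1 (fst c) + (1 - snd (snd c)) * f2 (fst (snd c)))" for x c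
    by (cases c) (simp add: piecewise_def mix_def)
  ultimately show ?thesis by (simp only:)
qed

lemma running_cost_integrable:
  assumes adm: "admissible t X a" and s: "0 \<le> s1" "s2 \<le> t"
  shows "running_cost X a integrable_on {s1..s2}"
proof (rule bounded_measurable_integrable(2)[OF piecewise_measurable[OF adm l1_cont l2_cont s]])
  show "\<bar>running_cost X a u\<bar> \<le> C" if "s1 < u" "u < s2" for u
    using running_cost_abs_le[OF adm, of u] that s by simp
qed

lemma total_cost_eq: "admissible t X a \<Longrightarrow> total_cost l1 l2 g t (X, a) = cost t X a"
  unfolding total_cost_def cost_def
  using bounded_measurable_integrable(3)[OF piecewise_measurable[OF _ l1_cont l2_cont order_refl order_refl]
    running_cost_abs_le] by simp

lemma admissible_subinterval_AE:
  fixes s1 s2 t :: real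
  assumes "0 \<le> s1" "s2 \<le> t" "AE s in lebesgue_on {0<..<t}. P s"
  shows "AE s in lebesgue_on {s1<..<s2}. P s"
proof (rule AE_lebesgue_on_subset[OF assms(3)])
  show "{s1<..<s2} \<subseteq> {0<..<t}" using assms(1,2) by auto
qed simp_all

lemma velocity_has_integral:
  assumes adm: "admissible t X a" and s: "0 \<le> s1" "s1 \<le> s2" "s2 \<le> t"
  shows "(velocity X a has_integral X s2 - X s1) {s1..s2}"
proof -
  obtain L where "L-lipschitz_on {0..t} X" using adm by (auto simp: admissible_iff)
  then have "L-lipschitz_on {s1..s2} X" by (rule lipschitz_on_subset) (use s in auto)
  then show ?thesis
  proof (rule lipschitz_fundamental_theorem[OF _ s(2)])
    show "AE s in lebesgue_on {s1<..<s2}. (X has_real_derivative velocity X a s) (at s)"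
      using s adm by (intro admissible_subinterval_AE[of s1 s2 t]) (auto simp: admissible_iff)
  qed (rule piecewise_measurable[OF adm b1_cont b2_cont s(1,3)])
qed

lemma trajectory_speed:
  assumes adm: "admissible t X a" and s: "0 \<le> s1" "s1 \<le> s2" "s2 \<le> t"
  shows "\<bar>X s2 - X s1\<bar> \<le> C * (s2 - s1)"
proof -
  have "\<bar>integral {s1..s2} (velocity X a)\<bar> \<le> C * (s2 - s1)"
  proof (rule integral_abs_le_bound[OF piecewise_measurable[OF adm b1_cont b2_cont s(1,3)] _ s(2)])
    show "\<bar>velocity X a u\<bar> \<le> C" if "s1 < u" "u < s2" for u
      using velocity_abs_le[OF adm, of u] that s by simp
  qed
  then show ?thesis using velocity_has_integral[OF assms] by (simp add: integral_unique)
qed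

lemma running_cost_integral_abs_le:
  assumes adm: "admissible t X a" and s: "0 \<le> s1" "s1 \<le> s2" "s2 \<le> t"
  shows "\<bar>integral {s1..s2} (running_cost X a)\<bar> \<le> C * (s2 - s1)"
proof (rule integral_abs_le_bound[OF piecewise_measurable[OF adm l1_cont l2_cont s(1,3)] _ s(2)])
  show "\<bar>running_cost X a u\<bar> \<le> C" if "s1 < u" "u < s2" for u
    using running_cost_abs_le[OF adm, of u] that s by simp
qed

text \<open>At almost every zero of \<open>X\<close> the derivative exists, and outside a countable set of zeros it
  vanishes. Hence almost every control used at the junction is tangential.\<close>

lemma zero_velocity_at_junction:
  assumes d: "AE s in lebesgue_on {0<..<t}. (X has_real_derivative velocity X a s) (at s)"
  shows "AE s in lebesgue_on {0<..<t}. X s = 0 \<longrightarrow> velocity X a s = 0"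
proof -
  have "AE s in lebesgue_on {0<..<t}. s \<notin> {s. X s = 0 \<and> (\<exists>d. d \<noteq> 0 \<and> (X has_real_derivative d) (at s))}"
    by (rule AE_lebesgue_on_not_in_countable[OF countable_transversal_zeros]) simp
  with d show ?thesis by eventually_elim blast
qed

lemma mix_le_A: "a \<in> Z \<Longrightarrow> - mix l1 l2 a \<le> A"
  unfolding A_def
proof (rule cSUP_upper)
  have "- mix l1 l2 a \<le> C" if "a \<in> Z" for a
  proof -
    have "a \<in> controls A1 A2" using Z_upper that by (auto simp: controls0_def)
    from mix_abs_le[OF this, of l1 l2] l1_le l2_le show ?thesis by (auto simp: abs_le_iff)
  qed
  then show "bdd_above ((\<lambda>a. - mix l1 l2 a) ` Z)" by (auto intro!: bdd_aboveI)
qed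

text \<open>The primitive that vanishes at \<open>0\<close> of the slope \<open>qL\<close> on the left and \<open>qR\<close> on the right.\<close>

definition kink :: "real \<Rightarrow> real \<Rightarrow> real \<Rightarrow> real" where
  "kink qL qR x = qL * min x 0 + qR * max x 0"

lemma kink_lipschitz: "\<bar>kink qL qR x - kink qL qR y\<bar> \<le> (\<bar>qL\<bar> + \<bar>qR\<bar>) * \<bar>x - y\<bar>"
proof -
  have "\<bar>qL * (min x 0 - min y 0)\<bar> \<le> \<bar>qL\<bar> * \<bar>x - y\<bar>" "\<bar>qR * (max x 0 - max y 0)\<bar> \<le> \<bar>qR\<bar> * \<bar>x - y\<bar>"
    unfolding abs_mult by (intro mult_left_mono; simp add: min_def max_def abs_if)+
  moreover have "kink qL qR x - kink qL qR y = qL * (min x 0 - min y 0) + qR * (max x 0 - max y 0)"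
    by (simp add: kink_def algebra_simps)
  ultimately show ?thesis by (simp add: distrib_right abs_le_iff)
qed

lemma kink_chain_rule:
  assumes d: "(X has_real_derivative v) (at s)" and z: "X s = 0 \<Longrightarrow> v = 0"
  shows "((\<lambda>s. kink qL qR (X s)) has_real_derivative
    (if X s < 0 then qL * v else if X s > 0 then qR * v else 0)) (at s)"
proof -
  have X: "(X \<longlongrightarrow> X s) (at s)" using DERIV_isCont[OF d] by (simp add: isCont_def)
  consider "X s < 0" | "X s > 0" | "X s = 0" by linarith
  then show ?thesis
  proof cases
    case 1
    then have "\<forall>\<^sub>F u in at s. X u < 0" using X by (rule order_tendstoD(2)[rotated])
    then have "\<forall>\<^sub>F u in nhds s. X u < 0" using 1 by (simp add: eventually_nhds_conv_at)
    then have ev: "\<forall>\<^sub>F u in nhds s. kink qL qR (X u) = qL * X u"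
      by (rule eventually_mono) (simp add: kink_def)
    have "((\<lambda>u. qL * X u) has_real_derivative qL * v) (at s)" by (rule DERIV_cmult[OF d])
    then show ?thesis using 1 ev by (simp add: DERIV_cong_ev[OF refl ev refl])
  next
    case 2
    then have "\<forall>\<^sub>F u in at s. X u > 0" using X by (rule order_tendstoD(1)[rotated])
    then have "\<forall>\<^sub>F u in nhds s. X u > 0" using 2 by (simp add: eventually_nhds_conv_at)
    then have ev: "\<forall>\<^sub>F u in nhds s. kink qL qR (X u) = qR * X u"
      by (rule eventually_mono) (simp add: kink_def)
    have "((\<lambda>u. qR * X u) has_real_derivative qR * v) (at s)" by (rule DERIV_cmult[OF d])
    then show ?thesis using 2 ev by (simp add: DERIV_cong_ev[OF refl ev refl])
  next
    case 3
    have "((\<lambda>u. (X u - X s) / (u - s)) \<longlongrightarrow> 0) (at s)"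
      using d z[OF 3] by (simp add: has_field_derivative_iff)
    then have "((\<lambda>u. (\<bar>qL\<bar> + \<bar>qR\<bar>) * \<bar>(X u - X s) / (u - s)\<bar>) \<longlongrightarrow> 0) (at s)"
      by (intro tendsto_mult_right_zero tendsto_rabs_zero)
    then have "((\<lambda>u. (kink qL qR (X u) - kink qL qR (X s)) / (u - s)) \<longlongrightarrow> 0) (at s)"
    proof (rule Lim_null_comparison[rotated])
      show "\<forall>\<^sub>F u in at s. norm ((kink qL qR (X u) - kink qL qR (X s)) / (u - s))
          \<le> (\<bar>qL\<bar> + \<bar>qR\<bar>) * \<bar>(X u - X s) / (u - s)\<bar>"
        using kink_lipschitz by (intro always_eventually allI) (simp add: divide_right_mono)
    qed
    then show ?thesis using 3 by (simp add: has_field_derivative_iff)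
  qed
qed

text \<open>The running cost is bounded from below by the Fenchel inequality \<open>l \<ge> - H q - b q\<close>, with a
  slope for each half-line; at the junction the velocity vanishes almost everywhere, so that the
  slopes disappear and the tangential bound \<open>- A\<close> takes over.\<close>

lemma cost_lower_bound:
  assumes adm: "admissible t X a" and s: "0 \<le> s1" "s1 \<le> s2" "s2 \<le> t"
    and M: "\<And>s. s1 < s \<Longrightarrow> s < s2 \<Longrightarrow>
      (X s < 0 \<longrightarrow> H1 qL \<le> M) \<and> (X s > 0 \<longrightarrow> H2 qR \<le> M) \<and> (X s = 0 \<longrightarrow> A \<le> M)"
  shows "- M * (s2 - s1) - (kink qL qR (X s2) - kink qL qR (X s1)) \<le> integral {s1..s2} (running_cost X a)"
proof -
  define f where "f = (\<lambda>s. if X s < 0 then qL * velocity X a s else if X s > 0 then qR * velocity X a s else 0)"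
  note mv = piecewise_measurable[OF adm b1_cont b2_cont s(1,3)]
  note ml = piecewise_measurable[OF adm l1_cont l2_cont s(1,3)]
  have "continuous_on {s1<..<s2} X"
    by (rule continuous_on_subset[OF admissible_continuous[OF adm]]) (use s in auto)
  then have X[measurable]: "X \<in> borel_measurable (lebesgue_on {s1<..<s2})"
    by (rule continuous_imp_measurable_on_sets_lebesgue) simp
  have fm: "f \<in> borel_measurable (lebesgue_on {s1<..<s2})"
    unfolding f_def by (intro measurable_If borel_measurable_times mv; measurable)
  obtain L where L: "L-lipschitz_on {0..t} X" using adm by (auto simp: admissible_iff)
  have "((\<bar>qL\<bar> + \<bar>qR\<bar>) * L)-lipschitz_on {s1..s2} (\<lambda>s. kink qL qR (X s))"
  proof (rule lipschitz_onI)
    fix u v assume "u \<in> {s1..s2}" "v \<in> {s1..s2}"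
    then have "\<bar>X u - X v\<bar> \<le> L * \<bar>u - v\<bar>" using lipschitz_onD[OF L, of u v] s by (simp add: dist_real_def)
    then have "(\<bar>qL\<bar> + \<bar>qR\<bar>) * \<bar>X u - X v\<bar> \<le> (\<bar>qL\<bar> + \<bar>qR\<bar>) * (L * \<bar>u - v\<bar>)" by (intro mult_left_mono) auto
    then show "dist (kink qL qR (X u)) (kink qL qR (X v)) \<le> (\<bar>qL\<bar> + \<bar>qR\<bar>) * L * dist u v"
      using kink_lipschitz[of qL qR "X u" "X v"] by (simp add: dist_real_def mult.assoc)
  qed (use lipschitz_on_nonneg[OF L] in simp)
  moreover have d: "AE s in lebesgue_on {s1<..<s2}. (X has_real_derivative velocity X a s) (at s)"
    and Z: "AE s in lebesgue_on {s1<..<s2}. X s = 0 \<longrightarrow> a s \<in> Z"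
    and v0: "AE s in lebesgue_on {s1<..<s2}. X s = 0 \<longrightarrow> velocity X a s = 0"
    using s adm zero_velocity_at_junction[where t = t and X = X and a = a]
    by (auto intro!: admissible_subinterval_AE[of s1 s2 t] simp: admissible_iff)
  have "AE s in lebesgue_on {s1<..<s2}. ((\<lambda>s. kink qL qR (X s)) has_real_derivative f s) (at s)"
    using d v0 unfolding f_def by eventually_elim (rule kink_chain_rule, auto)
  ultimately have f_int: "(f has_integral kink qL qR (X s2) - kink qL qR (X s1)) {s1..s2}"
    using lipschitz_fundamental_theorem[OF _ s(2) fm] by blast
  have "- M * (s2 - s1) \<le> integral {s1..s2} (\<lambda>s. running_cost X a s + f s)"
  proof (rule integral_ge_AE[OF _ _ _ s(2)])
    show "(\<lambda>s. running_cost X a s + f s) \<in> borel_measurable (lebesgue_on {s1<..<s2})"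
      using ml fm by (rule borel_measurable_add)
    fix u assume u: "s1 < u" "u < s2"
    have v: "\<bar>velocity X a u\<bar> \<le> C" "\<bar>running_cost X a u\<bar> \<le> C"
      using velocity_abs_le[OF adm, of u] running_cost_abs_le[OF adm, of u] u s by auto
    have "\<bar>qL * velocity X a u\<bar> \<le> \<bar>qL\<bar> * C" "\<bar>qR * velocity X a u\<bar> \<le> \<bar>qR\<bar> * C"
      unfolding abs_mult using v by (intro mult_left_mono; simp)+
    moreover have "0 \<le> \<bar>qL\<bar> * C" "0 \<le> \<bar>qR\<bar> * C" using C_pos by auto
    ultimately show "\<bar>running_cost X a u + f u\<bar> \<le> C + \<bar>qL\<bar> * C + \<bar>qR\<bar> * C"
      using v(2) unfolding f_def by (smt (verit))
  next
    show "AE s in lebesgue_on {s1<..<s2}. - M \<le> running_cost X a s + f s"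
      using Z AE_space
    proof eventually_elim
      case (elim u)
      then have u: "s1 < u" "u < s2" by auto
      obtain \<alpha>1 \<alpha>2 \<mu> where au: "a u = (\<alpha>1, \<alpha>2, \<mu>)" by (cases "a u")
      have m: "\<alpha>1 \<in> A1" "\<alpha>2 \<in> A2" using admissible_controls[OF adm, of u] u s by (auto simp: au controls_def)
      consider "X u < 0" | "X u > 0" | "X u = 0" by linarith
      then show ?case
      proof cases
        case 1 then show ?thesis using S1.ham_ge[OF m(1), of qL] M[OF u] by (simp add: f_def au piecewise_def mult.commute)
      next
        case 2 then show ?thesis using S2.ham_ge[OF m(2), of qR] M[OF u] by (simp add: f_def au piecewise_def mult.commute)
      next
        case 3 then show ?thesis using mix_le_A[of "a u"] elim(1) M[OF u] by (simp add: f_def au piecewise_def)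
      qed
    qed
  qed
  also have "\<dots> = integral {s1..s2} (running_cost X a) + integral {s1..s2} f"
    using running_cost_integrable[OF adm s(1,3)] f_int by (intro integral_add) blast+
  finally show ?thesis using f_int by (simp add: integral_unique)
qed

end

section \<open>Dynamic programming\<close>

context junction_control begin

lemma admissible_restrict:
  assumes adm: "admissible t X a" and t': "t' \<le> t" shows "admissible t' X a"
  unfolding admissible_iff
proof (intro conjI)
  obtain L where L: "L-lipschitz_on {0..t} X" using adm by (auto simp: admissible_iff)
  have "{0..t'} \<subseteq> {0..t}" using t' by auto
  then show "\<exists>L. L-lipschitz_on {0..t'} X" using lipschitz_on_subset[OF L] by blast
  have a: "a \<in> lebesgue_on {0<..<t} \<rightarrow>\<^sub>M restrict_space borel (controls A1 A2)"
    using adm by (simp add: admissible_iff)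
  show "a \<in> lebesgue_on {0<..<t'} \<rightarrow>\<^sub>M restrict_space borel (controls A1 A2)"
    by (rule measurable_restrict_mono[OF a]) (use t' in auto)
  show "AE s in lebesgue_on {0<..<t'}. (X has_real_derivative velocity X a s) (at s)"
    "AE s in lebesgue_on {0<..<t'}. X s = 0 \<longrightarrow> a s \<in> Z"
    using adm admissible_subinterval_AE[OF order_refl t'] by (auto simp: admissible_iff)
qed

lemma admissible_tail:
  assumes adm: "admissible t X a" and h: "0 \<le> h" "h \<le> t"
  shows "admissible (t - h) (\<lambda>s. X (s + h)) (\<lambda>s. a (s + h))"
  unfolding admissible_iff
proof (intro conjI)
  obtain L where L: "L-lipschitz_on {0..t} X" using adm by (auto simp: admissible_iff)
  have "L-lipschitz_on {0..t - h} (\<lambda>s. X (s + h))"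
  proof (rule lipschitz_onI)
    fix u v assume "u \<in> {0..t - h}" "v \<in> {0..t - h}"
    then show "dist (X (u + h)) (X (v + h)) \<le> L * dist u v"
      using lipschitz_onD[OF L, of "u + h" "v + h"] h by (simp add: dist_real_def)
  qed (rule lipschitz_on_nonneg[OF L])
  then show "\<exists>L. L-lipschitz_on {0..t - h} (\<lambda>s. X (s + h))" by blast
  have a: "a \<in> lebesgue_on {0<..<t} \<rightarrow>\<^sub>M restrict_space borel (controls A1 A2)"
    using adm by (simp add: admissible_iff)
  have "(\<lambda>s. a (s + h)) \<in> lebesgue_on {0 - h<..<t - h} \<rightarrow>\<^sub>M restrict_space borel (controls A1 A2)"
    by (rule measurable_compose[OF measurable_lebesgue_on_shift a])
  then show "(\<lambda>s. a (s + h)) \<in> lebesgue_on {0<..<t - h} \<rightarrow>\<^sub>M restrict_space borel (controls A1 A2)"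
    by (rule measurable_restrict_mono) (use h in auto)
  have sub: "AE s in lebesgue_on {0<..<t - h}. P (s + h)" if "AE s in lebesgue_on {0<..<t}. P s" for P
    using AE_lebesgue_on_shift[OF that, of h] by (rule AE_lebesgue_on_subset) (use h in auto)
  have "AE s in lebesgue_on {0<..<t - h}. (X has_real_derivative velocity X a (s + h)) (at (s + h))"
    using adm by (intro sub) (simp add: admissible_iff)
  then show "AE s in lebesgue_on {0<..<t - h}.
      ((\<lambda>s. X (s + h)) has_real_derivative velocity (\<lambda>s. X (s + h)) (\<lambda>s. a (s + h)) s) (at s)"
    by (simp add: DERIV_shift)
  show "AE s in lebesgue_on {0<..<t - h}. X (s + h) = 0 \<longrightarrow> a (s + h) \<in> Z"
    using adm by (intro sub) (simp add: admissible_iff)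
qed

lemma cost_tail:
  assumes adm: "admissible t X a" and h: "0 \<le> h" "h \<le> t"
  shows "cost t X a = integral {0..h} (running_cost X a) + cost (t - h) (\<lambda>s. X (s + h)) (\<lambda>s. a (s + h))"
proof -
  have "integral {0..h} (running_cost X a) + integral {h..t} (running_cost X a) = integral {0..t} (running_cost X a)"
    using running_cost_integrable[OF adm order_refl order_refl] h
    by (intro Henstock_Kurzweil_Integration.integral_combine) auto
  moreover have "integral {0..t - h} (\<lambda>s. running_cost X a (s + h)) = integral {h..t} (running_cost X a)"
    using integral_shift_real_ivl[of h h t "running_cost X a"] by simp
  ultimately show ?thesis by (simp add: cost_def)
qed

text \<open>Together with the cost of a tail this gives the half of the dynamic programming principle that
  bounds the value function from above.\<close>

lemma admissible_prepend:
  assumes adm: "admissible t X a" and t: "0 \<le> t" and h: "0 < h" and X0: "X 0 = x + v * h"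
    and a0: "a0 \<in> controls A1 A2"
    and v: "\<And>s. 0 < s \<Longrightarrow> s < h \<Longrightarrow> piecewise b1 b2 (x + v * s) a0 = v"
    and Z: "\<And>s. 0 < s \<Longrightarrow> s < h \<Longrightarrow> x + v * s = 0 \<Longrightarrow> a0 \<in> Z"
  shows "admissible (t + h) (\<lambda>s. if s \<le> h then x + v * s else X (s - h)) (\<lambda>s. if s \<le> h then a0 else a (s - h))"
    (is "admissible _ ?X ?a")
  unfolding admissible_iff
proof (intro conjI)
  obtain L where L: "L-lipschitz_on {0..t} X" using adm by (auto simp: admissible_iff)
  have 1: "\<bar>v\<bar>-lipschitz_on {0..h} (\<lambda>s. x + v * s)"
  proof (rule lipschitz_onI)
    show "dist (x + v * s) (x + v * u) \<le> \<bar>v\<bar> * dist s u" for s u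
      by (simp add: dist_real_def flip: abs_mult right_diff_distrib)
  qed simp
  have 2: "L-lipschitz_on {h..t + h} (\<lambda>s. X (s - h))"
  proof (rule lipschitz_onI)
    fix s u assume "s \<in> {h..t + h}" "u \<in> {h..t + h}"
    then show "dist (X (s - h)) (X (u - h)) \<le> L * dist s u"
      using lipschitz_onD[OF L, of "s - h" "u - h"] by (simp add: dist_real_def)
  qed (rule lipschitz_on_nonneg[OF L])
  show "\<exists>L. L-lipschitz_on {0..t + h} ?X"
    using lipschitz_on_concat_max[OF 1 2] X0 by auto
  have a: "a \<in> lebesgue_on {0<..<t} \<rightarrow>\<^sub>M restrict_space borel (controls A1 A2)"
    using adm by (simp add: admissible_iff)
  have "(\<lambda>s. a (s + - h)) \<in> lebesgue_on {0 - - h<..<t - - h} \<rightarrow>\<^sub>M restrict_space borel (controls A1 A2)"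
    by (rule measurable_compose[OF measurable_lebesgue_on_shift a])
  then have m2: "(\<lambda>s. a (s - h)) \<in> lebesgue_on {h<..<t + h} \<rightarrow>\<^sub>M restrict_space borel (controls A1 A2)"
    by simp
  have "restrict_space (lebesgue_on {0<..<t + h}) {s. \<not> s \<le> h} = lebesgue_on {h<..<t + h}"
  proof -
    have "{s::real. \<not> s \<le> h} = {h<..}" by auto
    moreover have "{0<..<t + h} \<inter> {h<..} = {h<..<t + h}" using h by auto
    ultimately show ?thesis by (simp add: restrict_restrict_space)
  qed
  moreover have "{s \<in> space (lebesgue_on {0<..<t + h}). s \<le> h} \<in> sets (lebesgue_on {0<..<t + h})"
  proof -
    have "{s \<in> space (lebesgue_on {0<..<t + h}). s \<le> h} = {0<..<t + h} \<inter> {..h}" by auto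
    then show ?thesis by (simp add: sets_restrict_space_iff)
  qed
  ultimately show "?a \<in> lebesgue_on {0<..<t + h} \<rightarrow>\<^sub>M restrict_space borel (controls A1 A2)"
    using m2 a0 by (subst measurable_If_restrict_space_iff) (auto simp: space_restrict_space)
  have split: "AE s in lebesgue_on {0<..<t + h}. P s"
    if first: "\<And>s. 0 < s \<Longrightarrow> s < h \<Longrightarrow> P s"
      and second: "AE s in lebesgue_on {0<..<t}. Q s" and Q: "\<And>s. h < s \<Longrightarrow> Q (s - h) \<Longrightarrow> P s" for P Q
  proof -
    have "AE s in lebesgue. s \<in> {0 - - h<..<t - - h} \<longrightarrow> Q (s + - h)"
      using AE_lebesgue_on_shift[OF second, of "- h"] by (simp add: AE_lebesgue_on_iff)
    moreover have "AE s in lebesgue. s \<notin> {h}"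
      using AE_lebesgue_on_not_in_countable[of "{h}" UNIV] unfolding lebesgue_on_UNIV_eq by simp
    ultimately have "AE s in lebesgue. s \<in> {0<..<t + h} \<longrightarrow> P s"
    proof eventually_elim
      case (elim s)
      show ?case
      proof
        assume s: "s \<in> {0<..<t + h}"
        show "P s"
        proof (cases "s < h")
          case True then show ?thesis using first s by simp
        next
          case False then show ?thesis using elim s by (intro Q) auto
        qed
      qed
    qed
    then show ?thesis by (simp add: AE_lebesgue_on_iff)
  qed
  show "AE s in lebesgue_on {0<..<t + h}. (?X has_real_derivative velocity ?X ?a s) (at s)"
  proof (rule split)
    show "AE s in lebesgue_on {0<..<t}. (X has_real_derivative velocity X a s) (at s)"
      using adm by (simp add: admissible_iff)
  next
    fix s assume s: "0 < s" "s < h"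
    have "((\<lambda>s. x + v * s) has_real_derivative v) (at s)" by (auto intro!: derivative_eq_intros)
    then have "(?X has_real_derivative v) (at s)"
      by (rule has_field_derivative_transform_within_open[where S = "{..<h}"]) (use s in auto)
    then show "(?X has_real_derivative velocity ?X ?a s) (at s)" using s v by simp
  next
    fix s assume s: "h < s" and d: "(X has_real_derivative velocity X a (s - h)) (at (s - h))"
    have "((\<lambda>s. X (s + - h)) has_real_derivative velocity X a (s - h)) (at s)"
      using d unfolding DERIV_shift[symmetric] by simp
    then have "(?X has_real_derivative velocity X a (s - h)) (at s)"
      by (rule has_field_derivative_transform_within_open[where S = "{h<..}"]) (use s in auto)
    then show "(?X has_real_derivative velocity ?X ?a s) (at s)" using s by simp
  qed
  show "AE s in lebesgue_on {0<..<t + h}. ?X s = 0 \<longrightarrow> ?a s \<in> Z"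
  proof (rule split)
    show "AE s in lebesgue_on {0<..<t}. X s = 0 \<longrightarrow> a s \<in> Z"
      using adm by (simp add: admissible_iff)
  qed (use Z in auto)
qed

lemma resting_controls:
  obtains \<alpha>1 \<alpha>2 where "\<alpha>1 \<in> A1" "b1 \<alpha>1 = 0" "\<alpha>2 \<in> A2" "b2 \<alpha>2 = 0"
  using S1.velocity_exists[of 0] S2.velocity_exists[of 0] S1.delta_pos by auto

lemma regular_control_in_Z:
  assumes "\<alpha>1 \<in> A1" "\<alpha>2 \<in> A2" "0 \<le> \<mu>" "\<mu> \<le> 1" "b1 \<alpha>1 \<le> 0" "0 \<le> b2 \<alpha>2" "\<mu> * b1 \<alpha>1 + (1 - \<mu>) * b2 \<alpha>2 = 0"
  shows "(\<alpha>1, \<alpha>2, \<mu>) \<in> Z"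
proof -
  have "(\<alpha>1, \<alpha>2, \<mu>) \<in> controls0_reg A1 A2 b1 b2"
    using assms by (simp add: controls0_reg_def controls_def mix_def)
  then show ?thesis using Z_lower by blast
qed

lemma admissible_rest: "\<exists>a. admissible t (\<lambda>_. x) a"
proof -
  obtain \<alpha>1 \<alpha>2 where *: "\<alpha>1 \<in> A1" "b1 \<alpha>1 = 0" "\<alpha>2 \<in> A2" "b2 \<alpha>2 = 0" by (rule resting_controls)
  let ?a = "(\<alpha>1, \<alpha>2, 1::real)"
  have "?a \<in> Z" by (rule regular_control_in_Z) (use * in auto)
  moreover have "?a \<in> controls A1 A2" using * by (simp add: controls_def)
  moreover have "piecewise b1 b2 x ?a = 0" using * by (simp add: piecewise_def mix_def)
  ultimately have "admissible t (\<lambda>_. x) (\<lambda>_. ?a)"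
    unfolding admissible_iff by (auto intro!: exI[of _ 0] lipschitz_intros simp: space_restrict_space)
  then show ?thesis by blast
qed

lemma cost_ge:
  assumes adm: "admissible t X a" and t: "0 \<le> t"
  shows "g (X 0) - (Lg * C + C) * t \<le> cost t X a"
proof -
  have "\<bar>g (X t) - g (X 0)\<bar> \<le> Lg * \<bar>X t - X 0\<bar>" by (rule g_lipschitz)
  also have "\<dots> \<le> Lg * (C * t)"
    using trajectory_speed[OF adm order_refl t order_refl] Lg by (intro mult_left_mono) auto
  finally have "g (X 0) - Lg * C * t \<le> g (X t)" by (simp add: abs_le_iff)
  moreover have "- (C * t) \<le> integral {0..t} (running_cost X a)"
    using running_cost_integral_abs_le[OF adm order_refl t order_refl] by (simp add: abs_le_iff)
  ultimately show ?thesis by (simp add: cost_def algebra_simps)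
qed

lemma V_le:
  assumes "admissible t X a" "0 \<le> t" shows "V (t, X 0) \<le> cost t X a"
proof -
  have "(INF (Y, c)\<in>{(Y, c). admissible t Y c \<and> Y 0 = X 0}. cost t Y c) \<le> (\<lambda>(Y, c). cost t Y c) (X, a)"
  proof (rule cINF_lower)
    show "bdd_below ((\<lambda>(Y, c). cost t Y c) ` {(Y, c). admissible t Y c \<and> Y 0 = X 0})"
      using cost_ge[OF _ assms(2)] by (intro bdd_belowI[of _ "g (X 0) - (Lg * C + C) * t"]) (auto, metis)
  qed (use assms in auto)
  then show ?thesis by (simp add: V_def)
qed

lemma V_ge:
  assumes "\<And>X a. admissible t X a \<Longrightarrow> X 0 = x \<Longrightarrow> c \<le> cost t X a" shows "c \<le> V (t, x)"
proof -
  obtain a where "admissible t (\<lambda>_. x) a" using admissible_rest by blast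
  then have "{(X, a). admissible t X a \<and> X 0 = x} \<noteq> {}" by blast
  then show ?thesis unfolding V_def using assms by (intro cINF_greatest) auto
qed

lemma V_near_optimal:
  assumes "e > 0" shows "\<exists>X a. admissible t X a \<and> X 0 = x \<and> cost t X a < V (t, x) + e"
proof (rule ccontr)
  assume "\<not> ?thesis"
  then have "V (t, x) + e \<le> V (t, x)" by (intro V_ge) (metis linorder_not_less)
  then show False using assms by simp
qed

lemma V_initial: "V (0, x) = g x"
proof (rule antisym)
  obtain a where "admissible 0 (\<lambda>_. x) a" using admissible_rest by blast
  from V_le[OF this] show "V (0, x) \<le> g x" by (simp add: cost_def)
  show "g x \<le> V (0, x)" by (rule V_ge) (auto simp: cost_def)
qed

lemma V_move:
  assumes h: "0 \<le> h" "h \<le> t" and a0: "a0 \<in> controls A1 A2"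
    and v: "\<And>s. 0 < s \<Longrightarrow> s < h \<Longrightarrow> piecewise b1 b2 (x + v * s) a0 = v"
    and l: "\<And>s. 0 < s \<Longrightarrow> s < h \<Longrightarrow> piecewise l1 l2 (x + v * s) a0 = c"
    and Z: "\<And>s. 0 < s \<Longrightarrow> s < h \<Longrightarrow> x + v * s = 0 \<Longrightarrow> a0 \<in> Z"
  shows "V (t, x) \<le> V (t - h, x + v * h) + h * c"
proof (cases "h = 0")
  case False
  then have hpos: "h > 0" using h by simp
  have "V (t, x) - h * c \<le> V (t - h, x + v * h)"
  proof (rule V_ge)
    fix X a assume adm: "admissible (t - h) X a" and X0: "X 0 = x + v * h"
    let ?X = "\<lambda>s. if s \<le> h then x + v * s else X (s - h)"
    let ?a = "\<lambda>s. if s \<le> h then a0 else a (s - h)"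
    have adm': "admissible t ?X ?a"
      using admissible_prepend[OF adm _ hpos X0 a0 v Z] h by simp
    have "V (t, ?X 0) \<le> cost t ?X ?a" using h by (intro V_le[OF adm']) simp
    also have "\<dots> = integral {0..h} (running_cost ?X ?a) + cost (t - h) (\<lambda>s. ?X (s + h)) (\<lambda>s. ?a (s + h))"
      by (rule cost_tail[OF adm' h])
    also have "integral {0..h} (running_cost ?X ?a) = integral {0..h} (\<lambda>_. c)"
      unfolding integral_open_interval_real by (rule integral_cong) (use l in auto)
    also have "cost (t - h) (\<lambda>s. ?X (s + h)) (\<lambda>s. ?a (s + h)) = cost (t - h) X a"
    proof -
      have "integral {0..t - h} (running_cost (\<lambda>s. ?X (s + h)) (\<lambda>s. ?a (s + h))) = integral {0..t - h} (running_cost X a)"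
        unfolding integral_open_interval_real by (rule integral_cong) auto
      moreover have "?X (t - h + h) = X (t - h)" using X0 h by simp
      ultimately show ?thesis by (simp add: cost_def)
    qed
    finally show "V (t, x) - h * c \<le> cost (t - h) X a" using hpos by simp
  qed
  then show ?thesis by simp
qed simp

text \<open>The left control is completed by a resting control on the right, with weight \<open>\<mu> = 1\<close>. If the
  motion is at the junction for more than an instant, it rests there, and then this control is regular.\<close>

lemma V_left_move:
  assumes a: "\<alpha> \<in> A1" and h: "0 \<le> h" "h \<le> t" and x: "x \<le> 0" "x + b1 \<alpha> * h \<le> 0"
  shows "V (t, x) \<le> V (t - h, x + b1 \<alpha> * h) + h * l1 \<alpha>"
proof -
  obtain \<alpha>1 \<alpha>2 where *: "\<alpha>1 \<in> A1" "b1 \<alpha>1 = 0" "\<alpha>2 \<in> A2" "b2 \<alpha>2 = 0" by (rule resting_controls)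
  let ?a = "(\<alpha>, \<alpha>2, 1::real)"
  have nonpos: "x + b1 \<alpha> * s \<le> 0" "x + b1 \<alpha> * s = 0 \<Longrightarrow> b1 \<alpha> = 0" if s: "0 < s" "s < h" for s
  proof -
    have e: "h * (x + b1 \<alpha> * s) = (h - s) * x + s * (x + b1 \<alpha> * h)" by (simp add: algebra_simps)
    have m: "(h - s) * x \<le> 0" "s * (x + b1 \<alpha> * h) \<le> 0" using s x by (auto intro: mult_nonneg_nonpos)
    then have "h * (x + b1 \<alpha> * s) \<le> 0" using e by linarith
    then show "x + b1 \<alpha> * s \<le> 0" using s by (simp add: mult_le_0_iff)
    assume "x + b1 \<alpha> * s = 0"
    then have "h * (x + b1 \<alpha> * s) = 0" by simp
    then have "(h - s) * x = 0" using e m by linarith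
    then have "x = 0" using s by simp
    then show "b1 \<alpha> = 0" using \<open>x + b1 \<alpha> * s = 0\<close> s by simp
  qed
  show ?thesis
  proof (rule V_move[OF h, where ?a0.0 = ?a])
    show "?a \<in> controls A1 A2" using a * by (simp add: controls_def)
    fix s assume s: "0 < s" "s < h"
    show "piecewise b1 b2 (x + b1 \<alpha> * s) ?a = b1 \<alpha>" "piecewise l1 l2 (x + b1 \<alpha> * s) ?a = l1 \<alpha>"
      using nonpos(1)[OF s] by (auto simp: piecewise_def mix_def)
    assume "x + b1 \<alpha> * s = 0"
    then have "b1 \<alpha> = 0" by (rule nonpos(2)[OF s])
    then show "?a \<in> Z" using a * by (intro regular_control_in_Z) auto
  qed
qed

lemma V_right_move:
  assumes a: "\<alpha> \<in> A2" and h: "0 \<le> h" "h \<le> t" and x: "0 \<le> x" "0 \<le> x + b2 \<alpha> * h"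
  shows "V (t, x) \<le> V (t - h, x + b2 \<alpha> * h) + h * l2 \<alpha>"
proof -
  obtain \<alpha>1 \<alpha>2 where *: "\<alpha>1 \<in> A1" "b1 \<alpha>1 = 0" "\<alpha>2 \<in> A2" "b2 \<alpha>2 = 0" by (rule resting_controls)
  let ?a = "(\<alpha>1, \<alpha>, 0::real)"
  have nonneg: "0 \<le> x + b2 \<alpha> * s" "x + b2 \<alpha> * s = 0 \<Longrightarrow> b2 \<alpha> = 0" if s: "0 < s" "s < h" for s
  proof -
    have e: "h * (x + b2 \<alpha> * s) = (h - s) * x + s * (x + b2 \<alpha> * h)" by (simp add: algebra_simps)
    have m: "0 \<le> (h - s) * x" "0 \<le> s * (x + b2 \<alpha> * h)" using s x by auto
    then have "0 \<le> h * (x + b2 \<alpha> * s)" using e by linarith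
    then show "0 \<le> x + b2 \<alpha> * s" using s by (simp add: zero_le_mult_iff)
    assume "x + b2 \<alpha> * s = 0"
    then have "h * (x + b2 \<alpha> * s) = 0" by simp
    then have "(h - s) * x = 0" using e m by linarith
    then have "x = 0" using s by simp
    then show "b2 \<alpha> = 0" using \<open>x + b2 \<alpha> * s = 0\<close> s by simp
  qed
  show ?thesis
  proof (rule V_move[OF h, where ?a0.0 = ?a])
    show "?a \<in> controls A1 A2" using a * by (simp add: controls_def)
    fix s assume s: "0 < s" "s < h"
    show "piecewise b1 b2 (x + b2 \<alpha> * s) ?a = b2 \<alpha>" "piecewise l1 l2 (x + b2 \<alpha> * s) ?a = l2 \<alpha>"
      using nonneg(1)[OF s] by (auto simp: piecewise_def mix_def)
    assume "x + b2 \<alpha> * s = 0"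
    then have "b2 \<alpha> = 0" by (rule nonneg(2)[OF s])
    then show "?a \<in> Z" using a * by (intro regular_control_in_Z) auto
  qed
qed

lemma V_stay:
  assumes h: "0 \<le> h" "h \<le> t" shows "V (t, 0) \<le> V (t - h, 0) - h * A"
proof (cases "h = 0")
  case False
  then have hpos: "h > 0" using h by simp
  have "A \<le> (V (t - h, 0) - V (t, 0)) / h"
    unfolding A_def
  proof (rule cSUP_least)
    obtain \<alpha>1 \<alpha>2 where *: "\<alpha>1 \<in> A1" "b1 \<alpha>1 = 0" "\<alpha>2 \<in> A2" "b2 \<alpha>2 = 0" by (rule resting_controls)
    have "(\<alpha>1, \<alpha>2, 1) \<in> Z" by (rule regular_control_in_Z) (use * in auto)
    then show "Z \<noteq> {}" by blast
    fix a assume a: "a \<in> Z"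
    then have c: "a \<in> controls A1 A2" "mix b1 b2 a = 0" using Z_upper by (auto simp: controls0_def)
    have "V (t, 0) \<le> V (t - h, 0 + 0 * h) + h * mix l1 l2 a"
      by (rule V_move[OF h c(1)]) (use c a in \<open>auto simp: piecewise_def split: prod.splits\<close>)
    then show "- mix l1 l2 a \<le> (V (t - h, 0) - V (t, 0)) / h" using hpos by (simp add: field_simps)
  qed
  then show ?thesis using hpos by (simp add: field_simps)
qed simp

lemma V_satisfies_moves: "moves V"
  unfolding moves_def using V_left_move V_right_move V_stay by blast

end

section \<open>Regularity and minimality of the value function\<close>

text \<open>Jensen's inequality in the form needed for straightening a trajectory: a point outside \<open>S\<close> would be
  separated from \<open>S\<close> by a line, and the separating inequality can be integrated.\<close>

lemma closed_convex_average:
  fixes f1 f2 :: "real \<Rightarrow> real"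
  assumes S: "convex S" "closed S" and ab: "a < b"
    and f1: "(f1 has_integral i1) {a..b}" and f2: "(f2 has_integral i2) {a..b}"
    and mem: "\<And>s. a < s \<Longrightarrow> s < b \<Longrightarrow> (f1 s, f2 s) \<in> S"
  shows "(i1 / (b - a), i2 / (b - a)) \<in> S"
proof (rule ccontr)
  assume "(i1 / (b - a), i2 / (b - a)) \<notin> S"
  from separating_hyperplane_closed_point[OF S this]
  obtain n c where n: "n \<bullet> (i1 / (b - a), i2 / (b - a)) < c" "\<forall>s\<in>S. c < n \<bullet> s" by auto
  obtain n1 n2 where nn: "n = (n1, n2)" by (cases n)
  have "((\<lambda>s. n1 * f1 s + n2 * f2 s) has_integral n1 * i1 + n2 * i2) {a..b}"
    by (intro has_integral_add has_integral_mult_right f1 f2)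
  then have I: "((\<lambda>s. n1 * f1 s + n2 * f2 s) has_integral n1 * i1 + n2 * i2) {a<..<b}"
    by (simp add: has_integral_Icc_iff_Ioo)
  have J: "((\<lambda>_. c) has_integral c * (b - a)) {a<..<b}"
    using has_integral_const_real[of c a b] ab by (simp add: has_integral_Icc_iff_Ioo mult.commute)
  have "c \<le> n1 * f1 s + n2 * f2 s" if "s \<in> {a<..<b}" for s
    using n(2) mem[of s] that by (fastforce simp: nn)
  then have "c * (b - a) \<le> n1 * i1 + n2 * i2" by (rule has_integral_le[OF J I])
  then have "c \<le> (n1 * i1 + n2 * i2) / (b - a)" using ab by (simp add: pos_le_divide_eq)
  then show False using n(1) by (simp add: nn add_divide_distrib)
qed

context junction_control begin

lemma V_time_upper:
  assumes "0 \<le> h" "h \<le> t" shows "V (t, x) \<le> V (t - h, x) + h * C"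
proof -
  obtain \<alpha>1 \<alpha>2 where *: "\<alpha>1 \<in> A1" "b1 \<alpha>1 = 0" "\<alpha>2 \<in> A2" "b2 \<alpha>2 = 0" by (rule resting_controls)
  have "l1 \<alpha>1 \<le> C" "l2 \<alpha>2 \<le> C" using l1_le[OF *(1)] l2_le[OF *(3)] by auto
  then have "h * l1 \<alpha>1 \<le> h * C" "h * l2 \<alpha>2 \<le> h * C" using assms by (auto intro: mult_left_mono)
  moreover have "x \<le> 0 \<Longrightarrow> V (t, x) \<le> V (t - h, x) + h * l1 \<alpha>1"
    using moves_left[OF V_satisfies_moves *(1) assms, of x] * by simp
  moreover have "0 \<le> x \<Longrightarrow> V (t, x) \<le> V (t - h, x) + h * l2 \<alpha>2"
    using moves_right[OF V_satisfies_moves *(3) assms, of x] * by simp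
  ultimately show ?thesis by (cases "x \<le> 0") linarith+
qed

text \<open>Cutting a trajectory short saves or costs at most \<open>C h\<close>, and the initial datum changes by at most
  \<open>Lg C h\<close> along the piece that is cut off.\<close>

lemma V_time_lower:
  assumes "0 \<le> h" "h \<le> t" shows "V (t - h, x) \<le> V (t, x) + (C + Lg * C) * h"
proof -
  have "V (t - h, x) - (C + Lg * C) * h \<le> V (t, x)"
  proof (rule V_ge)
    fix X a assume adm: "admissible t X a" and X0: "X 0 = x"
    have "V (t - h, X 0) \<le> cost (t - h) X a"
      using assms by (intro V_le admissible_restrict[OF adm]) auto
    moreover have "integral {0..t - h} (running_cost X a) + integral {t - h..t} (running_cost X a) = integral {0..t} (running_cost X a)"
      using running_cost_integrable[OF adm order_refl order_refl] assms
      by (intro Henstock_Kurzweil_Integration.integral_combine) auto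
    moreover have "\<bar>integral {t - h..t} (running_cost X a)\<bar> \<le> C * h"
      using running_cost_integral_abs_le[OF adm, of "t - h" t] assms by simp
    moreover have "\<bar>g (X t) - g (X (t - h))\<bar> \<le> Lg * (C * h)"
      using g_lipschitz[of "X t" "X (t - h)"] mult_left_mono[OF trajectory_speed[OF adm, of "t - h" t] Lg] assms
      by simp
    ultimately show "V (t - h, x) - (C + Lg * C) * h \<le> cost t X a"
      by (simp add: cost_def X0 abs_le_iff algebra_simps)
  qed
  then show ?thesis by simp
qed

text \<open>Within time \<open>h\<close> every point at distance \<open>\<delta> h\<close> can be reached, also across the junction.\<close>

lemma V_steer:
  assumes h: "0 \<le> h" "h \<le> t" and d: "\<bar>y - x\<bar> = \<delta> * h"
  shows "V (t, x) \<le> V (t - h, y) + h * C"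
proof -
  have one_side: "V (t, x) \<le> V (t - h, y) + h * C"
    if h: "0 \<le> h" "h \<le> t" and d: "\<bar>y - x\<bar> = \<delta> * h" and side: "x \<le> 0 \<and> y \<le> 0 \<or> 0 \<le> x \<and> 0 \<le> y" for t x y h
  proof (cases "h = 0")
    case True then show ?thesis using d by simp
  next
    case False
    define v where "v = (y - x) / h"
    have y: "y = x + v * h" using False by (simp add: v_def)
    have "\<bar>v\<bar> = \<delta>" using d False h by (simp add: v_def abs_divide)
    then have v: "\<bar>v\<bar> \<le> \<delta>" by simp
    from side show ?thesis
    proof
      assume s: "x \<le> 0 \<and> y \<le> 0"
      obtain \<alpha> where \<alpha>: "\<alpha> \<in> A1" "b1 \<alpha> = v" using S1.velocity_exists[OF v] by blast
      have "V (t, x) \<le> V (t - h, y) + h * l1 \<alpha>"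
        using moves_left[OF V_satisfies_moves \<alpha>(1) h, of x] s \<alpha>(2) y by simp
      moreover have "h * l1 \<alpha> \<le> h * C" using l1_le[OF \<alpha>(1)] h by (intro mult_left_mono) auto
      ultimately show ?thesis by linarith
    next
      assume s: "0 \<le> x \<and> 0 \<le> y"
      obtain \<alpha> where \<alpha>: "\<alpha> \<in> A2" "b2 \<alpha> = v" using S2.velocity_exists[OF v] by blast
      have "V (t, x) \<le> V (t - h, y) + h * l2 \<alpha>"
        using moves_right[OF V_satisfies_moves \<alpha>(1) h, of x] s \<alpha>(2) y by simp
      moreover have "h * l2 \<alpha> \<le> h * C" using l2_le[OF \<alpha>(1)] h by (intro mult_left_mono) auto
      ultimately show ?thesis by linarith
    qed
  qed
  show ?thesis
  proof (cases "x \<le> 0 \<and> y \<le> 0 \<or> 0 \<le> x \<and> 0 \<le> y")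
    case True then show ?thesis by (rule one_side[OF h d])
  next
    case False
    define h1 where "h1 = \<bar>x\<bar> / \<delta>"
    have \<delta>: "\<delta> > 0" by (rule S1.delta_pos)
    have x: "\<bar>x\<bar> = \<delta> * h1" using \<delta> by (simp add: h1_def)
    have "\<bar>y - x\<bar> = \<bar>y\<bar> + \<bar>x\<bar>" using False by (auto simp: abs_if)
    then have y: "\<bar>y\<bar> = \<delta> * (h - h1)" using d x by (simp add: algebra_simps)
    have h1: "0 \<le> h1" "h1 \<le> h"
    proof -
      show "0 \<le> h1" using \<delta> by (simp add: h1_def)
      have "0 \<le> \<delta> * (h - h1)" using y by (metis abs_ge_zero)
      then show "h1 \<le> h" using \<delta> by (simp add: zero_le_mult_iff)
    qed
    have "V (t, x) \<le> V (t - h1, 0) + h1 * C"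
      using h1 h x by (intro one_side) auto
    also have "V (t - h1, 0) \<le> V (t - h1 - (h - h1), y) + (h - h1) * C"
      using h1 h y by (intro one_side) auto
    finally show ?thesis by (simp add: algebra_simps)
  qed
qed

definition V_lip :: real where "V_lip = Lg + (2 * C + Lg * C) / \<delta> + (C + Lg * C)"

text \<open>For \<open>t\<close> long enough the other point can be reached; for shorter times \<open>V\<close> is still close to the initial
  datum, compared with the distance of the points.\<close>

lemma V_space:
  assumes t: "0 \<le> t" shows "V (t, x) \<le> V (t, y) + (Lg + (2 * C + Lg * C) / \<delta>) * \<bar>x - y\<bar>"
proof -
  have \<delta>: "\<delta> > 0" by (rule S1.delta_pos)
  define h where "h = \<bar>x - y\<bar> / \<delta>"
  have h: "0 \<le> h" "\<bar>y - x\<bar> = \<delta> * h" using \<delta> by (auto simp: h_def abs_minus_commute)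
  have Lg': "0 \<le> Lg * \<bar>x - y\<bar>" using Lg by simp
  have k: "(Lg + (2 * C + Lg * C) / \<delta>) * \<bar>x - y\<bar> = Lg * \<bar>x - y\<bar> + (2 * C + Lg * C) * h"
    by (simp add: h_def distrib_right)
  show ?thesis
  proof (cases "h \<le> t")
    case True
    have "V (t, x) \<le> V (t - h, y) + h * C" by (rule V_steer[OF h(1) True h(2)])
    also have "V (t - h, y) \<le> V (t, y) + (C + Lg * C) * h" by (rule V_time_lower[OF h(1) True])
    finally show ?thesis unfolding k using Lg' by (simp add: algebra_simps)
  next
    case False
    have "V (t, x) \<le> g x + t * C" using V_time_upper[OF t order_refl, of x] by (simp add: V_initial)
    moreover have "g y \<le> V (t, y) + (C + Lg * C) * t" using V_time_lower[OF t order_refl, of y] by (simp add: V_initial)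
    moreover have "g x - g y \<le> Lg * \<bar>x - y\<bar>" using g_lipschitz[of x y] by simp
    moreover have "(2 * C + Lg * C) * t \<le> (2 * C + Lg * C) * h"
      using False C_pos Lg by (intro mult_left_mono) auto
    ultimately show ?thesis unfolding k by (simp add: algebra_simps)
  qed
qed

lemma V_lipschitz:
  assumes "0 \<le> t" "0 \<le> s"
  shows "\<bar>V (t, x) - V (s, y)\<bar> \<le> V_lip * (\<bar>t - s\<bar> + \<bar>x - y\<bar>)"
proof -
  have \<delta>: "\<delta> > 0" by (rule S1.delta_pos)
  have one: "V (t, x) - V (s, y) \<le> V_lip * (\<bar>t - s\<bar> + \<bar>x - y\<bar>)" if "0 \<le> t" "0 \<le> s" for t s x y
  proof -
    have LC: "0 \<le> Lg * C" "0 \<le> (2 * C + Lg * C) / \<delta>" using Lg C_pos \<delta> by auto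
    have "V (t, x) \<le> V (s, x) + (C + Lg * C) * \<bar>t - s\<bar>"
    proof (cases "s \<le> t")
      case True
      have "V (t, x) \<le> V (t - (t - s), x) + (t - s) * C" using True that by (intro V_time_upper) auto
      moreover have "0 \<le> (Lg * C) * (t - s)" by (rule mult_nonneg_nonneg[OF LC(1)]) (use True in simp)
      then have "(t - s) * C \<le> (C + Lg * C) * (t - s)" by (simp add: algebra_simps)
      ultimately show ?thesis using True by simp
    next
      case False
      have "V (s - (s - t), x) \<le> V (s, x) + (C + Lg * C) * (s - t)" using False that by (intro V_time_lower) auto
      then show ?thesis using False by simp
    qed
    moreover have "V (s, x) \<le> V (s, y) + (Lg + (2 * C + Lg * C) / \<delta>) * \<bar>x - y\<bar>" by (rule V_space[OF that(2)])
    moreover have "(C + Lg * C) * \<bar>t - s\<bar> \<le> V_lip * \<bar>t - s\<bar>"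
      using LC Lg by (intro mult_right_mono) (auto simp: V_lip_def)
    moreover have "(Lg + (2 * C + Lg * C) / \<delta>) * \<bar>x - y\<bar> \<le> V_lip * \<bar>x - y\<bar>"
      using LC C_pos by (intro mult_right_mono) (auto simp: V_lip_def)
    ultimately show ?thesis by (simp add: distrib_left)
  qed
  show ?thesis using one[OF assms, of x y] one[OF assms(2,1), of y x]
    by (simp add: abs_le_iff abs_minus_commute)
qed

lemma V_extension_lipschitz:
  "\<bar>V (max t 0, x) - V (max s 0, y)\<bar> \<le> V_lip * (\<bar>t - s\<bar> + \<bar>x - y\<bar>)"
proof -
  have "\<bar>V (max t 0, x) - V (max s 0, y)\<bar> \<le> V_lip * (\<bar>max t 0 - max s 0\<bar> + \<bar>x - y\<bar>)"
    by (rule V_lipschitz) auto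
  also have "\<dots> \<le> V_lip * (\<bar>t - s\<bar> + \<bar>x - y\<bar>)"
    using Lg C_pos S1.delta_pos by (intro mult_left_mono) (auto simp: V_lip_def)
  finally show ?thesis .
qed

lemma V_continuous: "continuous_on time_space V"
proof -
  have "continuous_on time_space (\<lambda>z. V (max (fst z) 0, snd z))"
    by (rule lipschitz_plane_continuous[where L = V_lip]) (simp add: V_extension_lipschitz)
  then show ?thesis by (rule continuous_on_eq) (auto simp: time_space_def)
qed

text \<open>Away from the junction the trajectory stays in one half-line, and the averages of its velocity
  and of its running cost are the velocity and the cost of a single control.\<close>

lemma segment_cost:
  assumes w: "moves w" and adm: "admissible t X a" and s: "0 \<le> s1" "s1 \<le> s2" "s2 \<le> t"
    and nz: "\<And>s. s1 < s \<Longrightarrow> s < s2 \<Longrightarrow> X s \<noteq> 0"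
  shows "w (t - s1, X s1) \<le> w (t - s2, X s2) + integral {s1..s2} (running_cost X a)"
proof (cases "s1 = s2")
  case False
  then have lt: "s1 < s2" using s by simp
  have cont: "continuous_on {s1..s2} X"
    by (rule continuous_on_subset[OF admissible_continuous[OF adm]]) (use s in auto)
  have vi: "(velocity X a has_integral X s2 - X s1) {s1..s2}" by (rule velocity_has_integral[OF adm s])
  have ci: "(running_cost X a has_integral integral {s1..s2} (running_cost X a)) {s1..s2}"
    by (rule integrable_integral[OF running_cost_integrable[OF adm s(1,3)]])
  have ctl: "a u \<in> controls A1 A2" if "s1 < u" "u < s2" for u
    using admissible_controls[OF adm] that s by simp
  have conn: "connected (X ` {s1<..<s2})"
    by (rule connected_continuous_image[OF continuous_on_subset[OF cont]]) auto
  have zero: "0 \<notin> X ` {s1<..<s2}" using nz by force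
  have sign: "(\<forall>u\<in>{s1<..<s2}. X u < 0) \<or> (\<forall>u\<in>{s1<..<s2}. 0 < X u)"
  proof (rule ccontr)
    assume "\<not> ?thesis"
    then obtain u v where uv: "u \<in> {s1<..<s2}" "v \<in> {s1<..<s2}" "\<not> X u < 0" "\<not> 0 < X v" by blast
    then have "0 \<in> {X v..X u}" by auto
    then show False
      using connected_contains_Icc[OF conn imageI[OF uv(2)] imageI[OF uv(1)]] zero by blast
  qed
  have cl: "X s1 \<in> closure (X ` {s1<..<s2})" "X s2 \<in> closure (X ` {s1<..<s2})"
  proof -
    have "X ` closure {s1<..<s2} \<subseteq> closure (X ` {s1<..<s2})"
      by (rule image_closure_subset[OF _ closed_closure closure_subset]) (use cont lt in simp)
    then show "X s1 \<in> closure (X ` {s1<..<s2})" "X s2 \<in> closure (X ` {s1<..<s2})" using lt by auto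
  qed
  define m where "m = s2 - s1"
  have m: "m > 0" "t - s2 = t - s1 - m" using lt by (auto simp: m_def)
  have mt: "m \<le> t - s1" using s by (simp add: m_def)
  from sign show ?thesis
  proof
    assume neg: "\<forall>u\<in>{s1<..<s2}. X u < 0"
    then have "closure (X ` {s1<..<s2}) \<subseteq> {..0}" by (intro closure_minimal) (auto simp: less_imp_le)
    then have ends: "X s1 \<le> 0" "X s2 \<le> 0" using cl by auto
    have "((X s2 - X s1) / (s2 - s1), integral {s1..s2} (running_cost X a) / (s2 - s1)) \<in> (\<lambda>\<alpha>. (b1 \<alpha>, l1 \<alpha>)) ` A1"
    proof (rule closed_convex_average[OF S1.convex_graph S1.closed_graph lt vi ci])
      fix u assume u: "s1 < u" "u < s2"
      then show "(velocity X a u, running_cost X a u) \<in> (\<lambda>\<alpha>. (b1 \<alpha>, l1 \<alpha>)) ` A1"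
        using neg ctl[OF u] by (cases "a u") (auto simp: piecewise_def controls_def)
    qed
    then obtain \<alpha> where \<alpha>: "\<alpha> \<in> A1" "b1 \<alpha> = (X s2 - X s1) / m" "l1 \<alpha> = integral {s1..s2} (running_cost X a) / m"
      by (auto simp: m_def)
    have e: "X s1 + b1 \<alpha> * m = X s2" "m * l1 \<alpha> = integral {s1..s2} (running_cost X a)"
      using m by (simp_all add: \<alpha>(2,3))
    have "w (t - s1, X s1) \<le> w (t - s1 - m, X s1 + b1 \<alpha> * m) + m * l1 \<alpha>"
      by (rule moves_left[OF w \<alpha>(1)]) (use m mt s ends in \<open>simp_all add: e(1)\<close>)
    then show ?thesis by (simp only: e m(2)[symmetric])
  next
    assume pos: "\<forall>u\<in>{s1<..<s2}. 0 < X u"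
    then have "closure (X ` {s1<..<s2}) \<subseteq> {0..}" by (intro closure_minimal) (auto simp: less_imp_le)
    then have ends: "0 \<le> X s1" "0 \<le> X s2" using cl by auto
    have "((X s2 - X s1) / (s2 - s1), integral {s1..s2} (running_cost X a) / (s2 - s1)) \<in> (\<lambda>\<alpha>. (b2 \<alpha>, l2 \<alpha>)) ` A2"
    proof (rule closed_convex_average[OF S2.convex_graph S2.closed_graph lt vi ci])
      fix u assume u: "s1 < u" "u < s2"
      then have "0 < X u" using pos by simp
      then show "(velocity X a u, running_cost X a u) \<in> (\<lambda>\<alpha>. (b2 \<alpha>, l2 \<alpha>)) ` A2"
        using ctl[OF u] by (cases "a u") (auto simp: piecewise_def controls_def)
    qed
    then obtain \<alpha> where \<alpha>: "\<alpha> \<in> A2" "b2 \<alpha> = (X s2 - X s1) / m" "l2 \<alpha> = integral {s1..s2} (running_cost X a) / m"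
      by (auto simp: m_def)
    have e: "X s1 + b2 \<alpha> * m = X s2" "m * l2 \<alpha> = integral {s1..s2} (running_cost X a)"
      using m by (simp_all add: \<alpha>(2,3))
    have "w (t - s1, X s1) \<le> w (t - s1 - m, X s1 + b2 \<alpha> * m) + m * l2 \<alpha>"
      by (rule moves_right[OF w \<alpha>(1)]) (use m mt s ends in \<open>simp_all add: e(1)\<close>)
    then show ?thesis by (simp only: e m(2)[symmetric])
  qed
qed simp

lemma min_hamiltonian_le_A: "H1 p1 \<le> A" "H2 p2 \<le> A"
proof -
  obtain \<alpha>1 \<alpha>2 where *: "\<alpha>1 \<in> A1" "b1 \<alpha>1 = 0" "\<alpha>2 \<in> A2" "b2 \<alpha>2 = 0" by (rule resting_controls)
  obtain \<beta>1 where 1: "\<beta>1 \<in> A1" "b1 \<beta>1 = 0" "- l1 \<beta>1 = H1 p1" using S1.resting_control[OF p1] by blast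
  obtain \<beta>2 where 2: "\<beta>2 \<in> A2" "b2 \<beta>2 = 0" "- l2 \<beta>2 = H2 p2" using S2.resting_control[OF p2] by blast
  have "(\<beta>1, \<alpha>2, 1) \<in> Z" "(\<alpha>1, \<beta>2, 0) \<in> Z" using * 1 2 by (auto intro: regular_control_in_Z)
  from mix_le_A[OF this(1)] mix_le_A[OF this(2)] show "H1 p1 \<le> A" "H2 p2 \<le> A"
    using 1(3) 2(3) by (auto simp: mix_def)
qed

text \<open>Up to the first and after the last visit to the junction, averaging replaces the trajectory
  by a straight one of equal cost; between these two visits nothing is cheaper than staying.\<close>

lemma moves_le_cost:
  assumes w: "moves w" and init: "\<And>x. w (0, x) \<le> g x" and adm: "admissible t X a" and t: "0 \<le> t"
  shows "w (t, X 0) \<le> cost t X a"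
proof -
  define N where "N = {s \<in> {0..t}. X s = 0}"
  have i: "running_cost X a integrable_on {u..v}" if "0 \<le> u" "v \<le> t" for u v
    by (rule running_cost_integrable[OF adm that])
  show ?thesis
  proof (cases "N = {}")
    case True
    have "w (t - 0, X 0) \<le> w (t - t, X t) + integral {0..t} (running_cost X a)"
      by (rule segment_cost[OF w adm]) (use t True in \<open>auto simp: N_def\<close>)
    then show ?thesis using init[of "X t"] by (simp add: cost_def)
  next
    case False
    have "closed N" unfolding N_def
      by (rule continuous_closed_preimage_constant[OF admissible_continuous[OF adm]]) simp
    have bd: "bdd_below N" "bdd_above N" by (auto simp: N_def intro!: bdd_belowI[of _ 0] bdd_aboveI[of _ t])
    define \<tau>1 \<tau>2 where "\<tau>1 = Inf N" and "\<tau>2 = Sup N"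
    have \<tau>: "\<tau>1 \<in> N" "\<tau>2 \<in> N"
      unfolding \<tau>1_def \<tau>2_def by (rule closed_contains_Inf[OF False bd(1) \<open>closed N\<close>], rule closed_contains_Sup[OF False bd(2) \<open>closed N\<close>])
    then have z: "X \<tau>1 = 0" "X \<tau>2 = 0" "0 \<le> \<tau>1" "\<tau>1 \<le> t" "0 \<le> \<tau>2" "\<tau>2 \<le> t" by (auto simp: N_def)
    have bounds: "\<tau>1 \<le> s" "s \<le> \<tau>2" if "s \<in> N" for s
      unfolding \<tau>1_def \<tau>2_def using cInf_lower[OF that bd(1)] cSup_upper[OF that bd(2)] by auto
    have le: "\<tau>1 \<le> \<tau>2" using bounds(1)[OF \<tau>(2)] .
    have "w (t - 0, X 0) \<le> w (t - \<tau>1, X \<tau>1) + integral {0..\<tau>1} (running_cost X a)"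
    proof (rule segment_cost[OF w adm order_refl z(3,4)])
      fix s assume s: "0 < s" "s < \<tau>1"
      show "X s \<noteq> 0"
      proof
        assume "X s = 0"
        then have "s \<in> N" using s z by (simp add: N_def)
        then show False using bounds(1) s by fastforce
      qed
    qed
    moreover have "w (t - \<tau>1, 0) \<le> w (t - \<tau>2, 0) + integral {\<tau>1..\<tau>2} (running_cost X a)"
    proof -
      have "w (t - \<tau>1, 0) \<le> w (t - \<tau>1 - (\<tau>2 - \<tau>1), 0) - (\<tau>2 - \<tau>1) * A"
        using le z by (intro moves_stay[OF w]) auto
      moreover have "- A * (\<tau>2 - \<tau>1) - (kink p1 p2 (X \<tau>2) - kink p1 p2 (X \<tau>1)) \<le> integral {\<tau>1..\<tau>2} (running_cost X a)"
        by (rule cost_lower_bound[OF adm z(3) le z(6)]) (use min_hamiltonian_le_A in auto)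
      ultimately show ?thesis by (simp add: z mult.commute)
    qed
    moreover have "w (t - \<tau>2, X \<tau>2) \<le> w (t - t, X t) + integral {\<tau>2..t} (running_cost X a)"
    proof (rule segment_cost[OF w adm z(5,6) order_refl])
      fix s assume s: "\<tau>2 < s" "s < t"
      show "X s \<noteq> 0"
      proof
        assume "X s = 0"
        then have "s \<in> N" using s z by (simp add: N_def)
        then show False using bounds(2) s by fastforce
      qed
    qed
    moreover have "integral {0..\<tau>1} (running_cost X a) + integral {\<tau>1..t} (running_cost X a) = integral {0..t} (running_cost X a)"
      using z by (intro Henstock_Kurzweil_Integration.integral_combine i) auto
    moreover have "integral {\<tau>1..\<tau>2} (running_cost X a) + integral {\<tau>2..t} (running_cost X a) = integral {\<tau>1..t} (running_cost X a)"
      using z le by (intro Henstock_Kurzweil_Integration.integral_combine i) auto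
    ultimately show ?thesis using init[of "X t"] z by (simp add: cost_def)
  qed
qed

lemma moves_le_V:
  assumes "moves w" "\<And>x. w (0, x) \<le> g x" "0 \<le> t" shows "w (t, x) \<le> V (t, x)"
  by (rule V_ge) (use moves_le_cost[OF assms(1,2) _ assms(3)] in blast)

end

section \<open>The value function solves the equation\<close>

lemma eventually_along_ray:
  assumes ev: "\<forall>\<^sub>F y in nhds (t, x). P y"
  shows "\<exists>h0>0. \<forall>h. 0 < h \<longrightarrow> h < h0 \<longrightarrow> P (t - h, x + v * h :: real)"
proof -
  have "((\<lambda>h. (t - h, x + v * h)) \<longlongrightarrow> (t - 0, x + v * 0)) (at_right 0)" by (intro tendsto_intros)
  then have "\<forall>\<^sub>F h in at_right 0. P (t - h, x + v * h)"
    using ev unfolding filterlim_iff by simp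
  then show ?thesis unfolding eventually_at_right_field by blast
qed

lemma first_order_expansion:
  fixes J :: "real set"
  assumes d: "(\<phi> has_derivative (\<lambda>h. p * fst h + q * snd h)) (at (t, x) within {0<..} \<times> J)"
    and t: "t > 0" and e: "e > 0"
  shows "\<forall>\<^sub>F y in nhds (t, x). snd y \<in> J \<longrightarrow>
    \<bar>\<phi> y - \<phi> (t, x) - (p * (fst y - t) + q * (snd y - x))\<bar> \<le> e * (\<bar>fst y - t\<bar> + \<bar>snd y - x\<bar>)"
proof -
  obtain r where r: "r > 0" "\<And>y. y \<in> {0<..} \<times> J \<Longrightarrow> norm (y - (t, x)) < r \<Longrightarrow>
      norm (\<phi> y - \<phi> (t, x) - (p * fst (y - (t, x)) + q * snd (y - (t, x)))) \<le> e * norm (y - (t, x))"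
    using d e unfolding has_derivative_within_alt by blast
  have "\<forall>\<^sub>F y in nhds (t, x). y \<in> ball (t, x) (min r t)"
    by (rule eventually_nhds_in_open) (use r(1) t in auto)
  then show ?thesis
  proof (rule eventually_mono, intro impI)
    fix y assume y: "y \<in> ball (t, x) (min r t)" and J: "snd y \<in> J"
    have n: "norm (y - (t, x)) < min r t" using y by (simp add: dist_norm norm_minus_commute)
    have "\<bar>fst y - t\<bar> \<le> norm (y - (t, x))" using norm_fst_le[of "fst y - t" "snd y - x"] by (cases y) simp
    then have "fst y > 0" using n by auto
    then have "y \<in> {0<..} \<times> J" using J by (cases y) auto
    then have "\<bar>\<phi> y - \<phi> (t, x) - (p * (fst y - t) + q * (snd y - x))\<bar> \<le> e * norm (y - (t, x))"
      using r(2)[of y] n by simp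
    also have "norm (y - (t, x)) \<le> \<bar>fst y - t\<bar> + \<bar>snd y - x\<bar>"
      using norm_Pair_le[of "fst y - t" "snd y - x"] by (cases y) simp
    finally show "\<bar>\<phi> y - \<phi> (t, x) - (p * (fst y - t) + q * (snd y - x))\<bar> \<le> e * (\<bar>fst y - t\<bar> + \<bar>snd y - x\<bar>)"
      using e by simp
  qed
qed

lemma has_derivative_along_ray:
  fixes J :: "real set"
  assumes d: "(\<phi> has_derivative (\<lambda>h. p * fst h + q * snd h)) (at (t, x) within {0<..} \<times> J)"
    and J: "\<And>h. 0 \<le> h \<Longrightarrow> h \<le> h0 \<Longrightarrow> h < t \<and> x + v * h \<in> J"
  shows "((\<lambda>h. \<phi> (t - h, x + v * h)) has_real_derivative - p + v * q) (at 0 within {0..h0})"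
proof -
  have i: "((\<lambda>h. (t - h, x + v * h)) has_derivative (\<lambda>h. (- h, v * h))) (at 0 within {0..h0})"
    by (auto intro!: derivative_eq_intros)
  have "(\<phi> has_derivative (\<lambda>h. p * fst h + q * snd h))
      (at (t - 0, x + v * 0) within (\<lambda>h. (t - h, x + v * h)) ` {0..h0})"
  proof -
    have "(\<lambda>h. (t - h, x + v * h)) ` {0..h0} \<subseteq> {0<..} \<times> J" using J by fastforce
    from has_derivative_subset[OF d this] show ?thesis by simp
  qed
  from has_derivative_in_compose[OF i this]
  have "((\<lambda>h. \<phi> (t - h, x + v * h)) has_derivative (\<lambda>h. p * (- h) + q * (v * h))) (at 0 within {0..h0})"
    by (simp only: fst_conv snd_conv)
  moreover have "(\<lambda>h. p * (- h) + q * (v * h)) = (*) (- p + v * q)" by (simp add: fun_eq_iff algebra_simps)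
  ultimately show ?thesis by (simp only: has_field_derivative_def)
qed

lemma test_function_left_derivative:
  assumes "test_function \<phi>" "t > 0" "x \<le> 0"
  shows "\<exists>p q. (\<phi> has_derivative (\<lambda>h. p * fst h + q * snd h)) (at (t, x) within left_space)"
  using assms unfolding test_function_def C1_on_def by (meson SigmaI atMost_iff greaterThan_iff)

lemma test_function_right_derivative:
  assumes "test_function \<phi>" "t > 0" "0 \<le> x"
  shows "\<exists>p q. (\<phi> has_derivative (\<lambda>h. p * fst h + q * snd h)) (at (t, x) within right_space)"
  using assms unfolding test_function_def C1_on_def by (meson SigmaI atLeast_iff greaterThan_iff)

context junction_control begin

text \<open>A test function above \<open>V\<close> inherits each move of \<open>V\<close>, and the derivative of the resulting inequality
  along the motion is the claim.\<close>

lemma touching_above_inequality: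
  fixes J :: "real set"
  assumes eq: "\<phi> (t, x) = V (t, x)" and touch: "\<forall>\<^sub>F y in nhds (t, x). V y \<le> \<phi> y" and t: "t > 0"
    and d: "(\<phi> has_derivative (\<lambda>h. p * fst h + q * snd h)) (at (t, x) within {0<..} \<times> J)"
    and h1: "h1 > 0" "\<And>h. 0 \<le> h \<Longrightarrow> h \<le> h1 \<Longrightarrow> x + v * h \<in> J"
    and move: "\<And>h. 0 < h \<Longrightarrow> h \<le> h1 \<Longrightarrow> h \<le> t \<Longrightarrow> V (t, x) \<le> V (t - h, x + v * h) + h * c"
  shows "p - v * q \<le> c"
proof -
  obtain h2 where h2: "h2 > 0" "\<And>h. 0 < h \<Longrightarrow> h < h2 \<Longrightarrow> V (t - h, x + v * h) \<le> \<phi> (t - h, x + v * h)"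
    using eventually_along_ray[OF touch, of v] by blast
  define h0 where "h0 = min (min h1 h2) (t / 2)"
  have h0: "h0 > 0" "h0 \<le> h1" "h0 \<le> h2" "h0 < t" using h1 h2 t by (auto simp: h0_def)
  have "((\<lambda>h. \<phi> (t - h, x + v * h)) has_real_derivative - p + v * q) (at 0 within {0..h0})"
    by (rule has_derivative_along_ray[OF d]) (use h0 h1 in auto)
  then have "((\<lambda>h. \<phi> (t - h, x + v * h) + h * c - \<phi> (t, x)) has_real_derivative - p + v * q + c) (at 0 within {0..h0})"
    by (auto intro!: derivative_eq_intros)
  then have "0 \<le> - p + v * q + c"
  proof (rule right_derivative_nonneg[OF _ _ h0(1)])
    fix h assume h: "0 < h" "h < h0"
    then show "0 \<le> \<phi> (t - h, x + v * h) + h * c - \<phi> (t, x)"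
      using move[of h] h2(2)[of h] h0 eq by simp
  qed simp
  then show ?thesis by simp
qed

lemma left_touching_above_inequality:
  assumes eq: "\<phi> (t, x) = V (t, x)" and touch: "\<forall>\<^sub>F y in nhds (t, x). V y \<le> \<phi> y" and t: "t > 0"
    and d: "(\<phi> has_derivative (\<lambda>h. p * fst h + q * snd h)) (at (t, x) within left_space)"
    and \<alpha>: "\<alpha> \<in> A1" and x: "x < 0 \<or> x = 0 \<and> b1 \<alpha> \<le> 0"
  shows "- b1 \<alpha> * q - l1 \<alpha> \<le> - p"
proof -
  define h1 where "h1 = (if x < 0 then - x / (\<bar>b1 \<alpha>\<bar> + 1) else 1)"
  have h1: "h1 > 0" unfolding h1_def by (auto intro!: divide_neg_pos)
  have stays: "x + b1 \<alpha> * h \<le> 0" if h: "0 \<le> h" "h \<le> h1" for h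
  proof (cases "x < 0")
    case True
    have "\<bar>b1 \<alpha>\<bar> * h + h \<le> - x" using h True by (simp add: h1_def field_simps)
    moreover have "b1 \<alpha> * h \<le> \<bar>b1 \<alpha>\<bar> * h" using h by (intro mult_right_mono) auto
    ultimately show ?thesis using h by linarith
  next
    case False then show ?thesis using x h by (auto intro: mult_nonpos_nonneg)
  qed
  have "p - b1 \<alpha> * q \<le> l1 \<alpha>"
  proof (rule touching_above_inequality[OF eq touch t d h1])
    fix h assume h: "0 < h" "h \<le> h1" "h \<le> t"
    show "V (t, x) \<le> V (t - h, x + b1 \<alpha> * h) + h * l1 \<alpha>"
      using h x stays[of h] by (intro V_left_move[OF \<alpha>]) auto
  qed (use stays in auto)
  then show ?thesis by simp
qed

lemma right_touching_above_inequality: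
  assumes eq: "\<phi> (t, x) = V (t, x)" and touch: "\<forall>\<^sub>F y in nhds (t, x). V y \<le> \<phi> y" and t: "t > 0"
    and d: "(\<phi> has_derivative (\<lambda>h. p * fst h + q * snd h)) (at (t, x) within right_space)"
    and \<alpha>: "\<alpha> \<in> A2" and x: "x > 0 \<or> x = 0 \<and> 0 \<le> b2 \<alpha>"
  shows "- b2 \<alpha> * q - l2 \<alpha> \<le> - p"
proof -
  define h1 where "h1 = (if x > 0 then x / (\<bar>b2 \<alpha>\<bar> + 1) else 1)"
  have h1: "h1 > 0" unfolding h1_def by (auto intro!: divide_pos_pos)
  have stays: "0 \<le> x + b2 \<alpha> * h" if h: "0 \<le> h" "h \<le> h1" for h
  proof (cases "x > 0")
    case True
    have "\<bar>b2 \<alpha>\<bar> * h + h \<le> x" using h True by (simp add: h1_def field_simps)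
    moreover have "- \<bar>b2 \<alpha>\<bar> * h \<le> b2 \<alpha> * h" using h by (intro mult_right_mono) auto
    ultimately show ?thesis using h by linarith
  next
    case False then show ?thesis using x h by auto
  qed
  have "p - b2 \<alpha> * q \<le> l2 \<alpha>"
  proof (rule touching_above_inequality[OF eq touch t d h1])
    fix h assume h: "0 < h" "h \<le> h1" "h \<le> t"
    show "V (t, x) \<le> V (t - h, x + b2 \<alpha> * h) + h * l2 \<alpha>"
      using h x stays[of h] by (intro V_right_move[OF \<alpha>]) auto
  qed (use stays in auto)
  then show ?thesis by simp
qed

lemma V_subsolution:
  assumes tf: "test_function \<phi>" and t: "t > 0"
    and eq: "\<phi> (t, x) = V (t, x)" and touch: "\<forall>\<^sub>F y in nhds (t, x). V y \<le> \<phi> y"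
  shows "junction_lhs H1 H2 F \<phi> t x \<le> 0"
proof -
  consider "x < 0" | "x > 0" | "x = 0" by linarith
  then show ?thesis
  proof cases
    case 1
    obtain p q where d: "(\<phi> has_derivative (\<lambda>h. p * fst h + q * snd h)) (at (t, x) within left_space)"
      using test_function_left_derivative[OF tf t less_imp_le[OF 1]] by blast
    have "H1 q \<le> - p"
      by (rule S1.ham_le) (use left_touching_above_inequality[OF eq touch t d] 1 in auto)
    then show ?thesis using junction_lhs_left[OF d t 1] by simp
  next
    case 2
    obtain p q where d: "(\<phi> has_derivative (\<lambda>h. p * fst h + q * snd h)) (at (t, x) within right_space)"
      using test_function_right_derivative[OF tf t less_imp_le[OF 2]] by blast
    have "H2 q \<le> - p"
      by (rule S2.ham_le) (use right_touching_above_inequality[OF eq touch t d] 2 in auto)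
    then show ?thesis using junction_lhs_right[OF d t 2] by simp
  next
    case 3
    obtain p qL where L: "(\<phi> has_derivative (\<lambda>h. p * fst h + qL * snd h)) (at (t, x) within left_space)"
      using test_function_left_derivative[OF tf t eq_refl[OF 3]] by blast
    obtain p' qR where R: "(\<phi> has_derivative (\<lambda>h. p' * fst h + qR * snd h)) (at (t, x) within right_space)"
      using test_function_right_derivative[OF tf t eq_refl[OF 3[symmetric]]] by blast
    have lhs: "junction_lhs H1 H2 F \<phi> t x = p + F qL qR" "p' = p"
      using junction_lhs_zero[OF L[unfolded 3] R[unfolded 3] t] 3 by auto
    have "incr_part H1 p1 qL \<le> - p"
      by (rule S1.incr_part_le[OF p1]) (use left_touching_above_inequality[OF eq touch t L] 3 in auto)
    moreover have "decr_part H2 p2 qR \<le> - p"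
      by (rule S2.decr_part_le[OF p2]) (use right_touching_above_inequality[OF eq touch t R] 3 lhs(2) in auto)
    moreover have "p - 0 * qL \<le> - A"
    proof (rule touching_above_inequality[OF eq touch t L zero_less_one])
      fix h assume "0 < h" "h \<le> 1" "h \<le> t"
      then show "V (t, x) \<le> V (t - h, x + 0 * h) + h * - A" using V_stay[of h t] 3 by simp
    qed (use 3 in auto)
    ultimately show ?thesis unfolding lhs flux_limited_def by simp
  qed
qed

text \<open>Along a nearly optimal trajectory the dynamic programming principle compares the lower bound
  for the running cost with the first order expansion of the test function. Both contain the
  same slopes, and only the time derivative and the bound \<open>M\<close> for the Hamiltonians remain.\<close>

lemma touching_below_inequality:
  assumes eq: "\<phi> (t, x) = V (t, x)" and touch: "\<forall>\<^sub>F y in nhds (t, x). \<phi> y \<le> V y" and t: "t > 0"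
    and M: "\<forall>\<^sub>F y in nhds x. (y < 0 \<longrightarrow> H1 qL \<le> M) \<and> (y > 0 \<longrightarrow> H2 qR \<le> M) \<and> (y = 0 \<longrightarrow> A \<le> M)"
    and expansion: "\<And>e. e > 0 \<Longrightarrow> \<forall>\<^sub>F y in nhds (t, x).
      \<phi> (t, x) + p * (fst y - t) + (kink qL qR (snd y) - kink qL qR x)
        - e * (\<bar>fst y - t\<bar> + \<bar>snd y - x\<bar>) \<le> \<phi> y"
  shows "0 \<le> p + M"
proof (rule ccontr)
  assume "\<not> 0 \<le> p + M"
  define \<gamma> where "\<gamma> = - (p + M)"
  have \<gamma>: "\<gamma> > 0" using \<open>\<not> 0 \<le> p + M\<close> by (simp add: \<gamma>_def)
  define e where "e = \<gamma> / (3 * (1 + C))"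
  have e: "e > 0" "e * (1 + C) = \<gamma> / 3" using \<gamma> C_pos by (simp_all add: e_def divide_simps)
  have "\<forall>\<^sub>F y in nhds (t, x). \<phi> (t, x) + p * (fst y - t) + (kink qL qR (snd y) - kink qL qR x)
        - e * (\<bar>fst y - t\<bar> + \<bar>snd y - x\<bar>) \<le> V y"
    using touch expansion[OF e(1)] by eventually_elim linarith
  then obtain r1 where r1: "r1 > 0" "\<And>y. dist y (t, x) < r1 \<Longrightarrow>
      \<phi> (t, x) + p * (fst y - t) + (kink qL qR (snd y) - kink qL qR x)
        - e * (\<bar>fst y - t\<bar> + \<bar>snd y - x\<bar>) \<le> V y"
    unfolding eventually_nhds_metric by blast
  obtain r2 where r2: "r2 > 0" "\<And>y. dist y x < r2 \<Longrightarrow>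
      (y < 0 \<longrightarrow> H1 qL \<le> M) \<and> (y > 0 \<longrightarrow> H2 qR \<le> M) \<and> (y = 0 \<longrightarrow> A \<le> M)"
    using M unfolding eventually_nhds_metric by blast
  define h where "h = min t (min r1 r2 / (2 * (1 + C)))"
  have h: "h > 0" "h \<le> t" using t r1(1) r2(1) C_pos by (auto simp: h_def)
  have "h \<le> min r1 r2 / (2 * (1 + C))" by (simp add: h_def)
  then have "h * (2 * (1 + C)) \<le> min r1 r2" using C_pos by (subst (asm) pos_le_divide_eq) auto
  then have "(h + C * h) + (h + C * h) \<le> min r1 r2" by (simp add: algebra_simps)
  moreover have "h + C * h > 0" using h C_pos by (simp add: add_pos_pos)
  ultimately have small: "h + C * h < r1" "h + C * h < r2" by linarith+
  obtain X a where adm: "admissible t X a" and X0: "X 0 = x" and opt: "cost t X a < V (t, x) + \<gamma> / 3 * h"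
    using V_near_optimal[of "\<gamma> / 3 * h" t x] \<gamma> h by auto
  have near: "\<bar>X s - x\<bar> \<le> C * h" if "0 \<le> s" "s \<le> h" for s
  proof -
    have "\<bar>X s - X 0\<bar> \<le> C * (s - 0)" using that h by (intro trajectory_speed[OF adm]) auto
    also have "C * (s - 0) \<le> C * h" using that C_pos by (intro mult_left_mono) auto
    finally show ?thesis by (simp add: X0)
  qed
  have "cost t X a = integral {0..h} (running_cost X a) + cost (t - h) (\<lambda>s. X (s + h)) (\<lambda>s. a (s + h))"
    using h by (intro cost_tail[OF adm]) auto
  moreover have "V (t - h, X h) \<le> cost (t - h) (\<lambda>s. X (s + h)) (\<lambda>s. a (s + h))"
    using V_le[OF admissible_tail[OF adm, of h]] h by simp
  moreover have "- M * (h - 0) - (kink qL qR (X h) - kink qL qR (X 0)) \<le> integral {0..h} (running_cost X a)"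
  proof (rule cost_lower_bound[OF adm order_refl _ h(2)])
    fix s assume "0 < s" "s < h"
    then have "dist (X s) x < r2" using near[of s] small(2) h by (simp add: dist_real_def)
    then show "(X s < 0 \<longrightarrow> H1 qL \<le> M) \<and> (X s > 0 \<longrightarrow> H2 qR \<le> M) \<and> (X s = 0 \<longrightarrow> A \<le> M)" by (rule r2(2))
  qed (use h in simp)
  moreover have "\<phi> (t, x) - p * h + (kink qL qR (X h) - kink qL qR x) - e * (h + \<bar>X h - x\<bar>) \<le> V (t - h, X h)"
  proof -
    have "dist (t - h, X h) (t, x) \<le> \<bar>(t - h) - t\<bar> + \<bar>X h - x\<bar>"
      using norm_Pair_le[of "(t - h) - t" "X h - x"] by (simp add: dist_norm)
    also have "\<dots> < r1" using near[of h] small(1) h by simp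
    finally show ?thesis using r1(2)[of "(t - h, X h)"] h by simp
  qed
  moreover have "e * (h + \<bar>X h - x\<bar>) \<le> \<gamma> / 3 * h"
  proof -
    have "e * (h + \<bar>X h - x\<bar>) \<le> e * (h + C * h)" using near[of h] h e by (intro mult_left_mono) auto
    also have "\<dots> = e * (1 + C) * h" by (simp add: algebra_simps)
    finally show ?thesis unfolding e(2) .
  qed
  ultimately have "- M * h - p * h < 2 * (\<gamma> / 3 * h)" using opt eq X0 by simp
  moreover have "- M * h - p * h = \<gamma> * h" by (simp add: \<gamma>_def algebra_simps)
  moreover have "\<gamma> * h > 0" using \<gamma> h by simp
  ultimately show False by simp
qed

lemma V_supersolution:
  assumes tf: "test_function \<phi>" and t: "t > 0"
    and eq: "\<phi> (t, x) = V (t, x)" and touch: "\<forall>\<^sub>F y in nhds (t, x). \<phi> y \<le> V y"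
  shows "0 \<le> junction_lhs H1 H2 F \<phi> t x"
proof -
  have kink_same: "kink q q y = q * y" for q y by (auto simp: kink_def min_def max_def)
  have off_junction: "0 \<le> p + M"
    if d: "(\<phi> has_derivative (\<lambda>h. p * fst h + q * snd h)) (at (t, x) within {0<..} \<times> J)"
      and J: "\<forall>\<^sub>F y in nhds x. y \<in> J \<and> (y < 0 \<longrightarrow> H1 q \<le> M) \<and> (y > 0 \<longrightarrow> H2 q \<le> M) \<and> (y = 0 \<longrightarrow> A \<le> M)"
    for p q M J
  proof (rule touching_below_inequality[OF eq touch t, of q M q])
    show "\<forall>\<^sub>F y in nhds x. (y < 0 \<longrightarrow> H1 q \<le> M) \<and> (y > 0 \<longrightarrow> H2 q \<le> M) \<and> (y = 0 \<longrightarrow> A \<le> M)"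
      using J by (rule eventually_mono) blast
    fix e :: real assume "e > 0"
    have "(snd \<longlongrightarrow> snd (t, x)) (nhds (t, x))" by (intro tendsto_snd filterlim_ident)
    moreover have "\<forall>\<^sub>F y in nhds x. y \<in> J" using J by (rule eventually_mono) blast
    ultimately have "\<forall>\<^sub>F y in nhds (t, x). snd y \<in> J" using eventually_compose_filterlim by fastforce
    with first_order_expansion[OF d t \<open>e > 0\<close>]
    show "\<forall>\<^sub>F y in nhds (t, x). \<phi> (t, x) + p * (fst y - t) + (kink q q (snd y) - kink q q x)
        - e * (\<bar>fst y - t\<bar> + \<bar>snd y - x\<bar>) \<le> \<phi> y"
    proof eventually_elim
      case (elim y)
      then have "\<bar>\<phi> y - \<phi> (t, x) - (p * (fst y - t) + q * (snd y - x))\<bar> \<le> e * (\<bar>fst y - t\<bar> + \<bar>snd y - x\<bar>)" by simp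
      then show ?case unfolding kink_same abs_le_iff right_diff_distrib by linarith
    qed
  qed
  consider "x < 0" | "x > 0" | "x = 0" by linarith
  then show ?thesis
  proof cases
    case 1
    obtain p q where d: "(\<phi> has_derivative (\<lambda>h. p * fst h + q * snd h)) (at (t, x) within left_space)"
      using test_function_left_derivative[OF tf t less_imp_le[OF 1]] by blast
    have "0 \<le> p + H1 q"
      by (rule off_junction[OF d]) (use eventually_nhds_in_open[of "{..<0}" x] 1 in \<open>auto elim: eventually_mono\<close>)
    then show ?thesis using junction_lhs_left[OF d t 1] by simp
  next
    case 2
    obtain p q where d: "(\<phi> has_derivative (\<lambda>h. p * fst h + q * snd h)) (at (t, x) within right_space)"
      using test_function_right_derivative[OF tf t less_imp_le[OF 2]] by blast
    have "0 \<le> p + H2 q"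
      by (rule off_junction[OF d]) (use eventually_nhds_in_open[of "{0<..}" x] 2 in \<open>auto elim: eventually_mono\<close>)
    then show ?thesis using junction_lhs_right[OF d t 2] by simp
  next
    case 3
    obtain p qL where L: "(\<phi> has_derivative (\<lambda>h. p * fst h + qL * snd h)) (at (t, 0) within left_space)"
      using test_function_left_derivative[OF tf t, of 0] by auto
    obtain p' qR where R: "(\<phi> has_derivative (\<lambda>h. p' * fst h + qR * snd h)) (at (t, 0) within right_space)"
      using test_function_right_derivative[OF tf t, of 0] by auto
    have lhs: "junction_lhs H1 H2 F \<phi> t x = p + F qL qR" "p' = p"
      using junction_lhs_zero[OF L R t] 3 by auto
    \<comment> \<open>A larger slope on the left or a smaller one on the right only lowers the expansion, and at the
      slopes \<open>sL\<close> and \<open>sR\<close> the Hamiltonians equal the monotone parts in \<open>F\<close>.\<close>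
    define sL where "sL = max qL p1"
    define sR where "sR = min qR p2"
    have FM: "H1 sL \<le> F qL qR" "H2 sR \<le> F qL qR" "A \<le> F qL qR"
      using F_ge(2)[of qL qR] F_ge(3)[of qR qL] F_ge(1)[of qL qR]
      by (simp_all add: sL_def sR_def S1.incr_part_eq S2.decr_part_eq)
    have "0 \<le> p + F qL qR"
    proof (rule touching_below_inequality[OF eq touch t, of sL _ sR])
      show "\<forall>\<^sub>F y in nhds x. (y < 0 \<longrightarrow> H1 sL \<le> F qL qR) \<and> (y > 0 \<longrightarrow> H2 sR \<le> F qL qR) \<and> (y = 0 \<longrightarrow> A \<le> F qL qR)"
        using FM by (intro always_eventually) simp
      fix e :: real assume e: "e > 0"
      from first_order_expansion[OF L t e] first_order_expansion[OF R t e]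
      show "\<forall>\<^sub>F y in nhds (t, x). \<phi> (t, x) + p * (fst y - t) + (kink sL sR (snd y) - kink sL sR x)
          - e * (\<bar>fst y - t\<bar> + \<bar>snd y - x\<bar>) \<le> \<phi> y"
        unfolding 3
      proof eventually_elim
        case (elim y)
        have "kink sL sR 0 = 0" by (simp add: kink_def)
        show ?case
        proof (cases "snd y \<le> 0")
          case True
          have "sL * snd y \<le> qL * snd y" using True by (intro mult_right_mono_neg) (auto simp: sL_def)
          moreover have "kink sL sR (snd y) = sL * snd y" using True by (simp add: kink_def)
          moreover have "\<bar>\<phi> y - \<phi> (t, 0) - (p * (fst y - t) + qL * (snd y - 0))\<bar> \<le> e * (\<bar>fst y - t\<bar> + \<bar>snd y - 0\<bar>)"
            using elim(1) True by simp
          ultimately show ?thesis using \<open>kink sL sR 0 = 0\<close> unfolding abs_le_iff diff_0_right by linarith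
        next
          case False
          have "sR * snd y \<le> qR * snd y" using False by (intro mult_right_mono) (auto simp: sR_def)
          moreover have "kink sL sR (snd y) = sR * snd y" using False by (simp add: kink_def)
          moreover have "\<bar>\<phi> y - \<phi> (t, 0) - (p * (fst y - t) + qR * (snd y - 0))\<bar> \<le> e * (\<bar>fst y - t\<bar> + \<bar>snd y - 0\<bar>)"
            using elim(2) False lhs(2) by simp
          ultimately show ?thesis using \<open>kink sL sR 0 = 0\<close> unfolding abs_le_iff diff_0_right by linarith
        qed
      qed
    qed
    then show ?thesis using lhs by simp
  qed
qed

lemma V_junction_solution: "junction_solution H1 H2 F g V"
  unfolding junction_solution_def
proof (intro conjI allI impI)
  show "locally_bounded V" unfolding locally_bounded_def
  proof (intro allI impI)
    fix K assume "compact K \<and> K \<subseteq> time_space"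
    then show "bounded (V ` K)"
      by (intro compact_imp_bounded compact_continuous_image continuous_on_subset[OF V_continuous]) auto
  qed
next
  fix \<phi> t x assume a: "test_function \<phi> \<and> t > 0 \<and> touches_from_above \<phi> (usc_env V) (t, x)"
  then have t: "t > 0" and touch: "ereal (\<phi> (t, x)) = usc_env V (t, x)" "\<forall>\<^sub>F y in nhds (t, x). usc_env V y \<le> ereal (\<phi> y)"
    by (auto simp: touches_from_above_def)
  have "\<phi> (t, x) = V (t, x)"
    using touch(1) t upper_continuous[OF V_continuous, of "(t, x)"] by (simp add: time_space_def)
  moreover have "\<forall>\<^sub>F y in nhds (t, x). V y \<le> \<phi> y"
    using touch(2) eventually_positive_time[OF t, of x]
    by eventually_elim (simp add: upper_continuous[OF V_continuous])
  ultimately show "junction_lhs H1 H2 F \<phi> t x \<le> 0" using V_subsolution a by blast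
next
  fix \<phi> t x assume a: "test_function \<phi> \<and> t > 0 \<and> touches_from_below \<phi> (lsc_env V) (t, x)"
  then have t: "t > 0" and touch: "ereal (\<phi> (t, x)) = lsc_env V (t, x)" "\<forall>\<^sub>F y in nhds (t, x). ereal (\<phi> y) \<le> lsc_env V y"
    by (auto simp: touches_from_below_def)
  have "\<phi> (t, x) = V (t, x)"
    using touch(1) t lower_continuous[OF V_continuous, of "(t, x)"] by (simp add: time_space_def)
  moreover have "\<forall>\<^sub>F y in nhds (t, x). \<phi> y \<le> V y"
    using touch(2) eventually_positive_time[OF t, of x]
    by eventually_elim (simp add: lower_continuous[OF V_continuous])
  ultimately show "0 \<le> junction_lhs H1 H2 F \<phi> t x" using V_supersolution a by blast
next
  fix x
  have "(0, x) \<in> time_space" by (simp add: time_space_def)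
  then show "usc_env V (0, x) \<le> ereal (g x)" "ereal (g x) \<le> lsc_env V (0, x)"
    by (simp_all add: upper_continuous[OF V_continuous] lower_continuous[OF V_continuous] V_initial)
qed

text \<open>Comparison applies to functions that are Lipschitz on the whole plane, so \<open>V\<close> is extended
  to negative times by its initial values.\<close>

lemma V_le_supersolution:
  assumes super: "glued_supersolution H1 H2 F \<zeta>" and init: "\<And>x. g x \<le> \<zeta> (0, x)" and t: "0 \<le> t"
  shows "V (t, x) \<le> \<zeta> (t, x)"
proof -
  define W where "W = (\<lambda>z. V (max (fst z) 0, snd z))"
  have W: "W (s, y) = V (s, y)" if "0 \<le> s" for s y using that by (simp add: W_def)
  have "moves W"
    unfolding moves_def
  proof (intro conjI ballI allI impI)
    fix \<alpha> t h x assume "\<alpha> \<in> A1" "0 \<le> h" "h \<le> t" "x \<le> 0" "x + b1 \<alpha> * h \<le> 0"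
    then show "W (t, x) \<le> W (t - h, x + b1 \<alpha> * h) + h * l1 \<alpha>" using V_left_move by (simp add: W)
  next
    fix \<alpha> t h x assume "\<alpha> \<in> A2" "0 \<le> h" "h \<le> t" "0 \<le> x" "0 \<le> x + b2 \<alpha> * h"
    then show "W (t, x) \<le> W (t - h, x + b2 \<alpha> * h) + h * l2 \<alpha>" using V_right_move by (simp add: W)
  next
    fix t h :: real assume "0 \<le> h" "h \<le> t"
    then show "W (t, 0) \<le> W (t - h, 0) - h * A" using V_stay by (simp add: W)
  qed
  moreover have "\<bar>W (t, x) - W (s, y)\<bar> \<le> V_lip * (\<bar>t - s\<bar> + \<bar>x - y\<bar>)" for t s x y
    by (simp add: W_def V_extension_lipschitz)
  moreover have "W (0, x) \<le> \<zeta> (0, x)" for x using init[of x] by (simp add: W V_initial)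
  ultimately have "W (t, x) \<le> \<zeta> (t, x)" using comparison[OF _ _ super _ t] by blast
  then show ?thesis using t by (simp add: W)
qed

theorem V_unique_solution: "unique_junction_solution H1 H2 F g V"
  unfolding unique_junction_solution_def
proof (intro conjI allI impI ballI)
  fix v z assume sol: "junction_solution H1 H2 F g v" and z: "z \<in> time_space"
  have lb: "locally_bounded v" using sol by (simp add: junction_solution_def)
  obtain t x where tx: "z = (t, x)" "0 \<le> t" using z by (cases z) (auto simp: time_space_def)
  have "upper v (t, x) \<le> V (t, x)"
    by (rule moves_le_V[OF subsolution_moves[OF junction_solution_subsolution[OF sol]]
          junction_solution_initial(1)[OF sol] tx(2)])
  moreover have "V (t, x) \<le> lower v (t, x)"
    by (rule V_le_supersolution[OF junction_solution_supersolution[OF sol]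
          junction_solution_initial(2)[OF sol] tx(2)])
  ultimately show "v z = V z" using le_upper[OF lb z] lower_le[OF lb z] tx by simp
qed (rule V_junction_solution)

end

section \<open>The two value functions\<close>

context junction_control begin

lemma U_plus_eq_V:
  assumes "Z = controls0_reg A1 A2 b1 b2"
  shows "(\<lambda>(t, x). U_plus A1 A2 b1 l1 b2 l2 g x t) = V"
proof (rule ext, clarify)
  fix t x
  have "trajectories_reg A1 A2 b1 b2 t x = {(X, a). admissible t X a \<and> X 0 = x}"
    unfolding trajectories_reg_def admissible_def assms[symmetric] by (auto simp: trajectories_def)
  then show "U_plus A1 A2 b1 l1 b2 l2 g x t = V (t, x)"
    unfolding U_plus_def V_def fst_conv snd_conv
    by (intro INF_cong) (auto simp: total_cost_eq)
qed

text \<open>The restriction to \<open>Z\<close> holds automatically here, because the velocity vanishes almost everywhere at the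
  junction.\<close>

lemma U_minus_eq_V:
  assumes "Z = controls0 A1 A2 b1 b2"
  shows "(\<lambda>(t, x). U_minus A1 A2 b1 l1 b2 l2 g x t) = V"
proof (rule ext, clarify)
  fix t x
  have AE_Z: "AE s in lebesgue_on {0<..<t}. X s = 0 \<longrightarrow> a s \<in> Z"
    if "(X, a) \<in> trajectories A1 A2 b1 b2 t x" for X a
  proof -
    have a: "a \<in> lebesgue_on {0<..<t} \<rightarrow>\<^sub>M restrict_space borel (controls A1 A2)"
      and d: "AE s in lebesgue_on {0<..<t}. (X has_real_derivative velocity X a s) (at s)"
      using that by (auto simp: trajectories_def)
    show ?thesis using zero_velocity_at_junction[OF d] AE_space
    proof eventually_elim
      case (elim s)
      have "a s \<in> controls A1 A2" using measurable_space[OF a elim(2)] by (simp add: space_restrict_space)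
      then show ?case using elim(1) by (auto simp: assms controls0_def piecewise_def mix_def split: prod.splits)
    qed
  qed
  have "(X, a) \<in> trajectories A1 A2 b1 b2 t x \<longleftrightarrow> admissible t X a \<and> X 0 = x" for X a
  proof -
    have "(X, a) \<in> trajectories A1 A2 b1 b2 t x \<longleftrightarrow>
        (X, a) \<in> trajectories A1 A2 b1 b2 t (X 0) \<and> X 0 = x"
      by (auto simp: trajectories_def)
    then show ?thesis using AE_Z[of X a] unfolding admissible_def by blast
  qed
  then have "trajectories A1 A2 b1 b2 t x = {(X, a). admissible t X a \<and> X 0 = x}" by auto
  then show "U_minus A1 A2 b1 l1 b2 l2 g x t = V (t, x)"
    unfolding U_minus_def V_def fst_conv snd_conv
    by (intro INF_cong) (auto simp: total_cost_eq)
qed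

end

theorem theorem7p7:
  fixes A1 :: "'a::metric_space set" and A2 :: "'b::metric_space set"
    and b1 l1 :: "'a \<Rightarrow> real" and b2 l2 :: "'b \<Rightarrow> real"
    and g :: "real \<Rightarrow> real" and \<delta> p1 p2 :: real and H1 H2 :: "real \<Rightarrow> real"
  assumes "compact A1" and "compact A2"
    and "continuous_on A1 b1" and "continuous_on A1 l1"
    and "continuous_on A2 b2" and "continuous_on A2 l2"
    and "bounded (b1 ` A1)" and "bounded (l1 ` A1)"
    and "bounded (b2 ` A2)" and "bounded (l2 ` A2)"
    and "closed ((\<lambda>\<alpha>. (b1 \<alpha>, l1 \<alpha>)) ` A1)" and "convex ((\<lambda>\<alpha>. (b1 \<alpha>, l1 \<alpha>)) ` A1)"
    and "closed ((\<lambda>\<alpha>. (b2 \<alpha>, l2 \<alpha>)) ` A2)" and "convex ((\<lambda>\<alpha>. (b2 \<alpha>, l2 \<alpha>)) ` A2)"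
    and "\<delta> > 0"
    and "{-\<delta>..\<delta>} \<subseteq> (\<lambda>\<alpha>. - b1 \<alpha>) ` A1" and "{-\<delta>..\<delta>} \<subseteq> (\<lambda>\<alpha>. - b2 \<alpha>) ` A2"
    and "\<exists>L. L-lipschitz_on UNIV g"
    and "H1 = hamiltonian A1 b1 l1" and "H2 = hamiltonian A2 b2 l2"
    and "is_arg_min H1 (\<lambda>_. True) p1" and "is_arg_min H2 (\<lambda>_. True) p2"
  shows "unique_junction_solution H1 H2
           (flux_limited H1 p1 H2 p2 (H_T A1 A2 b1 l1 b2 l2)) g
           (\<lambda>(t, x). U_minus A1 A2 b1 l1 b2 l2 g x t) \<and>
         unique_junction_solution H1 H2
           (flux_limited H1 p1 H2 p2 (H_T_reg A1 A2 b1 l1 b2 l2)) g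
           (\<lambda>(t, x). U_plus A1 A2 b1 l1 b2 l2 g x t)"
proof -
  have "bounded (b1 ` A1 \<union> l1 ` A1 \<union> b2 ` A2 \<union> l2 ` A2)" using assms(7-10) by simp
  then obtain C where C: "C > 0" "\<forall>x\<in>b1 ` A1 \<union> l1 ` A1 \<union> b2 ` A2 \<union> l2 ` A2. norm x \<le> C"
    unfolding bounded_pos by blast
  obtain Lg where Lg: "Lg-lipschitz_on UNIV g" using assms(18) by blast
  have control: "junction_control A1 A2 b1 l1 b2 l2 \<delta> p1 p2 C Lg g Z"
    if "controls0_reg A1 A2 b1 b2 \<subseteq> Z" "Z \<subseteq> controls0 A1 A2 b1 b2" for Z
  proof unfold_locales
    show "\<bar>g x - g y\<bar> \<le> Lg * \<bar>x - y\<bar>" for x y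
      using lipschitz_onD[OF Lg, of x y] by (simp add: dist_real_def)
    show "0 \<le> Lg" by (rule lipschitz_on_nonneg[OF Lg])
  qed (use assms C that in auto)
  have reg: "controls0_reg A1 A2 b1 b2 \<subseteq> controls0 A1 A2 b1 b2"
    by (auto simp: controls0_reg_def controls0_def)
  interpret minus: junction_control A1 A2 b1 l1 b2 l2 \<delta> p1 p2 C Lg g "controls0 A1 A2 b1 b2"
    by (rule control[OF reg order_refl])
  interpret plus: junction_control A1 A2 b1 l1 b2 l2 \<delta> p1 p2 C Lg g "controls0_reg A1 A2 b1 b2"
    by (rule control[OF order_refl reg])
  show ?thesis
    using minus.V_unique_solution plus.V_unique_solution
    unfolding minus.A_def plus.A_def H_T_def[symmetric] H_T_reg_def[symmetric]
      minus.U_minus_eq_V[OF refl, symmetric] plus.U_plus_eq_V[OF refl, symmetric] assms(19,20)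
    by blast
qed

end
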